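(* Let $q\in L_2(0,\pi)$ (complex-valued), $h,H\in\mathbb C$, and suppose all eigenvalues of $L(q,h,H)$ are simple, with spectral data $\{\rho_n,\alpha_n\}_{n\ge1}$. Then for each fixed $x\in[0,\pi]$: $\psi(x),\tilde\psi(x)\in m$, the operators $R(x),\tilde R(x)$ are bounded on $m$, $\psi(x)$ satisfies $\tilde\psi(x)=(I+\tilde R(x))\psi(x)$, and the operator $I+\tilde R(x)$ has a bounded inverse on $m$ given by $(I+\tilde R(x))^{-1}=I-R(x)$; in particular, this equation is uniquely solvable in $m$.
   Context: $L(q,h,H)$: $-y''+q(x)y=\lambda y$ on $(0,\pi)$, $y'(0)-hy(0)=0$, $y'(\pi)+Hy(\pi)=0$. $\varphi(x,\rho)$ solves $-y''+qy=\rho^2y$ with $\varphi(0,\rho)=1,\varphi'(0,\rho)=h$. Eigenvalues $\lambda_n$ numbered so that $\rho_n=\sqrt{\lambda_n}=n-1+\frac{\omega}{\pi n}+\frac{\varkappa_n}{n}$ with $\{\varkappa_n\}\in l_2$, $\arg\rho_n\in[-\tfrac\pi2,\tfrac\pi2)$; $\alpha_n=(\int_0^\pi\varphi^2(x,\rho_n)dx)^{-1}$. Put $\tilde\rho_n=n-1$, $\tilde\alpha_1=\frac1\pi$, $\tilde\alpha_n=\frac2\pi$ ($n\ge2$), $\tilde\varphi(x,\rho)=\cos\rho x$; $\rho_{n0}=\rho_n,\rho_{n1}=\tilde\rho_n,\alpha_{n0}=\alpha_n,\alpha_{n1}=\tilde\alpha_n$; $\varphi_{ni}(x)=\varphi(x,\rho_{ni})$,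 $\dot\varphi_{n1}(x)=\partial_\rho\varphi(x,\rho)|_{\rho=\rho_{n1}}$; $\hat\rho_n=\rho_{n0}-\rho_{n1}$, $T_n=\begin{bmatrix}\hat\rho_n&1\\0&1\end{bmatrix}$. Define $(\psi_{n0}(x),\psi_{n1}(x))^T=T_n^{-1}(\varphi_{n0}(x),\varphi_{n1}(x))^T$ if $\rho_{n0}\ne\rho_{n1}$ and $=(\dot\varphi_{n1}(x),\varphi_{n1}(x))^T$ if $\rho_{n0}=\rho_{n1}$. Let $D(x,\rho,\theta)=\int_0^x\varphi(t,\rho)\varphi(t,\theta)dt$, $\dot D=\partial_\rho D$. For $n,k\ge1$, $[R_{ni,kj}(x)]_{i,j=0,1}=T_n^{-1}\begin{bmatrix}\alpha_{k0}D(x,\rho_{n0},\rho_{k0})&-\alpha_{k1}D(x,\rho_{n0},\rho_{k1})\\\alpha_{k0}D(x,\rho_{n1},\rho_{k0})&-\alpha_{k1}D(x,\rho_{n1},\rho_{k1})\end{bmatrix}T_k$ if $\rho_{n0}\ne\rho_{n1}$, and $=\begin{bmatrix}\alpha_{k0}\dot D(x,\rho_{n1},\rho_{k0})&-\alpha_{k1}\dot D(x,\rho_{n1},\rho_{k1})\\\alpha_{k0}D(x,\rho_{n1},\rho_{k0})&-\alpha_{k1}D(x,\rho_{n1},\rho_{k1})\end{bmatrix}T_k$ if $\rho_{n0}=\rho_{n1}$. $\tilde\psi_{ni}$, $\tilde D$, $\tilde R_{ni,kj}$ are defined in the same way with $\varphi$ replaced by $\tilde\varphi$ (so $\tilde D(x,\rho,\theta)=\int_0^x\cos\rho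 t\cos\theta t\,dt$). $m$ is the Banach space of bounded sequences $a=[a_{ni}]_{n\ge1,i=0,1}$ with sup norm, $I$ its identity, $\psi(x)=[\psi_{ni}(x)]$, $\tilde\psi(x)=[\tilde\psi_{ni}(x)]$, $(R(x)a)_{ni}=\sum_{k,j}R_{ni,kj}(x)a_{kj}$ and similarly $\tilde R(x)$. *)

theory Defs
  imports "HOL-Analysis.Analysis"
begin

text \<open>Solutions of -y'' + q y = lam y on [0,pi] are understood in the Caratheodory
  sense (q is only in L_2): y and its quasi-derivative yd are absolutely continuous,
  y(x) = y(0) + int_0^x yd and yd(x) = yd(0) + int_0^x (q - lam) y.  Functions are
  normalised to 0 outside [0,pi].\<close>

definition is_sol :: "(real \<Rightarrow> complex) \<Rightarrow> complex \<Rightarrow> (real \<Rightarrow> complex) \<Rightarrow> (real \<Rightarrow> complex) \<Rightarrow> bool" where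
  "is_sol q lam y yd \<longleftrightarrow>
     yd integrable_on {0..pi} \<and> (\<lambda>t. (q t - lam) * y t) integrable_on {0..pi} \<and>
     (\<forall>x\<in>{0..pi}. y x = y 0 + integral {0..x} yd \<and>
                   yd x = yd 0 + integral {0..x} (\<lambda>t. (q t - lam) * y t)) \<and>
     (\<forall>x. x \<notin> {0..pi} \<longrightarrow> y x = 0 \<and> yd x = 0)"

definition phi_pair :: "(real \<Rightarrow> complex) \<Rightarrow> complex \<Rightarrow> complex \<Rightarrow> (real \<Rightarrow> complex) \<times> (real \<Rightarrow> complex)" where
  "phi_pair q h rho = (THE p. is_sol q (rho ^ 2) (fst p) (snd p) \<and> fst p 0 = 1 \<and> snd p 0 = h)"

definition phi :: "(real \<Rightarrow> complex) \<Rightarrow> complex \<Rightarrow> real \<Rightarrow> complex \<Rightarrow> complex" where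
  "phi q h x rho = fst (phi_pair q h rho) x"

definition phid :: "(real \<Rightarrow> complex) \<Rightarrow> complex \<Rightarrow> real \<Rightarrow> complex \<Rightarrow> complex" where
  "phid q h x rho = snd (phi_pair q h rho) x"

definition is_eigenvalue :: "(real \<Rightarrow> complex) \<Rightarrow> complex \<Rightarrow> complex \<Rightarrow> complex \<Rightarrow> bool" where
  "is_eigenvalue q h H lam \<longleftrightarrow>
     (\<exists>y yd. is_sol q lam y yd \<and> (\<exists>x\<in>{0..pi}. y x \<noteq> 0) \<and>
            yd 0 - h * y 0 = 0 \<and> yd pi + H * y pi = 0)"

text \<open>Characteristic function Delta(lam) = phi'(pi,rho) + H phi(pi,rho), rho^2 = lam;
  its zeros are exactly the eigenvalues, and the (algebraic) multiplicity of an
  eigenvalue is its multiplicity as a zero of Delta.\<close>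
definition char_fun :: "(real \<Rightarrow> complex) \<Rightarrow> complex \<Rightarrow> complex \<Rightarrow> complex \<Rightarrow> complex" where
  "char_fun q h H lam = phid q h pi (csqrt lam) + H * phi q h pi (csqrt lam)"

definition simple_eigenvalue :: "(real \<Rightarrow> complex) \<Rightarrow> complex \<Rightarrow> complex \<Rightarrow> complex \<Rightarrow> bool" where
  "simple_eigenvalue q h H lam \<longleftrightarrow>
     is_eigenvalue q h H lam \<and> deriv (char_fun q h H) lam \<noteq> 0"

definition omega :: "(real \<Rightarrow> complex) \<Rightarrow> complex \<Rightarrow> complex \<Rightarrow> complex" where
  "omega q h H = h + H + integral {0..pi} q / 2"

definition spectral_numbering :: "(real \<Rightarrow> complex) \<Rightarrow> complex \<Rightarrow> complex \<Rightarrow> (nat \<Rightarrow> complex) \<Rightarrow> bool" where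
  "spectral_numbering q h H rho \<longleftrightarrow>
     {lam. is_eigenvalue q h H lam} = {rho n ^ 2 | n. n \<ge> 1} \<and>
     inj_on (\<lambda>n. rho n ^ 2) {1..} \<and>
     (\<forall>n\<ge>1. - (pi/2) \<le> Arg (rho n) \<and> Arg (rho n) < pi/2) \<and>
     summable (\<lambda>n. (cmod (of_nat (Suc n) * (rho (Suc n) - of_nat n) - omega q h H / pi))^2)"

definition alpha :: "(real \<Rightarrow> complex) \<Rightarrow> complex \<Rightarrow> (nat \<Rightarrow> complex) \<Rightarrow> nat \<Rightarrow> complex" where
  "alpha q h rho n = inverse (integral {0..pi} (\<lambda>x. (phi q h x (rho n))^2))"

text \<open>rho_{n0} = rho_n, rho_{n1} = n-1; alpha_{n0} = alpha_n, alpha_{n1} = tilde alpha_n.\<close>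
definition rr :: "(nat \<Rightarrow> complex) \<Rightarrow> nat \<Rightarrow> nat \<Rightarrow> complex" where
  "rr rho n i = (if i = 0 then rho n else of_nat (n - 1))"

definition aa :: "(nat \<Rightarrow> complex) \<Rightarrow> nat \<Rightarrow> nat \<Rightarrow> complex" where
  "aa al n i = (if i = 0 then al n else if n = 1 then of_real (1/pi) else of_real (2/pi))"

definition rhat :: "(nat \<Rightarrow> complex) \<Rightarrow> nat \<Rightarrow> complex" where
  "rhat rho n = rr rho n 0 - rr rho n 1"

definition phi0 :: "real \<Rightarrow> complex \<Rightarrow> complex" where
  "phi0 x rho = cos (rho * of_real x)"

text \<open>psi as an element indexed by n >= 1, i in {0,1}; zero elsewhere.
  T_n^{-1} = [[1/rhat_n, -1/rhat_n],[0,1]].\<close>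
definition psiv :: "(real \<Rightarrow> complex \<Rightarrow> complex) \<Rightarrow> (nat \<Rightarrow> complex) \<Rightarrow> real \<Rightarrow> nat \<Rightarrow> nat \<Rightarrow> complex" where
  "psiv Phi rho x n i =
     (if n \<ge> 1 \<and> i < 2 then
        (if rr rho n 0 \<noteq> rr rho n 1 then
           (if i = 0 then (Phi x (rr rho n 0) - Phi x (rr rho n 1)) / rhat rho n
            else Phi x (rr rho n 1))
         else
           (if i = 0 then deriv (\<lambda>r. Phi x r) (rr rho n 1) else Phi x (rr rho n 1)))
      else 0)"

definition DD :: "(real \<Rightarrow> complex \<Rightarrow> complex) \<Rightarrow> real \<Rightarrow> complex \<Rightarrow> complex \<Rightarrow> complex" where
  "DD Phi x r s = integral {0..x} (\<lambda>t. Phi t r * Phi t s)"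

text \<open>Right multiplication by T_k = [[rhat_k,1],[0,1]] and left multiplication by T_n^{-1}.\<close>
definition mulT :: "(nat \<Rightarrow> nat \<Rightarrow> complex) \<Rightarrow> complex \<Rightarrow> nat \<Rightarrow> nat \<Rightarrow> complex" where
  "mulT M r i j = (if j = 0 then M i 0 * r else M i 0 + M i 1)"

definition Tinvmul :: "complex \<Rightarrow> (nat \<Rightarrow> nat \<Rightarrow> complex) \<Rightarrow> nat \<Rightarrow> nat \<Rightarrow> complex" where
  "Tinvmul r M i j = (if i = 0 then (M 0 j - M 1 j) / r else M 1 j)"

definition Rm :: "(real \<Rightarrow> complex \<Rightarrow> complex) \<Rightarrow> (nat \<Rightarrow> complex) \<Rightarrow> (nat \<Rightarrow> complex) \<Rightarrow> real \<Rightarrow> nat \<Rightarrow> nat \<Rightarrow> nat \<Rightarrow> nat \<Rightarrow> complex" where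
  "Rm Phi rho al x n i k j =
     (let sg = (\<lambda>j'. if j' = 0 then aa al k 0 else - aa al k 1) in
      if rr rho n 0 \<noteq> rr rho n 1 then
        Tinvmul (rhat rho n)
          (mulT (\<lambda>i' j'. sg j' * DD Phi x (rr rho n i') (rr rho k j')) (rhat rho k)) i j
      else
        mulT (\<lambda>i' j'. sg j' * (if i' = 0 then deriv (\<lambda>r. DD Phi x r (rr rho k j')) (rr rho n 1)
                                else DD Phi x (rr rho n 1) (rr rho k j'))) (rhat rho k) i j)"

definition in_m :: "(nat \<Rightarrow> nat \<Rightarrow> complex) \<Rightarrow> bool" where
  "in_m a \<longleftrightarrow> (\<forall>n i. (n = 0 \<or> i \<ge> 2) \<longrightarrow> a n i = 0) \<and>
              (\<exists>C. \<forall>n\<ge>1. \<forall>i<2. cmod (a n i) \<le> C)"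

definition m_norm :: "(nat \<Rightarrow> nat \<Rightarrow> complex) \<Rightarrow> real" where
  "m_norm a = (SUP p\<in>{(n,i). n \<ge> 1 \<and> i < 2}. cmod (a (fst p) (snd p)))"

definition op_apply :: "(nat \<Rightarrow> nat \<Rightarrow> nat \<Rightarrow> nat \<Rightarrow> complex) \<Rightarrow> (nat \<Rightarrow> nat \<Rightarrow> complex) \<Rightarrow> nat \<Rightarrow> nat \<Rightarrow> complex" where
  "op_apply R a n i =
     (if n \<ge> 1 \<and> i < 2 then (\<Sum>k. \<Sum>j<2. R n i (Suc k) j * a (Suc k) j) else 0)"

definition bounded_op_m :: "(nat \<Rightarrow> nat \<Rightarrow> nat \<Rightarrow> nat \<Rightarrow> complex) \<Rightarrow> bool" where
  "bounded_op_m R \<longleftrightarrow>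
     (\<exists>C. \<forall>a. in_m a \<longrightarrow>
        (\<forall>n\<ge>1. \<forall>i<2. summable (\<lambda>k. \<Sum>j<2. R n i (Suc k) j * a (Suc k) j)) \<and>
        in_m (op_apply R a) \<and> m_norm (op_apply R a) \<le> C * m_norm a)"

definition I_plus :: "(nat \<Rightarrow> nat \<Rightarrow> nat \<Rightarrow> nat \<Rightarrow> complex) \<Rightarrow> (nat \<Rightarrow> nat \<Rightarrow> complex) \<Rightarrow> nat \<Rightarrow> nat \<Rightarrow> complex" where
  "I_plus R a n i = a n i + op_apply R a n i"

definition I_minus :: "(nat \<Rightarrow> nat \<Rightarrow> nat \<Rightarrow> nat \<Rightarrow> complex) \<Rightarrow> (nat \<Rightarrow> nat \<Rightarrow> complex) \<Rightarrow> nat \<Rightarrow> nat \<Rightarrow> complex" where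
  "I_minus R a n i = a n i - op_apply R a n i"

end

theory Submission
  imports Defs "HOL-Complex_Analysis.Complex_Analysis"
begin

text \<open>Write \<open>\<lambda> = \<rho>\<^sup>2\<close>. Let \<open>\<chi>\<close> be the solution satisfying the boundary condition at \<open>\<pi>\<close> and \<open>\<Delta>\<close> the characteristic
  function. The function \<open>- \<chi>(x, \<lambda>) / \<Delta>(\<lambda>)\<close> has residue \<open>\<alpha>\<^sub>n \<phi>(x, \<lambda>\<^sub>n)\<close> at \<open>\<lambda>\<^sub>n\<close>, so integrating it against an entire
  function \<open>E\<close> over the circles \<open>\<bar>\<lambda>\<bar> = (N + 1/2)\<^sup>2\<close> expands \<open>E\<close> in the products \<open>\<alpha>\<^sub>n E(\<lambda>\<^sub>n) D(x, \<lambda>\<^sub>n, \<mu>)\<close>, provided \<open>E\<close> grows no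
  faster than \<open>exp (\<bar>Im \<rho>\<bar> x) / \<bar>\<rho>\<bar>\<close>. Taking for \<open>E\<close> the kernel of the other problem, once for \<open>L\<close> and once for the
  problem with zero potential, gives the bilinear identity that encodes both \<open>R' R = R' - R\<close> and \<open>R R' = R' - R\<close>,
  where \<open>R'\<close> denotes the operator of the free problem; neither the transformation operators nor the completeness of
  the eigenfunctions is needed. The main equation follows in the same way from the difference of two such contour
  integrals. Since \<open>D(x, \<rho>, \<theta>) = O(1 / (1 + \<bar>\<rho> - \<theta>\<bar>))\<close> near the real axis, Cauchy estimates for the divided differences
  in \<open>T\<^sub>n\<^sup>-\<^sup>1\<close> bound the matrix entries by a constant times \<open>1 / (k (1 + \<bar>n - k\<bar>))\<close>, whose row sums are bounded.\<close>

section \<open>Integrals with an integrable weight\<close>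

text \<open>With a complex potential there is no orthogonality to rely on, and the integral of
  \<phi>^2 could vanish; simplicity of the eigenvalues excludes this, because \<Delta>' at an
  eigenvalue is a nonzero multiple of that integral. Solutions have merely absolutely continuous
  derivatives, so integration by parts and holomorphy in \<lambda> have to be proved for integrable
  weights. Passing from \<rho> to \<lambda> makes all functions entire and all poles simple, also at
  0. The radii are chosen because |sin(\<pi> \<rho>)| is at least exp(\<pi> |Im \<rho>|) / 4 for
  |\<rho>| = N + 1/2, and because for large N each of the two problems has exactly its first N + 1
  eigenvalues inside, so that the two families of residues are paired index by index. The factor T_k
  turns the nearly cancelling pair at index k into quantities of size 1/k; neither this nor the
  off-diagonal decay of D is summable alone, but their product is. The scalar identities hold for
  all complex arguments, so they can be differentiated, which is what coinciding nodes
  require.\<close>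

lemma absolutely_integrable_mult_continuous:
  fixes w f :: "real \<Rightarrow> complex"
  assumes "w absolutely_integrable_on {a..b}" "continuous_on {a..b} f"
  shows "(\<lambda>t. w t * f t) absolutely_integrable_on {a..b}"
proof -
  have "bounded (f ` {a..b})"
    using assms(2) compact_continuous_image compact_imp_bounded by blast
  moreover have "f \<in> borel_measurable (lebesgue_on {a..b})"
    by (rule continuous_imp_measurable_on_sets_lebesgue[OF assms(2)]) simp
  ultimately have "(\<lambda>t. f t * w t) absolutely_integrable_on {a..b}"
    using absolutely_integrable_bounded_measurable_product[OF bilinear_times, of f "{a..b}" w] assms(1)
    by auto
  then show ?thesis by (simp add: mult.commute)
qed

lemma norm_integrable:
  fixes w :: "real \<Rightarrow> complex"
  assumes "w absolutely_integrable_on S"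
  shows "(\<lambda>t. cmod (w t)) integrable_on S"
  using assms absolutely_integrable_on_def by blast

lemma norm_integral_mult_le:
  fixes w f :: "real \<Rightarrow> complex"
  assumes w: "w absolutely_integrable_on {a..b}" and f: "continuous_on {a..b} f"
    and B: "\<And>t. t \<in> {a..b} \<Longrightarrow> cmod (f t) \<le> B"
  shows "cmod (integral {a..b} (\<lambda>t. w t * f t)) \<le> B * integral {a..b} (\<lambda>t. cmod (w t))"
proof -
  have "cmod (integral {a..b} (\<lambda>t. w t * f t)) \<le> integral {a..b} (\<lambda>t. B * cmod (w t))"
  proof (rule integral_norm_bound_integral)
    show "(\<lambda>t. w t * f t) integrable_on {a..b}"
      using absolutely_integrable_mult_continuous[OF w f] absolutely_integrable_on_def by blast
    show "(\<lambda>t. B * cmod (w t)) integrable_on {a..b}"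
      using norm_integrable[OF w] by (rule integrable_on_mult_right)
    show "cmod (w t * f t) \<le> B * cmod (w t)" if "t \<in> {a..b}" for t
      using B[OF that] by (simp add: norm_mult mult.commute mult_right_mono)
  qed
  then show ?thesis by simp
qed

lemma absolutely_integrable_subinterval_real:
  fixes w :: "real \<Rightarrow> complex"
  assumes "w absolutely_integrable_on {a..b}" "a \<le> c" "d \<le> b"
  shows "w absolutely_integrable_on {c..d}"
  using assms by (intro absolutely_integrable_on_subinterval[OF assms(1)]) auto

lemma absolutely_integrable_imp_integrable:
  fixes w :: "real \<Rightarrow> complex"
  assumes "w absolutely_integrable_on S"
  shows "w integrable_on S"
  using assms absolutely_integrable_on_def by blast

lemma integral_cmod_mono:
  fixes w :: "real \<Rightarrow> complex"
  assumes "w absolutely_integrable_on {a..b}" "a \<le> c" "d \<le> b"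
  shows "integral {c..d} (\<lambda>t. cmod (w t)) \<le> integral {a..b} (\<lambda>t. cmod (w t))"
  using assms norm_integrable absolutely_integrable_subinterval_real[OF assms]
  by (intro integral_subset_le) auto

text \<open>With \<open>F t = \<integral>\<^sub>0\<^sup>t u b - u t v t + \<integral>\<^sub>0\<^sup>t u' v\<close> one has
  \<open>F t - F s = O(\<bar>t - s\<bar> \<integral>\<^sub>s\<^sup>t \<bar>b\<bar>)\<close>, so \<open>F\<close> has derivative 0 everywhere, although \<open>v\<close> need
  not be differentiable.\<close>

lemma product_rule_indefinite_integral:
  fixes u u' v b :: "real \<Rightarrow> complex"
  assumes u: "\<And>t. t \<in> {0..X} \<Longrightarrow> (u has_vector_derivative u' t) (at t within {0..X})"
    and u': "continuous_on {0..X} u'"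
    and b: "b absolutely_integrable_on {0..X}"
    and v: "\<And>t. t \<in> {0..X} \<Longrightarrow> v t = v 0 + integral {0..t} b"
    and x: "x \<in> {0..X}"
  shows "((\<lambda>t. u' t * v t + u t * b t) has_integral u x * v x - u 0 * v 0) {0..x}"
proof -
  have uc: "continuous_on {0..X} u"
    using u by (meson continuous_on_eq_continuous_within has_vector_derivative_continuous)
  have bi: "b integrable_on {0..X}" using b by (rule absolutely_integrable_imp_integrable)
  have "continuous_on {0..X} (\<lambda>t. v 0 + integral {0..t} b)"
    by (intro continuous_intros indefinite_integral_continuous_1 bi)
  then have vc: "continuous_on {0..X} v"
    by (rule continuous_on_eq) (rule v[symmetric])
  define F where "F t = integral {0..t} (\<lambda>t. b t * u t) - u t * v t + integral {0..t} (\<lambda>t. u' t * v t)" for t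
  define B where "B t = integral {0..t} (\<lambda>t. cmod (b t))" for t
  have Bc: "continuous_on {0..X} B"
    unfolding B_def by (intro indefinite_integral_continuous_1 norm_integrable b)
  obtain K where K: "\<And>t. t \<in> {0..X} \<Longrightarrow> cmod (u' t) \<le> K" and "K \<ge> 0"
    using compact_imp_bounded[OF compact_continuous_image[OF u' compact_Icc]]
    unfolding bounded_iff by (metis imageI norm_ge_zero order_trans x)
  have ub: "(\<lambda>t. b t * u t) integrable_on {0..X}" 
    using absolutely_integrable_mult_continuous[OF b uc] by (rule absolutely_integrable_imp_integrable)
  have u'v: "(\<lambda>t. u' t * v t) integrable_on {0..X}" 
    by (intro integrable_continuous_interval continuous_intros u' vc)
  have comb: "integral {0..t} g - integral {0..s} g = integral {s..t} g"
    if "g integrable_on {0..X}" "0 \<le> s" "s \<le> t" "t \<le> X" for g :: "real \<Rightarrow> complex" and s t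
    using Henstock_Kurzweil_Integration.integral_combine[of 0 s t g] that
     integrable_subinterval_real[OF that(1), of 0 t] by (auto simp: algebra_simps)
  have combr: "B t - B s = integral {s..t} (\<lambda>t. cmod (b t))"
    if "0 \<le> s" "s \<le> t" "t \<le> X" for s t
    using Henstock_Kurzweil_Integration.integral_combine[of 0 s t "\<lambda>t. cmod (b t)"] that
     integrable_subinterval_real[OF norm_integrable[OF b], of 0 t] by (auto simp: B_def algebra_simps)
  have inc: "cmod (F t - F s) \<le> 2 * K * (t - s) * (B t - B s)" if st: "0 \<le> s" "s \<le> t" "t \<le> X" for s t
  proof -
    have sub: "{s..t} \<subseteq> {0..X}" using st by auto
    have b': "b absolutely_integrable_on {s..t}"
      using absolutely_integrable_subinterval_real[OF b] st by auto
    have ucs: "continuous_on {s..t} u" and u'cs: "continuous_on {s..t} u'" and vcs: "continuous_on {s..t} v"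
      using uc u' vc sub continuous_on_subset by blast+
    have iu': "(u' has_integral u t - u s) {s..t}"
      using st u by (intro fundamental_theorem_of_calculus)
        (auto intro: has_vector_derivative_within_subset[OF u sub])
    have vts: "v t - v s = integral {s..t} b"
      using v[of t] v[of s] comb[OF bi st] st by auto
    have i1: "integral {s..t} (\<lambda>r. b r * u r) = integral {s..t} (\<lambda>r. b r * (u r - u s)) + u s * (v t - v s)"
    proof -
      have "(\<lambda>r. b r * (u r - u s)) integrable_on {s..t}"
        by (intro absolutely_integrable_imp_integrable absolutely_integrable_mult_continuous b'
              continuous_intros ucs)
      moreover have "(\<lambda>r. b r * u s) integrable_on {s..t}"
        by (intro absolutely_integrable_imp_integrable absolutely_integrable_mult_continuous b'
              continuous_intros)
      ultimately have "integral {s..t} (\<lambda>r. b r * (u r - u s) + b r * u s)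
          = integral {s..t} (\<lambda>r. b r * (u r - u s)) + integral {s..t} (\<lambda>r. b r * u s)"
        by (rule Henstock_Kurzweil_Integration.integral_add)
      then show ?thesis unfolding vts by (simp add: algebra_simps)
    qed
    have i2: "integral {s..t} (\<lambda>r. u' r * v r) = integral {s..t} (\<lambda>r. u' r * (v r - v t)) + (u t - u s) * v t"
    proof -
      have "(\<lambda>r. u' r * (v r - v t)) integrable_on {s..t}" "(\<lambda>r. u' r * v t) integrable_on {s..t}"
        by (intro integrable_continuous_interval continuous_intros u'cs vcs)+
      then have "integral {s..t} (\<lambda>r. u' r * (v r - v t) + u' r * v t)
          = integral {s..t} (\<lambda>r. u' r * (v r - v t)) + integral {s..t} (\<lambda>r. u' r * v t)"
        by (rule Henstock_Kurzweil_Integration.integral_add)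
      then show ?thesis using iu' by (simp add: algebra_simps integral_unique)
    qed
    have "F t - F s = integral {s..t} (\<lambda>r. b r * (u r - u s)) + integral {s..t} (\<lambda>r. u' r * (v r - v t))"
      using i1 i2 comb[OF ub st] comb[OF u'v st] unfolding F_def by algebra
    also have "cmod \<dots> \<le> cmod (integral {s..t} (\<lambda>r. b r * (u r - u s)))
        + cmod (integral {s..t} (\<lambda>r. u' r * (v r - v t)))"
      by (rule norm_triangle_ineq)
    also have "\<dots> \<le> (K * (t - s)) * (B t - B s) + (K * (B t - B s)) * (t - s)"
    proof (rule add_mono)
      have "cmod (u r - u s) \<le> K * (t - s)" if r: "r \<in> {s..t}" for r
      proof -
        have "(u' has_integral u r - u s) (cbox s r)"
          unfolding cbox_interval using r st 
          by (intro fundamental_theorem_of_calculus)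
             (auto intro: has_vector_derivative_within_subset[OF u, of _ "{s..r}"])
        then have "cmod (u r - u s) \<le> K * Henstock_Kurzweil_Integration.content (cbox s r)"
          using r st by (intro has_integral_bound[OF \<open>K \<ge> 0\<close>]) (auto intro: K)
        also have "\<dots> \<le> K * (t - s)" using r \<open>K \<ge> 0\<close> by (auto intro: mult_left_mono)
        finally show ?thesis .
      qed
      then show "cmod (integral {s..t} (\<lambda>r. b r * (u r - u s))) \<le> (K * (t - s)) * (B t - B s)"
        unfolding combr[OF st] by (intro norm_integral_mult_le b' continuous_intros ucs)
    next
      have "cmod (u' r * (v r - v t)) \<le> K * (B t - B s)" if r: "r \<in> {s..t}" for r
      proof -
        have "v t - v r = integral {r..t} b"
          using v[of t] v[of r] comb[OF bi, of r t] st r by auto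
        then have "cmod (v r - v t) \<le> integral {r..t} (\<lambda>t. cmod (b t))"
          using Henstock_Kurzweil_Integration.integral_norm_bound_integral[of b "{r..t}" "\<lambda>t. cmod (b t)"]
            absolutely_integrable_subinterval_real[OF b', of r t] r
          by (subst norm_minus_commute) (auto simp: norm_integrable absolutely_integrable_imp_integrable)
        also have "\<dots> \<le> B t - B s" unfolding combr[OF st] using r
          by (intro integral_cmod_mono[OF b']) auto
        finally show ?thesis using K[of r] r st \<open>K \<ge> 0\<close> by (auto simp: norm_mult intro!: mult_mono)
      qed
      moreover have "0 \<le> B t - B s" 
        unfolding combr[OF st] by (intro integral_nonneg norm_integrable b') auto
      moreover have "((\<lambda>r. u' r * (v r - v t)) has_integral integral {s..t} (\<lambda>r. u' r * (v r - v t))) (cbox s t)"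
        unfolding cbox_interval
        by (intro integrable_integral integrable_continuous_interval continuous_intros u'cs vcs)
      ultimately have "cmod (integral {s..t} (\<lambda>r. u' r * (v r - v t))) \<le> K * (B t - B s) * Henstock_Kurzweil_Integration.content (cbox s t)"
        using \<open>K \<ge> 0\<close> by (intro has_integral_bound) auto
      then show "cmod (integral {s..t} (\<lambda>r. u' r * (v r - v t))) \<le> (K * (B t - B s)) * (t - s)"
        using st by simp
    qed
    finally show ?thesis by (simp add: algebra_simps)
  qed
  have inc': "cmod (F t - F s) \<le> 2 * K * \<bar>t - s\<bar> * \<bar>B t - B s\<bar>" if "s \<in> {0..X}" "t \<in> {0..X}" for s t
  proof (cases "s \<le> t")
    case True
    have "0 \<le> B t - B s" 
      unfolding combr[of s t, OF _ True] using True that combr[of s t] 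
      by (auto intro!: integral_nonneg norm_integrable absolutely_integrable_subinterval_real[OF b])
    then show ?thesis using inc[of s t] that True by auto
  next
    case False
    have "0 \<le> B s - B t" 
      using False that combr[of t s] 
      by (auto intro!: integral_nonneg norm_integrable absolutely_integrable_subinterval_real[OF b])
    then show ?thesis using inc[of t s] that False by (auto simp: norm_minus_commute)
  qed
  have "(F has_derivative (\<lambda>h. 0)) (at s within {0..X})" if s: "s \<in> {0..X}" for s
  proof -
    have "((\<lambda>t. 2 * K * \<bar>B t - B s\<bar>) \<longlongrightarrow> 2 * K * \<bar>B s - B s\<bar>) (at s within {0..X})"
      using Bc s by (intro tendsto_intros) (auto simp: continuous_on_def)
    then have lim: "((\<lambda>t. 2 * K * \<bar>B t - B s\<bar>) \<longlongrightarrow> 0) (at s within {0..X})" by simp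
    have "((\<lambda>t. norm (F t - F s - 0) / norm (t - s)) \<longlongrightarrow> 0) (at s within {0..X})"
    proof (rule tendsto_sandwich[OF _ _ tendsto_const lim])
      show "\<forall>\<^sub>F t in at s within {0..X}. norm (F t - F s - 0) / norm (t - s) \<le> 2 * K * \<bar>B t - B s\<bar>"
        unfolding eventually_at_filter
        using inc'[OF s] by (auto intro!: always_eventually simp: divide_le_eq algebra_simps)
    qed auto
    then show ?thesis by (auto simp: has_derivative_iff_norm bounded_linear_zero)
  qed
  then obtain c where c: "\<And>t. t \<in> {0..X} \<Longrightarrow> F t = c"
    using has_derivative_zero_constant[of "{0..X}" F] by (auto simp: convex_real_interval)
  have "F x = F 0" using c[OF x] c[of 0] x by auto
  then have eq: "integral {0..x} (\<lambda>t. u' t * v t) + integral {0..x} (\<lambda>t. b t * u t) = u x * v x - u 0 * v 0"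
    unfolding F_def by (simp add: algebra_simps)
  have "((\<lambda>t. u' t * v t + b t * u t) has_integral
      integral {0..x} (\<lambda>t. u' t * v t) + integral {0..x} (\<lambda>t. b t * u t)) {0..x}"
    using x integrable_subinterval_real[OF ub, of 0 x] integrable_subinterval_real[OF u'v, of 0 x]
    by (intro has_integral_add integrable_integral) auto
  then show ?thesis unfolding eq by (simp add: mult.commute)
qed

text \<open>Differentiation under the integral sign with a merely integrable weight: the difference quotients are
  dominated by the Cauchy estimate.\<close>

lemma holomorphic_integral_weighted:
  fixes w :: "real \<Rightarrow> complex" and f :: "real \<Rightarrow> complex \<Rightarrow> complex"
  assumes w: "w absolutely_integrable_on {a..b}"
    and hol: "\<And>t. t \<in> {a..b} \<Longrightarrow> f t holomorphic_on UNIV"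
    and cont: "\<And>z. continuous_on {a..b} (\<lambda>t. f t z)"
    and bdd: "\<And>R. \<exists>C. \<forall>t\<in>{a..b}. \<forall>z. cmod z \<le> R \<longrightarrow> cmod (f t z) \<le> C"
  shows "(\<lambda>z. integral {a..b} (\<lambda>t. w t * f t z)) holomorphic_on UNIV"
proof -
  have "\<exists>f'. ((\<lambda>z. integral {a..b} (\<lambda>t. w t * f t z)) has_field_derivative f') (at z)" for z :: complex
  proof -
  \<comment> \<open>The radius leaves room for \<open>y\<close> in the unit disc around
    \<open>z\<close> and for Cauchy discs of radius 1 around the points of that disc.\<close>
  obtain C where C: "\<And>t y. t \<in> {a..b} \<Longrightarrow> cmod y \<le> cmod z + 2 \<Longrightarrow> cmod (f t y) \<le> C"
    using bdd[of "cmod z + 2"] by blast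
  have der: "cmod (f t y - f t z) \<le> C * cmod (y - z)" if t: "t \<in> {a..b}" and y: "cmod (y - z) \<le> 1" for t y
  proof (rule field_differentiable_bound[of "cball z 1" "f t" "deriv (f t)"])
    show "convex (cball z 1)" by simp
    show "(f t has_field_derivative deriv (f t) \<xi>) (at \<xi> within cball z 1)" for \<xi>
      using holomorphic_derivI[OF hol[OF t]] by auto
    show "cmod (deriv (f t) \<xi>) \<le> C" if "\<xi> \<in> cball z 1" for \<xi>
    proof -
      have "cmod ((deriv ^^ 1) (f t) \<xi>) \<le> fact 1 * C / 1 ^ 1"
      proof (rule Cauchy_inequality)
        show "f t holomorphic_on ball \<xi> 1" using hol[OF t] holomorphic_on_subset by blast
        show "continuous_on (cball \<xi> 1) (f t)" 
          using hol[OF t] holomorphic_on_imp_continuous_on continuous_on_subset by blast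
        fix x assume "cmod (\<xi> - x) = 1"
        then have "cmod x \<le> cmod z + 2" using that
          by (smt (verit) dist_norm mem_cball norm_minus_commute norm_triangle_sub)
        then show "cmod (f t x) \<le> C" using C t by blast
      qed auto
      then show ?thesis by simp
    qed
    show "y \<in> cball z 1" "z \<in> cball z 1" using y by (auto simp: dist_norm norm_minus_commute)
  qed
  define J where "J y = integral {a..b} (\<lambda>t. w t * f t y)" for y
  have intw: "(\<lambda>t. w t * f t y) integrable_on {a..b}" for y
    by (intro absolutely_integrable_imp_integrable absolutely_integrable_mult_continuous w cont)
  have "((\<lambda>y. (J y - J z) / (y - z)) \<longlongrightarrow> integral {a..b} (\<lambda>t. w t * deriv (f t) z)) (at z)"
    unfolding tendsto_at_iff_sequentially o_def
  proof (intro allI impI)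
    fix Y :: "nat \<Rightarrow> complex" assume Y: "\<forall>i. Y i \<in> UNIV - {z}" and lim: "Y \<longlonglongrightarrow> z"
    \<comment> \<open>Dropping finitely many terms puts the sequence into the unit disc around
      \<open>z\<close>, where \<open>C * cmod (w t)\<close> dominates every difference
      quotient.\<close>
    obtain N where N: "\<And>n. n \<ge> N \<Longrightarrow> cmod (Y n - z) \<le> 1"
      using LIMSEQ_D[OF lim, of 1] by (auto intro: less_imp_le)
    have "(\<lambda>n. integral {a..b} (\<lambda>t. (w t * f t (Y (n + N)) - w t * f t z) / (Y (n + N) - z)))
      \<longlonglongrightarrow> integral {a..b} (\<lambda>t. w t * deriv (f t) z)"
    proof (rule dominated_convergence(2))
      show "(\<lambda>t. (w t * f t (Y (n + N)) - w t * f t z) / (Y (n + N) - z)) integrable_on {a..b}" for n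
        by (intro integrable_on_divide integrable_diff intw)
      show "(\<lambda>t. C * cmod (w t)) integrable_on {a..b}"
        by (intro integrable_on_mult_right norm_integrable w)
      show "cmod ((w t * f t (Y (n + N)) - w t * f t z) / (Y (n + N) - z)) \<le> C * cmod (w t)"
        if "t \<in> {a..b}" for n t
      proof -
        have "Y (n+N) \<noteq> z" using Y by auto
        then have "cmod (f t (Y (n + N)) - f t z) / cmod (Y (n + N) - z) \<le> C"
          using der[OF that N[of "n+N"]] by (simp add: divide_le_eq)
        then have "cmod (w t) * (cmod (f t (Y (n + N)) - f t z) / cmod (Y (n + N) - z)) \<le> cmod (w t) * C"
          by (intro mult_left_mono) auto
        moreover have "(w t * f t (Y (n + N)) - w t * f t z) / (Y (n + N) - z)
            = w t * ((f t (Y (n + N)) - f t z) / (Y (n + N) - z))"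
          by (simp add: right_diff_distrib)
        ultimately show ?thesis
          by (simp only: norm_mult norm_divide mult.commute[of C])
      qed
      show "(\<lambda>n. (w t * f t (Y (n + N)) - w t * f t z) / (Y (n + N) - z)) \<longlonglongrightarrow> w t * deriv (f t) z"
        if "t \<in> {a..b}" for t
      proof -
        have "((\<lambda>y. (f t y - f t z) / (y - z)) \<longlongrightarrow> deriv (f t) z) (at z)"
          using holomorphic_derivI[OF hol[OF that], of z] by (auto simp: has_field_derivative_iff)
        then have "(\<lambda>n. (f t (Y n) - f t z) / (Y n - z)) \<longlonglongrightarrow> deriv (f t) z"
          using Y lim unfolding tendsto_at_iff_sequentially o_def by blast
        then have "(\<lambda>n. w t * ((f t (Y (n+N)) - f t z) / (Y (n+N) - z))) \<longlonglongrightarrow> w t * deriv (f t) z"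
          by (intro tendsto_intros) (rule LIMSEQ_ignore_initial_segment)
        then show ?thesis by (simp add: right_diff_distrib)
      qed
    qed
    then have "(\<lambda>n. (J (Y (n+N)) - J z) / (Y (n+N) - z)) \<longlonglongrightarrow> integral {a..b} (\<lambda>t. w t * deriv (f t) z)"
      unfolding J_def by (simp add: integral_diff intw divide_inverse)
    then show "(\<lambda>n. (J (Y n) - J z) / (Y n - z)) \<longlonglongrightarrow> integral {a..b} (\<lambda>t. w t * deriv (f t) z)"
      by (rule LIMSEQ_offset)
  qed
  then have "(J has_field_derivative integral {a..b} (\<lambda>t. w t * deriv (f t) z)) (at z)"
    by (simp add: has_field_derivative_iff)
  then show "\<exists>f'. ((\<lambda>z. integral {a..b} (\<lambda>t. w t * f t z)) has_field_derivative f') (at z)"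
    unfolding J_def by blast
  qed
  then show ?thesis by (simp add: holomorphic_on_open)
qed

section \<open>Solutions of the differential equation\<close>

text \<open>Relaxes \<open>is_sol\<close>: no normalisation outside the interval, so that
  closed-form solutions such as \<open>cos (r * x)\<close> qualify without being cut off. Continuity
  replaces the integrability conditions, which follow from it once \<open>q\<close> is absolutely
  integrable.\<close>

definition sol :: "(real \<Rightarrow> complex) \<Rightarrow> complex \<Rightarrow> (real \<Rightarrow> complex) \<Rightarrow> (real \<Rightarrow> complex) \<Rightarrow> bool" where
  "sol q z y yd \<longleftrightarrow> continuous_on {0..pi} y \<and> continuous_on {0..pi} yd \<and>
     (\<forall>x\<in>{0..pi}. y x = y 0 + integral {0..x} yd \<and>
                   yd x = yd 0 + integral {0..x} (\<lambda>t. (q t - z) * y t))"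

lemma is_sol_imp_sol:
  assumes "is_sol q z y yd"
  shows "sol q z y yd"
proof -
  have "continuous_on {0..pi} (\<lambda>x. y 0 + integral {0..x} yd)"
    using assms unfolding is_sol_def by (intro continuous_intros indefinite_integral_continuous_1) auto
  then have "continuous_on {0..pi} y"
    by (rule continuous_on_eq) (use assms[unfolded is_sol_def] in metis)
  moreover have "continuous_on {0..pi} (\<lambda>x. yd 0 + integral {0..x} (\<lambda>t. (q t - z) * y t))"
    using assms unfolding is_sol_def by (intro continuous_intros indefinite_integral_continuous_1) auto
  then have "continuous_on {0..pi} yd"
    by (rule continuous_on_eq) (use assms[unfolded is_sol_def] in metis)
  ultimately show ?thesis using assms unfolding sol_def is_sol_def by blast
qed

lemma absolutely_integrable_diff_const:
  fixes q :: "real \<Rightarrow> complex"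
  assumes "q absolutely_integrable_on {a..b}"
  shows "(\<lambda>t. q t - z) absolutely_integrable_on {a..b}"
  by (intro set_integral_diff(1) assms absolutely_integrable_continuous_real continuous_intros)

lemma sol_imp_is_sol:
  assumes "q absolutely_integrable_on {0..pi}" "sol q z y yd"
    and "\<And>x. x \<notin> {0..pi} \<Longrightarrow> y x = 0 \<and> yd x = 0"
  shows "is_sol q z y yd"
proof -
  have "yd integrable_on {0..pi}"
    using assms(2) unfolding sol_def by (intro integrable_continuous_interval) blast
  moreover have "(\<lambda>t. (q t - z) * y t) integrable_on {0..pi}"
    using assms(2) unfolding sol_def
    by (intro absolutely_integrable_imp_integrable absolutely_integrable_mult_continuous
      absolutely_integrable_diff_const assms(1)) blast
  ultimately show ?thesis using assms(2,3) unfolding is_sol_def sol_def by blast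
qed

text \<open>The twofold integral from 0 of \<open>w * u\<close>, written by Cauchy's formula with
  the kernel \<open>x - t\<close>. For \<open>w = q - z\<close>, a solution with initial data
  \<open>a\<close>, \<open>b\<close> is a fixed point of
  \<open>u = a + b * x + volterra w u\<close>.\<close>

definition volterra :: "(real \<Rightarrow> complex) \<Rightarrow> (real \<Rightarrow> complex) \<Rightarrow> real \<Rightarrow> complex" where
  "volterra w u x = integral {0..x} (\<lambda>t. w t * (of_real (x - t) * u t))"

text \<open>The kernel \<open>x - t\<close> beats the exponential weight: \<open>s exp (- M s) \<le> 1 / M\<close>, so the Volterra operator is a
  contraction in a weighted sup norm.\<close>

lemma volterra_bound:
  assumes w: "w absolutely_integrable_on {0..pi}" and u: "continuous_on {0..pi} u"
    and x: "x \<in> {0..pi}" and M: "M > 0" and wM: "integral {0..pi} (\<lambda>t. cmod (w t)) \<le> M / 2"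
    and m: "\<And>t. t \<in> {0..x} \<Longrightarrow> cmod (u t) \<le> m * exp (M * t)"
  shows "cmod (volterra w u x) \<le> m / 2 * exp (M * x)"
proof -
  have "m \<ge> 0" using m[of 0] x by (auto intro: order_trans[OF norm_ge_zero])
  have "cmod (of_real (x - t) * u t) \<le> m / M * exp (M * x)" if t: "t \<in> {0..x}" for t
  proof -
    have "M * (x - t) \<le> exp (M * (x - t))" using exp_ge_add_one_self[of "M * (x - t)"] by linarith
    then have "(x - t) * exp (M * t) \<le> exp (M * (x - t)) / M * exp (M * t)"
      using M by (intro mult_right_mono) (auto simp: field_simps)
    also have "\<dots> = exp (M * x) / M" by (simp add: algebra_simps flip: exp_add)
    finally have *: "(x - t) * exp (M * t) \<le> exp (M * x) / M" .
    have "cmod (of_real (x - t) * u t) \<le> (x - t) * (m * exp (M * t))"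
      unfolding norm_mult norm_of_real using t m[OF t] by (intro mult_mono) auto
    also have "\<dots> = m * ((x - t) * exp (M * t))" by simp
    also have "\<dots> \<le> m * (exp (M * x) / M)" using * \<open>m \<ge> 0\<close> by (rule mult_left_mono)
    finally show ?thesis by simp
  qed
  then have "cmod (volterra w u x) \<le> m / M * exp (M * x) * integral {0..x} (\<lambda>t. cmod (w t))"
    unfolding volterra_def using x
    by (intro norm_integral_mult_le absolutely_integrable_subinterval_real[OF w] continuous_intros
        continuous_on_subset[OF u]) auto
  also have "\<dots> \<le> m / M * exp (M * x) * (M / 2)"
    using x M \<open>m \<ge> 0\<close> integral_cmod_mono[OF w, of 0 x] wM by (intro mult_left_mono) auto
  finally show ?thesis using M by simp
qed

text \<open>Integration by parts against \<open>x - t\<close>: the boundary term vanishes at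
  \<open>t = x\<close> through the kernel and at \<open>t = 0\<close> through the inner
  integral.\<close>

lemma volterra_double_integral:
  assumes w: "w absolutely_integrable_on {0..pi}" and u: "continuous_on {0..pi} u" and x: "x \<in> {0..pi}"
  shows "((\<lambda>s. integral {0..s} (\<lambda>t. w t * u t)) has_integral volterra w u x) {0..x}"
proof -
  define v where "v s = integral {0..s} (\<lambda>t. w t * u t)" for s
  have wu: "(\<lambda>t. w t * u t) absolutely_integrable_on {0..x}"
    using x by (intro absolutely_integrable_mult_continuous absolutely_integrable_subinterval_real[OF w]
       continuous_on_subset[OF u]) auto
  have "((\<lambda>t. (-1) * v t + of_real (x - t) * (w t * u t)) has_integral of_real (x - x) * v x - of_real (x - 0) * v 0) {0..x}"
  proof (rule product_rule_indefinite_integral[where X = x])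
    show "((\<lambda>t. complex_of_real (x - t)) has_vector_derivative - 1) (at t within {0..x})" for t
      by (auto intro!: derivative_eq_intros)
  qed (use x wu in \<open>auto simp: v_def\<close>)
  then have 1: "((\<lambda>t. (-1) * v t + of_real (x - t) * (w t * u t)) has_integral 0) {0..x}"
    by (simp add: v_def)
  have "((\<lambda>t. w t * (of_real (x - t) * u t)) has_integral volterra w u x) {0..x}"
    unfolding volterra_def using x
    by (intro integrable_integral absolutely_integrable_imp_integrable absolutely_integrable_mult_continuous
      absolutely_integrable_subinterval_real[OF w] continuous_intros continuous_on_subset[OF u]) auto
  from has_integral_diff[OF this 1] show ?thesis by (simp add: v_def algebra_simps)
qed

lemma continuous_on_volterra:
  assumes w: "w absolutely_integrable_on {0..pi}" and u: "continuous_on {0..pi} u"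
  shows "continuous_on {0..pi} (volterra w u)"
proof -
  have "continuous_on {0..pi} (\<lambda>x. integral {0..x} (\<lambda>s. integral {0..s} (\<lambda>t. w t * u t)))"
    using has_integral_integrable[OF volterra_double_integral[OF w u, of pi]]
    by (intro indefinite_integral_continuous_1) auto
  then show ?thesis
    by (rule continuous_on_eq) (use integral_unique[OF volterra_double_integral[OF w u]] in auto)
qed

text \<open>\<open>m\<close> is the sup norm of \<open>y\<close> with weight
  \<open>exp (- M * t)\<close>, attained at \<open>x0\<close> by compactness. Having a point of
  equality lets an estimate at \<open>x0\<close> be turned into one for \<open>m\<close> itself. It
  is used with a large \<open>M\<close> for uniqueness and with \<open>M = |Im r|\<close> for
  asymptotics.\<close>

lemma exponential_majorant:
  fixes y :: "real \<Rightarrow> complex"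
  assumes y: "continuous_on {0..pi} y"
  obtains x0 m where "x0 \<in> {0..pi}" "m \<ge> 0" "cmod (y x0) = m * exp (M * x0)"
    "\<And>t. t \<in> {0..pi} \<Longrightarrow> cmod (y t) \<le> m * exp (M * t)"
proof -
  have "continuous_on {0..pi} (\<lambda>t. exp (- M * t) * cmod (y t))"
    using y by (intro continuous_intros)
  from continuous_attains_sup[OF compact_Icc _ this]
  obtain x0 where x0: "x0 \<in> {0..pi}"
    and max: "\<And>t. t \<in> {0..pi} \<Longrightarrow> exp (- M * t) * cmod (y t) \<le> exp (- M * x0) * cmod (y x0)"
    by fastforce
  show ?thesis
  proof (rule that[of x0 "exp (- M * x0) * cmod (y x0)"])
    show "cmod (y t) \<le> exp (- M * x0) * cmod (y x0) * exp (M * t)" if "t \<in> {0..pi}" for t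
      using max[OF that] by (simp add: exp_minus field_simps)
  qed (use x0 in \<open>auto simp: exp_minus field_simps\<close>)
qed

text \<open>The solution equals its own Volterra image, so the contraction estimate at the point
  where the weighted norm \<open>m\<close> is attained gives \<open>m <= m / 2\<close>. The summand
  1 in \<open>M\<close> ensures positivity.\<close>

lemma sol_unique_zero:
  assumes q: "q absolutely_integrable_on {0..pi}" and s: "sol q z y yd" and "y 0 = 0" "yd 0 = 0"
    and x: "x \<in> {0..pi}"
  shows "y x = 0 \<and> yd x = 0"
proof -
  define w where "w t = q t - z" for t
  have w: "w absolutely_integrable_on {0..pi}" 
    unfolding w_def by (intro absolutely_integrable_diff_const q)
  have y: "continuous_on {0..pi} y" using s by (simp add: sol_def)
  have yd: "yd t = integral {0..t} (\<lambda>t. w t * y t)" if "t \<in> {0..pi}" for t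
    using s that assms(4) by (simp add: sol_def w_def)
  have V: "y t = volterra w y t" if t: "t \<in> {0..pi}" for t
  proof -
    have "integral {0..t} yd = integral {0..t} (\<lambda>s. integral {0..s} (\<lambda>t. w t * y t))"
      using yd t by (intro integral_cong) auto
    then show ?thesis using s t assms(3) integral_unique[OF volterra_double_integral[OF w y t]]
      by (simp add: sol_def)
  qed
  define M where "M = 2 * integral {0..pi} (\<lambda>t. cmod (w t)) + 1"
  have "0 \<le> integral {0..pi} (\<lambda>t. cmod (w t))" by (intro integral_nonneg norm_integrable w) auto
  then have M: "M > 0" "integral {0..pi} (\<lambda>t. cmod (w t)) \<le> M / 2" by (auto simp: M_def)
  obtain x0 m where x0: "x0 \<in> {0..pi}" and m0: "m \<ge> 0" and m: "cmod (y x0) = m * exp (M * x0)"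
    and le: "\<And>t. t \<in> {0..pi} \<Longrightarrow> cmod (y t) \<le> m * exp (M * t)"
    by (rule exponential_majorant[OF y, where M = M]) (erule that)
  have "cmod (volterra w y x0) \<le> m / 2 * exp (M * x0)"
    using x0 le by (intro volterra_bound w y M) auto
  then have "m * exp (M * x0) \<le> m / 2 * exp (M * x0)" using V[OF x0] m by simp
  then have "m \<le> m / 2" by (rule mult_right_le_imp_le) simp
  then have "m = 0" using m0 by simp
  then have y0: "y t = 0" if "t \<in> {0..pi}" for t using le[OF that] by simp
  then have "integral {0..x} (\<lambda>t. w t * y t) = integral {0..x} (\<lambda>t. 0)"
    using x by (intro integral_cong) auto
  then show ?thesis using y0[OF x] yd[OF x] by simp
qed

section \<open>The Neumann series and entire dependence on the spectral parameter\<close>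

lemma volterra_diff:
  assumes w: "w absolutely_integrable_on {0..pi}" and u: "continuous_on {0..pi} u" "continuous_on {0..pi} v"
    and x: "x \<in> {0..pi}"
  shows "volterra w (\<lambda>t. u t - v t) x = volterra w u x - volterra w v x"
    and "volterra w (\<lambda>t. u t + v t) x = volterra w u x + volterra w v x"
proof -
  have i: "(\<lambda>t. w t * (of_real (x - t) * u t)) integrable_on {0..x}" if "continuous_on {0..pi} u" for u
    using x
    by (intro absolutely_integrable_imp_integrable absolutely_integrable_mult_continuous
      absolutely_integrable_subinterval_real[OF w] continuous_intros continuous_on_subset[OF that]) auto
  show "volterra w (\<lambda>t. u t - v t) x = volterra w u x - volterra w v x"
    unfolding volterra_def 
    using Henstock_Kurzweil_Integration.integral_diff[OF i[OF u(1)] i[OF u(2)]] by (simp add: algebra_simps)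
  show "volterra w (\<lambda>t. u t + v t) x = volterra w u x + volterra w v x"
    unfolding volterra_def 
    using Henstock_Kurzweil_Integration.integral_add[OF i[OF u(1)] i[OF u(2)]] by (simp add: algebra_simps)
qed

text \<open>These are the terms of the Neumann series, each the Volterra image of its predecessor;
  the successive approximations are their partial sums.\<close>

primrec picard :: "(real \<Rightarrow> complex) \<Rightarrow> complex \<Rightarrow> complex \<Rightarrow> nat \<Rightarrow> real \<Rightarrow> complex \<Rightarrow> complex" where
  "picard q a b 0 x z = a + b * of_real x"
| "picard q a b (Suc k) x z = volterra (\<lambda>t. q t - z) (\<lambda>t. picard q a b k t z) x"

lemma continuous_on_picard:
  assumes "q absolutely_integrable_on {0..pi}"
  shows "continuous_on {0..pi} (\<lambda>x. picard q a b k x z)"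
proof (induction k)
  case (Suc k)
  then show ?case
    using continuous_on_volterra[OF absolutely_integrable_diff_const[OF assms]] by simp
qed (auto intro!: continuous_intros)

lemma integral_cmod_diff_const_le:
  fixes q :: "real \<Rightarrow> complex"
  assumes q: "q absolutely_integrable_on {0..pi}"
  shows "integral {0..pi} (\<lambda>t. cmod (q t - z)) \<le> integral {0..pi} (\<lambda>t. cmod (q t)) + pi * cmod z"
proof -
  have "integral {0..pi} (\<lambda>t. cmod (q t - z)) \<le> integral {0..pi} (\<lambda>t. cmod (q t) + cmod z)"
    by (intro integral_le norm_integrable absolutely_integrable_diff_const q integrable_add
        norm_triangle_ineq4) auto
  also have "\<dots> = integral {0..pi} (\<lambda>t. cmod (q t)) + integral {0..pi} (\<lambda>t. cmod z)"
    by (intro integral_add norm_integrable q) auto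
  finally show ?thesis by simp
qed

text \<open>\<open>M\<close> depends on \<open>z\<close> only through \<open>R\<close>, so every
  term is at most half the previous one in a norm common to the whole disc. This is what makes
  convergence uniform in \<open>z\<close> as well as in \<open>x\<close>.\<close>

lemma picard_bound:
  assumes q: "q absolutely_integrable_on {0..pi}" and z: "cmod z \<le> R"
    and M: "M = 2 * (integral {0..pi} (\<lambda>t. cmod (q t)) + pi * R) + 1"
    and x: "x \<in> {0..pi}"
  shows "cmod (picard q a b k x z) \<le> (cmod a + cmod b * pi) / 2 ^ k * exp (M * x)"
  using x
proof (induction k arbitrary: x)
  have Q0: "0 \<le> integral {0..pi} (\<lambda>t. cmod (q t))" by (intro integral_nonneg norm_integrable q) auto
  have "R \<ge> 0" using z norm_ge_zero order_trans by blast
  then have M0: "M > 0" using Q0 by (simp add: M add_nonneg_pos)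
  {
    case 0
    have "cmod (a + b * of_real x) \<le> cmod a + cmod b * x"
      using norm_triangle_ineq[of a "b * of_real x"] 0 by (simp add: norm_mult)
    also have "\<dots> \<le> cmod a + cmod b * pi" using 0 by (auto intro: mult_left_mono)
    also have "\<dots> * 1 \<le> (cmod a + cmod b * pi) * exp (M * x)"
      using 0 M0 by (intro mult_left_mono) auto
    finally show ?case by simp
  next
    case (Suc k)
    have "integral {0..pi} (\<lambda>t. cmod (q t - z)) \<le> integral {0..pi} (\<lambda>t. cmod (q t)) + pi * cmod z"
      by (rule integral_cmod_diff_const_le[OF q])
    also have "\<dots> \<le> integral {0..pi} (\<lambda>t. cmod (q t)) + pi * R"
      using mult_left_mono[OF z pi_ge_zero] by (rule add_left_mono)
    also have "\<dots> \<le> M / 2" unfolding M by simp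
    finally have "cmod (volterra (\<lambda>t. q t - z) (\<lambda>t. picard q a b k t z) x) \<le> (cmod a + cmod b * pi) / 2 ^ k / 2 * exp (M * x)"
      using Suc.prems
      by (intro volterra_bound absolutely_integrable_diff_const q continuous_on_picard M0 Suc.IH) auto
    then show ?case by (simp add: mult.commute)
  }
qed

lemma picard_bounded:
  assumes q: "q absolutely_integrable_on {0..pi}"
  shows "\<exists>C. \<forall>x\<in>{0..pi}. \<forall>z. cmod z \<le> R \<longrightarrow> (\<forall>k. cmod (picard q a b k x z) \<le> C / 2 ^ k)"
proof (intro exI ballI allI impI)
  fix x z k assume x: "x \<in> {0..pi}" and z: "cmod z \<le> R"
  define M where "M = 2 * (integral {0..pi} (\<lambda>t. cmod (q t)) + pi * R) + 1"
  have Q0: "0 \<le> integral {0..pi} (\<lambda>t. cmod (q t))" by (intro integral_nonneg norm_integrable q) auto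
  have "R \<ge> 0" using z norm_ge_zero order_trans by blast
  then have M0: "M > 0" using Q0 by (simp add: M_def add_nonneg_pos)
  have "cmod (picard q a b k x z) \<le> (cmod a + cmod b * pi) / 2 ^ k * exp (M * x)"
    by (rule picard_bound[OF q z M_def x])
  also have "\<dots> \<le> (cmod a + cmod b * pi) / 2 ^ k * exp (M * pi)"
    using x M0 by (intro mult_left_mono) auto
  finally show "cmod (picard q a b k x z) \<le> (cmod a + cmod b * pi) *
     exp ((2 * (integral {0..pi} (\<lambda>t. cmod (q t)) + pi * R) + 1) * pi) / 2 ^ k" by (simp add: M_def)
qed

lemma holomorphic_picard:
  assumes q: "q absolutely_integrable_on {0..pi}"
  shows "x \<in> {0..pi} \<Longrightarrow> picard q a b k x holomorphic_on UNIV"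
proof (induction k arbitrary: x)
  case 0
  have "(\<lambda>z. a + b * of_real x) holomorphic_on UNIV" by (intro holomorphic_intros)
  then show ?case by (simp cong: holomorphic_cong)
next
  case (Suc k)
  have sub: "{0..x} \<subseteq> {0..pi}" using Suc.prems by auto
  have bdd: "\<exists>C. \<forall>t\<in>{0..x}. \<forall>z. cmod z \<le> R \<longrightarrow> cmod (of_real (x - t) * picard q a b k t z) \<le> C" for R
  proof -
    obtain C where C: "\<And>t z. t \<in> {0..pi} \<Longrightarrow> cmod z \<le> R \<Longrightarrow> cmod (picard q a b k t z) \<le> C / 2 ^ k"
      using picard_bounded[OF q] by blast
    have "cmod (of_real (x - t) * picard q a b k t z) \<le> pi * (C / 2 ^ k)" if "t \<in> {0..x}" "cmod z \<le> R" for t z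
      unfolding norm_mult norm_of_real using that Suc.prems C[of t z] by (intro mult_mono) auto
    then show ?thesis by blast
  qed
  have hol: "(\<lambda>z. integral {0..x} (\<lambda>t. w t * (of_real (x - t) * picard q a b k t z))) holomorphic_on UNIV"
    if "w absolutely_integrable_on {0..x}" for w
  proof (rule holomorphic_integral_weighted[OF that _ _ bdd])
    fix t assume "t \<in> {0..x}"
    then show "(\<lambda>z. of_real (x - t) * picard q a b k t z) holomorphic_on UNIV"
      using Suc by (intro holomorphic_intros) auto
  next
    show "continuous_on {0..x} (\<lambda>t. of_real (x - t) * picard q a b k t z)" for z
      by (intro continuous_intros continuous_on_subset[OF continuous_on_picard[OF q] sub])
  qed
  \<comment> \<open>The weight \<open>q - z\<close> itself varies with \<open>z\<close>. Splitting
    it into \<open>q\<close> and \<open>- z * 1\<close> leaves two integrals with fixed weights, to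
    which holomorphy under the integral applies.\<close>
  have "picard q a b (Suc k) x z = integral {0..x} (\<lambda>t. q t * (of_real (x - t) * picard q a b k t z))
      - z * integral {0..x} (\<lambda>t. 1 * (of_real (x - t) * picard q a b k t z))" for z
  proof -
    have c: "continuous_on {0..x} (\<lambda>t. of_real (x - t) * picard q a b k t z)"
      by (intro continuous_intros continuous_on_subset[OF continuous_on_picard[OF q] sub])
    have "(\<lambda>t. q t * (of_real (x - t) * picard q a b k t z)) integrable_on {0..x}"
      using Suc.prems
      by (intro absolutely_integrable_imp_integrable absolutely_integrable_mult_continuous c
          absolutely_integrable_subinterval_real[OF q]) auto
    moreover have "(\<lambda>t. z * (1 * (of_real (x - t) * picard q a b k t z))) integrable_on {0..x}"
      by (intro integrable_continuous_interval continuous_intros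
          continuous_on_subset[OF continuous_on_picard[OF q] sub])
    ultimately have "integral {0..x} (\<lambda>t. q t * (of_real (x - t) * picard q a b k t z) - z * (1 * (of_real (x - t) * picard q a b k t z)))
        = integral {0..x} (\<lambda>t. q t * (of_real (x - t) * picard q a b k t z))
        - integral {0..x} (\<lambda>t. z * (1 * (of_real (x - t) * picard q a b k t z)))"
      by (rule Henstock_Kurzweil_Integration.integral_diff)
    moreover have "(q t - z) * g = q t * g - z * (1 * g)" for t g by (simp add: left_diff_distrib)
    ultimately show ?thesis
      by (simp only: picard.simps volterra_def integral_mult_right)
  qed
  then have eq: "picard q a b (Suc k) x = (\<lambda>z. integral {0..x} (\<lambda>t. q t * (of_real (x - t) * picard q a b k t z))
      - z * integral {0..x} (\<lambda>t. 1 * (of_real (x - t) * picard q a b k t z)))"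
    by (intro ext)
  have "(\<lambda>t. 1::complex) absolutely_integrable_on {0..x}"
    by (intro absolutely_integrable_continuous_real continuous_intros)
  then show ?case
    unfolding eq using Suc.prems
    by (intro holomorphic_intros hol absolutely_integrable_subinterval_real[OF q]) auto
qed

lemma solution_family_exists:
  fixes q :: "real \<Rightarrow> complex"
  assumes q: "q absolutely_integrable_on {0..pi}"
  shows "\<exists>Y Yd. (\<forall>z. sol q z (\<lambda>x. Y x z) (\<lambda>x. Yd x z) \<and> Y 0 z = a \<and> Yd 0 z = b) \<and>
    (\<forall>x\<in>{0..pi}. Y x holomorphic_on UNIV \<and> Yd x holomorphic_on UNIV) \<and>
    (\<forall>R. \<exists>C. \<forall>x\<in>{0..pi}. \<forall>z. cmod z \<le> R \<longrightarrow> cmod (Y x z) \<le> C \<and> cmod (Yd x z) \<le> C)"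
proof -
  define S where "S n x z = (\<Sum>k<n. picard q a b k x z)" for n x z
  define Y where "Y x z = (\<Sum>k. picard q a b k x z)" for x z
  \<comment> \<open>Taking the second integral equation as the definition of the derivative leaves
    the first one to be checked; it comes from the fixed point equation \<open>Y_eq\<close> and the
    double integral formula.\<close>
  define Yd where "Yd x z = b + integral {0..x} (\<lambda>t. (q t - z) * Y t z)" for x z
  have S_cont: "continuous_on {0..pi} (\<lambda>x. S n x z)" for n z
    unfolding S_def by (intro continuous_intros continuous_on_picard q)
  have geo: "summable (\<lambda>k. C / 2 ^ k)" for C :: real
    using summable_mult[OF summable_geometric[of "1/2::real"], of C] by (simp add: power_one_over field_simps)
  have unif: "uniform_limit ({0..pi} \<times> cball 0 R) (\<lambda>n p. S n (fst p) (snd p)) (\<lambda>p. Y (fst p) (snd p)) sequentially" for R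
  proof -
    obtain C where C: "\<And>x z k. x \<in> {0..pi} \<Longrightarrow> cmod z \<le> R \<Longrightarrow> cmod (picard q a b k x z) \<le> C / 2 ^ k"
      using picard_bounded[OF q] by blast
    show ?thesis unfolding S_def Y_def
      by (rule Weierstrass_m_test[OF _ geo[of C]]) (use C in auto)
  qed
  have unif_x: "uniform_limit {0..pi} (\<lambda>n x. S n x z) (\<lambda>x. Y x z) sequentially" for z
    using unif[of "cmod z"] by (auto simp: uniform_limit_iff elim!: eventually_mono)
  have Y_cont: "continuous_on {0..pi} (\<lambda>x. Y x z)" for z
    by (rule uniform_limit_theorem[OF _ unif_x]) (auto simp: S_cont)
  have Y_hol: "Y x holomorphic_on UNIV" if x: "x \<in> {0..pi}" for x
  proof (rule holomorphic_uniform_sequence[where f = "\<lambda>n. S n x"])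
    show "S n x holomorphic_on UNIV" for n
      unfolding S_def by (intro holomorphic_intros holomorphic_picard[OF q x, unfolded eta_contract_eq])
    fix z :: complex
    have "uniform_limit (cball 0 (cmod z + 1)) (\<lambda>n. S n x) (Y x) sequentially"
      using unif[of "cmod z + 1"] x by (auto simp: uniform_limit_iff elim!: eventually_mono)
    moreover have "cball z 1 \<subseteq> cball 0 (cmod z + 1)" by (auto simp: dist_norm) (metis norm_triangle_sub add.commute add_left_mono norm_minus_commute order_trans)
    ultimately show "\<exists>d>0. cball z d \<subseteq> UNIV \<and> uniform_limit (cball z d) (\<lambda>n. S n x) (Y x) sequentially"
      by (intro exI[of _ 1]) (auto intro: uniform_limit_on_subset)
  qed auto
  have Y_bdd: "\<exists>C. \<forall>x\<in>{0..pi}. \<forall>z. cmod z \<le> R \<longrightarrow> cmod (Y x z) \<le> C" for R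
  proof -
    obtain C where C: "\<And>x z k. x \<in> {0..pi} \<Longrightarrow> cmod z \<le> R \<Longrightarrow> cmod (picard q a b k x z) \<le> C / 2 ^ k"
      using picard_bounded[OF q] by blast
    have "cmod (Y x z) \<le> (\<Sum>k. C / 2 ^ k)" if "x \<in> {0..pi}" "cmod z \<le> R" for x z
      unfolding Y_def by (rule norm_suminf_le[OF C[OF that] geo])
    then show ?thesis by blast
  qed
  have Y_eq: "Y x z = a + b * of_real x + volterra (\<lambda>t. q t - z) (\<lambda>t. Y t z) x" if x: "x \<in> {0..pi}" for x z
  proof -
    define w where "w t = q t - z" for t
    have w: "w absolutely_integrable_on {0..pi}" unfolding w_def by (intro absolutely_integrable_diff_const q)
    \<comment> \<open>The Volterra operator shifts the Neumann series by one place, so the fixed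
      point equation is the limit of this identity.\<close>
    have VS: "a + b * of_real x + volterra w (\<lambda>t. S n t z) x = S (Suc n) x z" for n
    proof (induction n)
      case 0
      then show ?case by (simp add: S_def volterra_def)
    next
      case (Suc n)
      have "volterra w (\<lambda>t. S (Suc n) t z) x = volterra w (\<lambda>t. S n t z + picard q a b n t z) x"
        by (simp add: S_def)
      also have "\<dots> = volterra w (\<lambda>t. S n t z) x + volterra w (\<lambda>t. picard q a b n t z) x"
        by (rule volterra_diff(2)[OF w S_cont continuous_on_picard[OF q] x])
      also have "volterra w (\<lambda>t. picard q a b n t z) x = picard q a b (Suc n) x z" by (simp add: w_def[abs_def])
      finally show ?case using Suc by (simp add: S_def algebra_simps)
    qed
    define M where "M = 2 * integral {0..pi} (\<lambda>t. cmod (w t)) + 1"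
    have "0 \<le> integral {0..pi} (\<lambda>t. cmod (w t))" by (intro integral_nonneg norm_integrable w) auto
    then have M: "M > 0" "integral {0..pi} (\<lambda>t. cmod (w t)) \<le> M / 2" by (auto simp: M_def)
    have "(\<lambda>n. volterra w (\<lambda>t. S n t z) x) \<longlonglongrightarrow> volterra w (\<lambda>t. Y t z) x"
    proof (rule tendstoI)
      fix e :: real assume e: "e > 0"
      \<comment> \<open>Scaled so that the weighted bound at \<open>x\<close> comes out as
        \<open>e / 2\<close>.\<close>
      define m where "m = e / exp (M * x)"
      have m: "m > 0" using e by (simp add: m_def)
      show "\<forall>\<^sub>F n in sequentially. dist (volterra w (\<lambda>t. S n t z) x) (volterra w (\<lambda>t. Y t z) x) < e"
        using uniform_limitD[OF unif_x[of z] m]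
      proof (eventually_elim)
        case (elim n)
        have "cmod (S n t z - Y t z) \<le> m * exp (M * t)" if t: "t \<in> {0..x}" for t
        proof -
          have "cmod (S n t z - Y t z) \<le> m * 1" using elim t x by (auto simp: dist_norm intro: less_imp_le)
          also have "\<dots> \<le> m * exp (M * t)" using t M m by (intro mult_left_mono) auto
          finally show ?thesis .
        qed
        then have "cmod (volterra w (\<lambda>t. S n t z - Y t z) x) \<le> m / 2 * exp (M * x)"
          using M x by (intro volterra_bound w continuous_intros S_cont Y_cont) auto
        also have "\<dots> < e" using e by (simp add: m_def)
        finally show ?case by (simp add: dist_norm volterra_diff(1)[OF w S_cont Y_cont x])
      qed
    qed
    then have "(\<lambda>n. S (Suc n) x z) \<longlonglongrightarrow> a + b * of_real x + volterra w (\<lambda>t. Y t z) x"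
      unfolding VS[symmetric] by (intro tendsto_intros)
    moreover have "(\<lambda>n. S (Suc n) x z) \<longlonglongrightarrow> Y x z"
      using tendsto_uniform_limitI[OF unif_x x] by (rule LIMSEQ_Suc)
    ultimately show ?thesis unfolding w_def using LIMSEQ_unique by blast
  qed
  have wY: "(\<lambda>t. (q t - z) * Y t z) absolutely_integrable_on {0..pi}" for z
    by (intro absolutely_integrable_mult_continuous absolutely_integrable_diff_const q Y_cont)
  have Yd_cont: "continuous_on {0..pi} (\<lambda>x. Yd x z)" for z
    unfolding Yd_def
    by (intro continuous_intros indefinite_integral_continuous_1 absolutely_integrable_imp_integrable wY)
  have sol: "sol q z (\<lambda>x. Y x z) (\<lambda>x. Yd x z) \<and> Y 0 z = a \<and> Yd 0 z = b" for z
  proof -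
    have Y0: "Y 0 z = a" using Y_eq[of 0 z] by (simp add: volterra_def)
    have Yd0: "Yd 0 z = b" by (simp add: Yd_def)
    have "integral {0..x} (\<lambda>x. Yd x z) = b * of_real x + volterra (\<lambda>t. q t - z) (\<lambda>t. Y t z) x"
      if x: "x \<in> {0..pi}" for x
    proof -
      have "((\<lambda>x. Yd x z) has_integral Henstock_Kurzweil_Integration.content {0..x} *\<^sub>R b + volterra (\<lambda>t. q t - z) (\<lambda>t. Y t z) x) {0..x}"
        unfolding Yd_def
        by (intro has_integral_add has_integral_const_real volterra_double_integral
            absolutely_integrable_diff_const q Y_cont x)
      then show ?thesis using x by (simp add: integral_unique scaleR_conv_of_real mult.commute)
    qed
    then have "Y x z = Y 0 z + integral {0..x} (\<lambda>x. Yd x z)" if "x \<in> {0..pi}" for x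
      unfolding Y0 using Y_eq[OF that] that by simp
    moreover have "Yd x z = Yd 0 z + integral {0..x} (\<lambda>t. (q t - z) * Y t z)" for x
      unfolding Yd0 by (simp add: Yd_def)
    ultimately show ?thesis
      unfolding sol_def using Y0 Yd0 Y_cont Yd_cont by blast
  qed
  have Yd_hol: "Yd x holomorphic_on UNIV" if x: "x \<in> {0..pi}" for x
  proof -
    have sub: "{0..x} \<subseteq> {0..pi}" using x by auto
    have hol: "(\<lambda>z. integral {0..x} (\<lambda>t. w t * Y t z)) holomorphic_on UNIV"
      if w: "w absolutely_integrable_on {0..x}" for w
    proof (rule holomorphic_integral_weighted[OF w])
      show "Y t holomorphic_on UNIV" if "t \<in> {0..x}" for t using that sub Y_hol by blast
      show "continuous_on {0..x} (\<lambda>t. Y t z)" for z using Y_cont sub continuous_on_subset by blast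
      show "\<exists>C. \<forall>t\<in>{0..x}. \<forall>z. cmod z \<le> R \<longrightarrow> cmod (Y t z) \<le> C" for R
        using Y_bdd[of R] sub by blast
    qed
    have eq: "Yd x = (\<lambda>z. b + (integral {0..x} (\<lambda>t. q t * Y t z) - z * integral {0..x} (\<lambda>t. 1 * Y t z)))"
    proof (rule ext)
      fix z
      have c: "continuous_on {0..x} (\<lambda>t. Y t z)" using Y_cont sub continuous_on_subset by blast
      have "(\<lambda>t. q t * Y t z) integrable_on {0..x}"
        using x by (intro absolutely_integrable_imp_integrable absolutely_integrable_mult_continuous c
          absolutely_integrable_subinterval_real[OF q]) auto
      moreover have "(\<lambda>t. z * (1 * Y t z)) integrable_on {0..x}"
        by (intro integrable_continuous_interval continuous_intros c)
      ultimately have "integral {0..x} (\<lambda>t. q t * Y t z - z * (1 * Y t z))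
          = integral {0..x} (\<lambda>t. q t * Y t z) - integral {0..x} (\<lambda>t. z * (1 * Y t z))"
        by (rule Henstock_Kurzweil_Integration.integral_diff)
      moreover have "(q t - z) * g = q t * g - z * (1 * g)" for t g by (simp add: left_diff_distrib)
      ultimately show "Yd x z = b + (integral {0..x} (\<lambda>t. q t * Y t z) - z * integral {0..x} (\<lambda>t. 1 * Y t z))"
        by (simp only: Yd_def integral_mult_right)
    qed
    have "(\<lambda>t. 1::complex) absolutely_integrable_on {0..x}"
      by (intro absolutely_integrable_continuous_real continuous_intros)
    then show ?thesis unfolding eq using x
      by (intro holomorphic_intros hol absolutely_integrable_subinterval_real[OF q]) auto
  qed
  have bdd: "\<exists>C. \<forall>x\<in>{0..pi}. \<forall>z. cmod z \<le> R \<longrightarrow> cmod (Y x z) \<le> C \<and> cmod (Yd x z) \<le> C" for R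
  proof -
    obtain C where C: "\<And>x z. x \<in> {0..pi} \<Longrightarrow> cmod z \<le> R \<Longrightarrow> cmod (Y x z) \<le> C"
      using Y_bdd[of R] by blast
    define Q where "Q = integral {0..pi} (\<lambda>t. cmod (q t)) + pi * R"
    have "cmod (Yd x z) \<le> cmod b + \<bar>C\<bar> * Q" if x: "x \<in> {0..pi}" and z: "cmod z \<le> R" for x z
    proof -
      have w: "(\<lambda>t. q t - z) absolutely_integrable_on {0..pi}" by (intro absolutely_integrable_diff_const q)
      have "cmod (integral {0..x} (\<lambda>t. (q t - z) * Y t z)) \<le> \<bar>C\<bar> * integral {0..x} (\<lambda>t. cmod (q t - z))"
        using x C[OF _ z]
        by (intro norm_integral_mult_le absolutely_integrable_subinterval_real[OF w]
            continuous_on_subset[OF Y_cont]) (auto intro: order_trans[OF _ abs_ge_self])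
      also have "\<dots> \<le> \<bar>C\<bar> * integral {0..pi} (\<lambda>t. cmod (q t - z))"
        using x by (intro mult_left_mono integral_cmod_mono w) auto
      also have "\<dots> \<le> \<bar>C\<bar> * (integral {0..pi} (\<lambda>t. cmod (q t)) + pi * cmod z)"
        by (intro mult_left_mono integral_cmod_diff_const_le q) auto
      also have "\<dots> \<le> \<bar>C\<bar> * Q" unfolding Q_def using z by (intro mult_left_mono add_left_mono) auto
      finally show ?thesis unfolding Yd_def by (intro order_trans[OF norm_triangle_ineq]) simp
    qed
    then show ?thesis using C by (intro exI[of _ "max C (cmod b + \<bar>C\<bar> * Q)"]) (auto simp: le_max_iff_disj)
  qed
  show ?thesis using sol Y_hol Yd_hol bdd by blast
qed

section \<open>Uniqueness and canonical solutions of the initial value problem\<close>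

lemma sol_lincomb:
  assumes q: "q absolutely_integrable_on {0..pi}" and 1: "sol q z y yd" and 2: "sol q z u ud"
  shows "sol q z (\<lambda>x. y x - c * u x) (\<lambda>x. yd x - c * ud x)"
proof -
  have c: "continuous_on {0..pi} y" "continuous_on {0..pi} yd" "continuous_on {0..pi} u" "continuous_on {0..pi} ud"
    using 1 2 by (auto simp: sol_def)
  have w: "(\<lambda>t. q t - z) absolutely_integrable_on {0..pi}" by (intro absolutely_integrable_diff_const q)
  have "y x - c * u x = y 0 - c * u 0 + integral {0..x} (\<lambda>x. yd x - c * ud x) \<and>
        yd x - c * ud x = yd 0 - c * ud 0 + integral {0..x} (\<lambda>t. (q t - z) * (y t - c * u t))"
    if x: "x \<in> {0..pi}" for x
  proof -
    have sub: "{0..x} \<subseteq> {0..pi}" using x by auto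
    note cs = c[THEN continuous_on_subset, OF sub]
    have "integral {0..x} (\<lambda>x. yd x - c * ud x) = integral {0..x} yd - integral {0..x} (\<lambda>x. c * ud x)"
      by (intro integral_diff integrable_continuous_interval continuous_intros cs)
    moreover have "integral {0..x} (\<lambda>t. (q t - z) * y t - c * ((q t - z) * u t))
        = integral {0..x} (\<lambda>t. (q t - z) * y t) - integral {0..x} (\<lambda>t. c * ((q t - z) * u t))"
      using x by (intro integral_diff integrable_on_mult_right absolutely_integrable_imp_integrable
          absolutely_integrable_mult_continuous cs absolutely_integrable_subinterval_real[OF w]) auto
    moreover have "(q t - z) * y t - c * ((q t - z) * u t) = (q t - z) * (y t - c * u t)" for t
      by (simp add: algebra_simps)
    moreover have "y x = y 0 + integral {0..x} yd" "yd x = yd 0 + integral {0..x} (\<lambda>t. (q t - z) * y t)"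
      "u x = u 0 + integral {0..x} ud" "ud x = ud 0 + integral {0..x} (\<lambda>t. (q t - z) * u t)"
      using 1 2 x unfolding sol_def by blast+
    ultimately show ?thesis by (simp only: integral_mult_right) (simp add: algebra_simps)
  qed
  moreover have "continuous_on {0..pi} (\<lambda>x. y x - c * u x)" "continuous_on {0..pi} (\<lambda>x. yd x - c * ud x)"
    by (intro continuous_intros c)+
  ultimately show ?thesis unfolding sol_def by blast
qed

lemma sol_unique:
  assumes q: "q absolutely_integrable_on {0..pi}" and 1: "sol q z y yd" and 2: "sol q z u ud"
    and "y 0 = c * u 0" "yd 0 = c * ud 0" and x: "x \<in> {0..pi}"
  shows "y x = c * u x \<and> yd x = c * ud x"
  using sol_unique_zero[OF q sol_lincomb[OF q 1 2, of c] _ _ x] assms(4,5) by simp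

text \<open>Copies the shape of \<open>phi_pair\<close> with free initial values and with
  \<open>z\<close> in place of \<open>rho ^ 2\<close>, so that \<open>phi_pair\<close> is literally
  an instance and the solution fixed at the right end can be obtained from the same
  construction.\<close>

definition sol_pair :: "(real \<Rightarrow> complex) \<Rightarrow> complex \<Rightarrow> complex \<Rightarrow> complex \<Rightarrow> (real \<Rightarrow> complex) \<times> (real \<Rightarrow> complex)" where
  "sol_pair q a b z = (THE p. is_sol q z (fst p) (snd p) \<and> fst p 0 = a \<and> snd p 0 = b)"

definition ivp :: "(real \<Rightarrow> complex) \<Rightarrow> complex \<Rightarrow> complex \<Rightarrow> real \<Rightarrow> complex \<Rightarrow> complex" where
  "ivp q a b x z = fst (sol_pair q a b z) x"

definition ivp_deriv :: "(real \<Rightarrow> complex) \<Rightarrow> complex \<Rightarrow> complex \<Rightarrow> real \<Rightarrow> complex \<Rightarrow> complex" where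
  "ivp_deriv q a b x z = snd (sol_pair q a b z) x"

lemma phi_eq_ivp: "phi q h x rho = ivp q 1 h x (rho ^ 2)" and phid_eq_ivp_deriv: "phid q h x rho = ivp_deriv q 1 h x (rho ^ 2)"
  by (simp_all add: phi_def phid_def ivp_def ivp_deriv_def phi_pair_def sol_pair_def)

text \<open>The definite description is meaningful because \<open>is_sol\<close> prescribes zero
  outside the interval: uniqueness on the interval becomes equality of functions on the whole
  line.\<close>

lemma sol_pair_is_sol:
  assumes q: "q absolutely_integrable_on {0..pi}"
  shows "is_sol q z (fst (sol_pair q a b z)) (snd (sol_pair q a b z)) \<and>
    fst (sol_pair q a b z) 0 = a \<and> snd (sol_pair q a b z) 0 = b"
proof -
  obtain y yd where y: "sol q z y yd" "y 0 = a" "yd 0 = b"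
    using solution_family_exists[OF q, of a b] by blast
  define p where "p = (\<lambda>x. if x \<in> {0..pi} then y x else 0, \<lambda>x. if x \<in> {0..pi} then yd x else 0)"
  have "sol q z (fst p) (snd p)"
  proof -
    have eq: "fst p t = y t" "snd p t = yd t" if "t \<in> {0..pi}" for t using that by (auto simp: p_def)
    have "integral {0..x} (snd p) = integral {0..x} yd"
      "integral {0..x} (\<lambda>t. (q t - z) * fst p t) = integral {0..x} (\<lambda>t. (q t - z) * y t)" if "x \<in> {0..pi}" for x
    proof -
      have "snd p t = yd t" "(q t - z) * fst p t = (q t - z) * y t" if "t \<in> {0..x}" for t
        using eq[of t] that \<open>x \<in> {0..pi}\<close> by simp_all
      then show "integral {0..x} (snd p) = integral {0..x} yd"
        "integral {0..x} (\<lambda>t. (q t - z) * fst p t) = integral {0..x} (\<lambda>t. (q t - z) * y t)"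
        by (intro integral_cong; blast)+
    qed
    note ints = this
    have "continuous_on {0..pi} (fst p)"
      by (rule continuous_on_eq[of _ y]) (use y(1) eq in \<open>auto simp only: sol_def\<close>)
    moreover have "continuous_on {0..pi} (snd p)"
      by (rule continuous_on_eq[of _ yd]) (use y(1) eq in \<open>auto simp only: sol_def\<close>)
    moreover have "fst p x = fst p 0 + integral {0..x} (snd p) \<and>
        snd p x = snd p 0 + integral {0..x} (\<lambda>t. (q t - z) * fst p t)" if x: "x \<in> {0..pi}" for x
    proof -
      have "y x = y 0 + integral {0..x} yd" "yd x = yd 0 + integral {0..x} (\<lambda>t. (q t - z) * y t)"
        using y(1) x unfolding sol_def by blast+
      moreover have "(0::real) \<in> {0..pi}" by simp
      ultimately show ?thesis by (simp only: eq x ints)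
    qed
    ultimately show ?thesis unfolding sol_def by blast
  qed
  then have "is_sol q z (fst p) (snd p)"
    by (intro sol_imp_is_sol q) (auto simp: p_def)
  moreover have "fst p 0 = a" "snd p 0 = b" using y by (auto simp: p_def)
  ultimately have ex: "is_sol q z (fst p) (snd p) \<and> fst p 0 = a \<and> snd p 0 = b" by blast
  moreover have "p' = p" if p': "is_sol q z (fst p') (snd p') \<and> fst p' 0 = a \<and> snd p' 0 = b" for p'
  proof -
    have "fst p' x = fst p x \<and> snd p' x = snd p x" for x
    proof (cases "x \<in> {0..pi}")
      case True
      then show ?thesis
        using sol_unique[OF q is_sol_imp_sol is_sol_imp_sol, of z "fst p'" "snd p'" "fst p" "snd p" 1 x] ex p' by simp
    next
      case False
      then show ?thesis using ex p' unfolding is_sol_def by metis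
    qed
    then show ?thesis by (simp add: prod_eq_iff fun_eq_iff)
  qed
  ultimately show ?thesis unfolding sol_pair_def by (rule theI)
qed

lemma sol_ivp:
  assumes "q absolutely_integrable_on {0..pi}"
  shows "sol q z (\<lambda>x. ivp q a b x z) (\<lambda>x. ivp_deriv q a b x z)" "ivp q a b 0 z = a" "ivp_deriv q a b 0 z = b"
  using sol_pair_is_sol[OF assms, of z a b] is_sol_imp_sol unfolding ivp_def ivp_deriv_def by auto

lemma ivp_unique:
  assumes q: "q absolutely_integrable_on {0..pi}" and s: "sol q z y yd" and x: "x \<in> {0..pi}"
  shows "y x = ivp q (y 0) (yd 0) x z" "yd x = ivp_deriv q (y 0) (yd 0) x z"
  using sol_unique[OF q s sol_ivp(1)[OF q], of 1 "y 0" "yd 0" x] sol_ivp(2,3)[OF q] x by auto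

lemma ivp_entire_bounded:
  assumes q: "q absolutely_integrable_on {0..pi}"
  shows "\<And>x. x \<in> {0..pi} \<Longrightarrow> ivp q a b x holomorphic_on UNIV"
    and "\<And>x. x \<in> {0..pi} \<Longrightarrow> ivp_deriv q a b x holomorphic_on UNIV"
    and "\<exists>C. \<forall>x\<in>{0..pi}. \<forall>z. cmod z \<le> R \<longrightarrow> cmod (ivp q a b x z) \<le> C \<and> cmod (ivp_deriv q a b x z) \<le> C"
proof -
  obtain u ud where s: "\<And>z. sol q z (\<lambda>x. u x z) (\<lambda>x. ud x z)" "\<And>z. u 0 z = a" "\<And>z. ud 0 z = b"
    and h: "\<And>x. x \<in> {0..pi} \<Longrightarrow> u x holomorphic_on UNIV" "\<And>x. x \<in> {0..pi} \<Longrightarrow> ud x holomorphic_on UNIV"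
    and bd: "\<And>R. \<exists>C. \<forall>x\<in>{0..pi}. \<forall>z. cmod z \<le> R \<longrightarrow> cmod (u x z) \<le> C \<and> cmod (ud x z) \<le> C"
    using solution_family_exists[OF q, of a b] by blast
  have eq: "ivp q a b x = u x" "ivp_deriv q a b x = ud x" if "x \<in> {0..pi}" for x
    using ivp_unique[OF q s(1) that] s(2,3) by (auto simp: fun_eq_iff)
  show "ivp q a b x holomorphic_on UNIV" "ivp_deriv q a b x holomorphic_on UNIV" if "x \<in> {0..pi}" for x
    using eq[OF that] h[OF that] by auto
  show "\<exists>C. \<forall>x\<in>{0..pi}. \<forall>z. cmod z \<le> R \<longrightarrow> cmod (ivp q a b x z) \<le> C \<and> cmod (ivp_deriv q a b x z) \<le> C"
    using bd[of R] eq by metis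
qed

section \<open>Asymptotics of solutions\<close>

lemma has_integral_reflect_pi:
  fixes f :: "real \<Rightarrow> 'a::banach"
  shows "((\<lambda>t. f (pi - t)) has_integral i) {pi - b..pi - a} \<longleftrightarrow> (f has_integral i) {a..b}"
proof -
  have "((\<lambda>t. f (pi - t)) has_integral i) {pi - b..pi - a} \<longleftrightarrow> ((\<lambda>t. f (- (t - pi))) has_integral i) {- b + pi..- a + pi}"
    by simp
  also have "\<dots> \<longleftrightarrow> ((\<lambda>t. f (- t)) has_integral i) {- b..- a}"
    using has_integral_shift_Icc_real[of "\<lambda>t. f (- (t - pi))" pi i "- b" "- a"] by (simp add: o_def add.commute)
  also have "\<dots> \<longleftrightarrow> (f has_integral i) {a..b}" by (rule has_integral_reflect_real)
  finally show ?thesis .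
qed

lemma absolutely_integrable_reflect_pi:
  fixes q :: "real \<Rightarrow> complex"
  assumes "q absolutely_integrable_on {0..pi}"
  shows "(\<lambda>t. q (pi - t)) absolutely_integrable_on {0..pi}"
proof -
  obtain i j where "(q has_integral i) {0..pi}" "((\<lambda>t. cmod (q t)) has_integral j) {0..pi}"
    using absolutely_integrable_imp_integrable[OF assms] norm_integrable[OF assms] by (auto simp: integrable_on_def)
  then have "((\<lambda>t. q (pi - t)) has_integral i) {0..pi}" "((\<lambda>t. cmod (q (pi - t))) has_integral j) {0..pi}"
    using has_integral_reflect_pi[of q i pi 0] has_integral_reflect_pi[of "\<lambda>t. cmod (q t)" j pi 0] by auto
  then show ?thesis unfolding absolutely_integrable_on_def by (auto simp: integrable_on_def)
qed

section \<open>Integration by parts, Lagrange identity and variation of constants\<close>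

lemma sol_has_vector_derivative:
  assumes s: "sol q z y yd" and t: "t \<in> {0..pi}"
  shows "(y has_vector_derivative yd t) (at t within {0..pi})"
proof -
  have "((\<lambda>u. y 0 + integral {0..u} yd) has_vector_derivative 0 + yd t) (at t within {0..pi})"
    using s t unfolding sol_def
    by (intro has_vector_derivative_add has_vector_derivative_const integral_has_vector_derivative) blast+
  moreover have "y 0 + integral {0..u} yd = y u" if "u \<in> {0..pi}" for u
    using s that unfolding sol_def by metis
  ultimately show ?thesis
    using has_vector_derivative_transform[OF t, of y "\<lambda>u. y 0 + integral {0..u} yd" "yd t"] by simp
qed

text \<open>The factor \<open>u\<close> is continuously differentiable, while the second formula
  integrates by parts against \<open>yd\<close>, which is in general only absolutely
  continuous.\<close>

lemma has_integral_sol_times_smooth: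
  assumes q: "q absolutely_integrable_on {0..pi}" and s: "sol q z y yd"
    and u: "\<And>t. t \<in> {0..pi} \<Longrightarrow> (u has_vector_derivative u' t) (at t within {0..pi})"
    and u': "continuous_on {0..pi} u'" and x: "x \<in> {0..pi}"
  shows "((\<lambda>t. u' t * y t + u t * yd t) has_integral u x * y x - u 0 * y 0) {0..x}"
    and "((\<lambda>t. u' t * yd t + u t * ((q t - z) * y t)) has_integral u x * yd x - u 0 * yd 0) {0..x}"
proof -
  have "yd absolutely_integrable_on {0..pi}"
    using s by (intro absolutely_integrable_continuous_real) (simp add: sol_def)
  moreover have "y t = y 0 + integral {0..t} yd" if "t \<in> {0..pi}" for t
    using s that unfolding sol_def by blast
  ultimately show "((\<lambda>t. u' t * y t + u t * yd t) has_integral u x * y x - u 0 * y 0) {0..x}"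
    by (intro product_rule_indefinite_integral[OF u u' _ _ x])
  have "(\<lambda>t. (q t - z) * y t) absolutely_integrable_on {0..pi}"
    using s by (intro absolutely_integrable_mult_continuous absolutely_integrable_diff_const q) (simp add: sol_def)
  moreover have "yd t = yd 0 + integral {0..t} (\<lambda>t. (q t - z) * y t)" if "t \<in> {0..pi}" for t
    using s that unfolding sol_def by blast
  ultimately show "((\<lambda>t. u' t * yd t + u t * ((q t - z) * y t)) has_integral u x * yd x - u 0 * yd 0) {0..x}"
    by (intro product_rule_indefinite_integral[OF u u' _ _ x])
qed

text \<open>In each of the products \<open>y * ud\<close> and \<open>u * yd\<close> the plain
  solution serves as the smooth factor. On subtraction the terms with \<open>q\<close> and with
  \<open>yd * ud\<close> cancel and \<open>(z - w) * y * u\<close> is left.\<close>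

lemma lagrange_identity:
  assumes q: "q absolutely_integrable_on {0..pi}" and y: "sol q z y yd" and u: "sol q w u ud"
    and x: "x \<in> {0..pi}"
  shows "(z - w) * integral {0..x} (\<lambda>t. y t * u t) = (y x * ud x - yd x * u x) - (y 0 * ud 0 - yd 0 * u 0)"
proof -
  have c: "continuous_on {0..pi} yd" "continuous_on {0..pi} ud" "continuous_on {0..pi} y" "continuous_on {0..pi} u"
    using y u by (auto simp: sol_def)
  have 1: "((\<lambda>t. yd t * ud t + y t * ((q t - w) * u t)) has_integral y x * ud x - y 0 * ud 0) {0..x}"
    by (rule has_integral_sol_times_smooth(2)[OF q u sol_has_vector_derivative[OF y] c(1) x])
  have 2: "((\<lambda>t. ud t * yd t + u t * ((q t - z) * y t)) has_integral u x * yd x - u 0 * yd 0) {0..x}"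
    by (rule has_integral_sol_times_smooth(2)[OF q y sol_has_vector_derivative[OF u] c(2) x])
  have "(yd t * ud t + y t * ((q t - w) * u t)) - (ud t * yd t + u t * ((q t - z) * y t)) = (z - w) * (y t * u t)" for t
    by (simp add: algebra_simps)
  then have "((\<lambda>t. (z - w) * (y t * u t)) has_integral (y x * ud x - y 0 * ud 0) - (u x * yd x - u 0 * yd 0)) {0..x}"
    using has_integral_diff[OF 1 2] by simp
  then have "integral {0..x} (\<lambda>t. (z - w) * (y t * u t)) = (y x * ud x - y 0 * ud 0) - (u x * yd x - u 0 * yd 0)"
    by (rule integral_unique)
  then have "(z - w) * integral {0..x} (\<lambda>t. y t * u t) = (y x * ud x - y 0 * ud 0) - (u x * yd x - u 0 * yd 0)"
    by (simp only: integral_mult_right)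
  then show ?thesis by (simp only: algebra_simps)
qed

text \<open>Obtained by testing the equation with \<open>sin (r * (x - t))\<close> and
  \<open>cos (r * (x - t))\<close>. The first formula is kept multiplied by \<open>r\<close>, so
  that \<open>r = 0\<close> is no exception.\<close>

lemma variation_of_constants:
  assumes q: "q absolutely_integrable_on {0..pi}" and s: "sol q (r ^ 2) y yd" and x: "x \<in> {0..pi}"
  shows "r * y x = r * y 0 * cos (r * x) + yd 0 * sin (r * x) + integral {0..x} (\<lambda>t. q t * (y t * sin (r * (x - t))))"
    and "yd x = yd 0 * cos (r * x) - r * y 0 * sin (r * x) + integral {0..x} (\<lambda>t. q t * (y t * cos (r * (x - t))))"
proof -
  let ?s = "\<lambda>t. sin (r * of_real (x - t))" and ?c = "\<lambda>t. cos (r * of_real (x - t))"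
  have ds: "(?s has_vector_derivative - r * ?c t) (at t within {0..pi})" for t
  proof -
    have "((\<lambda>w. sin (r * (of_real x - w))) has_field_derivative - r * ?c t) (at (of_real t))"
      by (auto intro!: derivative_eq_intros)
    from has_vector_derivative_real_field[OF this] show ?thesis by simp
  qed
  have dc: "(?c has_vector_derivative r * ?s t) (at t within {0..pi})" for t
  proof -
    have "((\<lambda>w. cos (r * (of_real x - w))) has_field_derivative r * ?s t) (at (of_real t))"
      by (auto intro!: derivative_eq_intros)
    from has_vector_derivative_real_field[OF this] show ?thesis by simp
  qed
  have s1: "((\<lambda>t. (- r * ?c t) * y t + ?s t * yd t) has_integral ?s x * y x - ?s 0 * y 0) {0..x}"
    by (rule has_integral_sol_times_smooth(1)[OF q s ds _ x]) (intro continuous_intros)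
  have s2: "((\<lambda>t. (- r * ?c t) * yd t + ?s t * ((q t - r ^ 2) * y t)) has_integral ?s x * yd x - ?s 0 * yd 0) {0..x}"
    by (rule has_integral_sol_times_smooth(2)[OF q s ds _ x]) (intro continuous_intros)
  have c1: "((\<lambda>t. (r * ?s t) * y t + ?c t * yd t) has_integral ?c x * y x - ?c 0 * y 0) {0..x}"
    by (rule has_integral_sol_times_smooth(1)[OF q s dc _ x]) (intro continuous_intros)
  have c2: "((\<lambda>t. (r * ?s t) * yd t + ?c t * ((q t - r ^ 2) * y t)) has_integral ?c x * yd x - ?c 0 * yd 0) {0..x}"
    by (rule has_integral_sol_times_smooth(2)[OF q s dc _ x]) (intro continuous_intros)
  have "((- r * ?c t) * yd t + ?s t * ((q t - r ^ 2) * y t)) + r * ((r * ?s t) * y t + ?c t * yd t) = q t * (y t * ?s t)" for t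
    by (simp add: algebra_simps power2_eq_square)
  then have "((\<lambda>t. q t * (y t * ?s t)) has_integral (?s x * yd x - ?s 0 * yd 0) + r * (?c x * y x - ?c 0 * y 0)) {0..x}"
    using has_integral_add[OF s2 has_integral_mult_right[OF c1, of r]] by simp
  then have "integral {0..x} (\<lambda>t. q t * (y t * ?s t)) = (?s x * yd x - ?s 0 * yd 0) + r * (?c x * y x - ?c 0 * y 0)"
    by (rule integral_unique)
  then show "r * y x = r * y 0 * cos (r * x) + yd 0 * sin (r * x) + integral {0..x} (\<lambda>t. q t * (y t * sin (r * (x - t))))"
    by (simp add: algebra_simps)
  have "((r * ?s t) * yd t + ?c t * ((q t - r ^ 2) * y t)) - r * ((- r * ?c t) * y t + ?s t * yd t) = q t * (y t * ?c t)" for t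
    by (simp add: algebra_simps power2_eq_square)
  then have "((\<lambda>t. q t * (y t * ?c t)) has_integral (?c x * yd x - ?c 0 * yd 0) - r * (?s x * y x - ?s 0 * y 0)) {0..x}"
    using has_integral_diff[OF c2 has_integral_mult_right[OF s1, of r]] by simp
  then have "integral {0..x} (\<lambda>t. q t * (y t * ?c t)) = (?c x * yd x - ?c 0 * yd 0) - r * (?s x * y x - ?s 0 * y 0)"
    by (rule integral_unique)
  then show "yd x = yd 0 * cos (r * x) - r * y 0 * sin (r * x) + integral {0..x} (\<lambda>t. q t * (y t * cos (r * (x - t))))"
    by (simp add: algebra_simps)
qed

lemma norm_sin_cos_le:
  fixes r :: complex
  assumes "s \<ge> 0"
  shows "cmod (sin (r * of_real s)) \<le> exp (\<bar>Im r\<bar> * s)" and "cmod (cos (r * of_real s)) \<le> exp (\<bar>Im r\<bar> * s)"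
  using cmod_sin_le_exp[of 1 "r * of_real s"] cmod_cos_le_exp[of 1 "r * of_real s"] assms
  by (auto simp: abs_mult)

text \<open>In the norm with weight \<open>exp (- |Im r| * t)\<close>, variation of constants at the
  maximum point bounds \<open>cmod r * m\<close> by the data plus \<open>m * Q\<close>. Since
  \<open>cmod r >= 2 * Q + 1\<close>, the last term is absorbed and \<open>m\<close> is at most
  twice \<open>cmod (y 0) + cmod (yd 0)\<close>. Inserting this once more gives the error constant
  \<open>K\<close>.\<close>

lemma sol_asymptotics:
  assumes q: "q absolutely_integrable_on {0..pi}" and s: "sol q (r ^ 2) y yd" and x: "x \<in> {0..pi}"
    and Q: "Q = integral {0..pi} (\<lambda>t. cmod (q t))" and r: "cmod r \<ge> 2 * Q + 1"
    and K: "K = cmod (yd 0) + 2 * Q * (cmod (y 0) + cmod (yd 0))"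
  shows "cmod (y x - y 0 * cos (r * x)) \<le> K / cmod r * exp (\<bar>Im r\<bar> * x)"
    and "cmod (yd x + y 0 * r * sin (r * x)) \<le> K * exp (\<bar>Im r\<bar> * x)"
proof -
  define T where "T = \<bar>Im r\<bar>"
  have Q0: "Q \<ge> 0" unfolding Q by (intro integral_nonneg norm_integrable q) auto
  then have r1: "cmod r \<ge> 1" "r \<noteq> 0" using r by auto
  have y: "continuous_on {0..pi} y" using s by (simp add: sol_def)
  obtain x0 m where x0: "x0 \<in> {0..pi}" and m0: "m \<ge> 0" and m: "cmod (y x0) = m * exp (T * x0)"
    and le: "\<And>t. t \<in> {0..pi} \<Longrightarrow> cmod (y t) \<le> m * exp (T * t)"
    by (rule exponential_majorant[OF y, where M = T]) (erule that)
  have int: "cmod (integral {0..x} (\<lambda>t. q t * (y t * g (r * of_real (x - t))))) \<le> m * Q * exp (T * x)"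
    if x: "x \<in> {0..pi}" and g: "\<And>s. s \<ge> 0 \<Longrightarrow> cmod (g (r * of_real s)) \<le> exp (T * s)" "continuous_on UNIV g"
    for x and g :: "complex \<Rightarrow> complex"
  proof -
    have "cmod (integral {0..x} (\<lambda>t. q t * (y t * g (r * of_real (x - t))))) \<le> m * exp (T * x) * integral {0..x} (\<lambda>t. cmod (q t))"
    proof (rule norm_integral_mult_le)
      show "q absolutely_integrable_on {0..x}" using x by (intro absolutely_integrable_subinterval_real[OF q]) auto
      show "continuous_on {0..x} (\<lambda>t. y t * g (r * of_real (x - t)))"
        using x by (intro continuous_intros continuous_on_subset[OF y] continuous_on_compose2[OF g(2)]) auto
      fix t assume t: "t \<in> {0..x}"
      have "cmod (y t * g (r * of_real (x - t))) \<le> (m * exp (T * t)) * exp (T * (x - t))"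
        unfolding norm_mult using t x m0 by (intro mult_mono le g) auto
      also have "\<dots> = m * exp (T * x)" by (simp add: algebra_simps flip: exp_add)
      finally show "cmod (y t * g (r * of_real (x - t))) \<le> m * exp (T * x)" .
    qed
    also have "\<dots> \<le> m * exp (T * x) * Q"
      unfolding Q using m0 x by (intro mult_left_mono integral_cmod_mono q) auto
    finally show ?thesis by (simp add: algebra_simps)
  qed
  have sc: "continuous_on UNIV (sin :: complex \<Rightarrow> complex)" "continuous_on UNIV (cos :: complex \<Rightarrow> complex)"
    by (simp_all add: continuous_at_imp_continuous_on)
  have ints: "cmod (integral {0..x} (\<lambda>t. q t * (y t * sin (r * (x - t))))) \<le> m * Q * exp (T * x)"
    and intc: "cmod (integral {0..x} (\<lambda>t. q t * (y t * cos (r * (x - t))))) \<le> m * Q * exp (T * x)"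
    if "x \<in> {0..pi}" for x
    using int[OF that norm_sin_cos_le(1)[of _ r, folded T_def] sc(1)]
      int[OF that norm_sin_cos_le(2)[of _ r, folded T_def] sc(2)] by auto
  have main: "cmod (r * (y x - y 0 * cos (r * x))) \<le> (cmod (yd 0) + m * Q) * exp (T * x)" if x: "x \<in> {0..pi}" for x
  proof -
    have "r * (y x - y 0 * cos (r * x)) = yd 0 * sin (r * x) + integral {0..x} (\<lambda>t. q t * (y t * sin (r * (x - t))))"
      using variation_of_constants(1)[OF q s x] by (simp add: algebra_simps)
    also have "cmod \<dots> \<le> cmod (yd 0) * exp (T * x) + m * Q * exp (T * x)"
      using ints[OF x] norm_sin_cos_le(1)[of x r] x unfolding T_def
      by (intro order_trans[OF norm_triangle_ineq] add_mono) (auto simp: norm_mult intro: mult_left_mono)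
    finally show ?thesis by (simp add: algebra_simps)
  qed
  have "cmod r * cmod (y x0) \<le> cmod r * cmod (y 0 * cos (r * x0)) + cmod (r * (y x0 - y 0 * cos (r * x0)))"
    using norm_triangle_ineq[of "r * (y 0 * cos (r * x0))" "r * (y x0 - y 0 * cos (r * x0))"]
    by (simp add: algebra_simps norm_mult)
  also have "\<dots> \<le> cmod r * (cmod (y 0) * exp (T * x0)) + (cmod (yd 0) + m * Q) * exp (T * x0)"
    using main[OF x0] norm_sin_cos_le(2)[of x0 r] x0 unfolding T_def
    by (intro add_mono mult_left_mono) (auto simp: norm_mult intro: mult_left_mono)
  finally have "cmod r * m * exp (T * x0) \<le> (cmod r * cmod (y 0) + cmod (yd 0) + m * Q) * exp (T * x0)"
    unfolding m by (simp add: algebra_simps)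
  then have "cmod r * m \<le> cmod r * cmod (y 0) + cmod (yd 0) + m * Q" by simp
  also have "\<dots> \<le> cmod r * cmod (y 0) + cmod r * cmod (yd 0) + m * (cmod r / 2)"
  proof -
    have "1 * cmod (yd 0) \<le> cmod r * cmod (yd 0)" using r1 by (intro mult_right_mono) auto
    moreover have "m * Q \<le> m * (cmod r / 2)" using r m0 by (intro mult_left_mono) auto
    ultimately show ?thesis by linarith
  qed
  finally have "cmod r * m \<le> cmod r * (2 * (cmod (y 0) + cmod (yd 0)))" by (simp add: algebra_simps)
  then have m2: "m \<le> 2 * (cmod (y 0) + cmod (yd 0))" using r1 by simp
  have mQ: "cmod (yd 0) + m * Q \<le> K" unfolding K using mult_right_mono[OF m2 Q0] by (simp add: algebra_simps)
  have "cmod (r * (y x - y 0 * cos (r * x))) \<le> K * exp (T * x)"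
    by (rule order_trans[OF main[OF x]]) (intro mult_right_mono mQ, simp)
  then have "cmod r * cmod (y x - y 0 * cos (r * x)) \<le> K * exp (T * x)" by (simp only: norm_mult)
  then show "cmod (y x - y 0 * cos (r * x)) \<le> K / cmod r * exp (\<bar>Im r\<bar> * x)"
    using r1 by (simp add: T_def field_simps)
  have "yd x + y 0 * r * sin (r * x) = yd 0 * cos (r * x) + integral {0..x} (\<lambda>t. q t * (y t * cos (r * (x - t))))"
    using variation_of_constants(2)[OF q s x] by (simp add: algebra_simps)
  also have "cmod \<dots> \<le> cmod (yd 0) * exp (T * x) + m * Q * exp (T * x)"
    using intc[OF x] norm_sin_cos_le(2)[of x r] x unfolding T_def
    by (intro order_trans[OF norm_triangle_ineq] add_mono) (auto simp: norm_mult intro: mult_left_mono)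
  also have "\<dots> \<le> K * exp (T * x)" using mult_right_mono[OF mQ, of "exp (T * x)"] by (simp add: algebra_simps)
  finally show "cmod (yd x + y 0 * r * sin (r * x)) \<le> K * exp (\<bar>Im r\<bar> * x)" by (simp add: T_def)
qed

lemma sol_reflect:
  assumes q: "q absolutely_integrable_on {0..pi}" and s: "sol q z y yd"
  shows "sol (\<lambda>t. q (pi - t)) z (\<lambda>x. y (pi - x)) (\<lambda>x. - yd (pi - x))"
proof -
  have c: "continuous_on {0..pi} y" "continuous_on {0..pi} yd" using s by (auto simp: sol_def)
  have w: "(\<lambda>t. (q t - z) * y t) integrable_on {0..pi}"
    by (intro absolutely_integrable_imp_integrable absolutely_integrable_mult_continuous
        absolutely_integrable_diff_const q c)
  have yd: "yd integrable_on {0..pi}" by (intro integrable_continuous_interval c)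
  have refl: "integral {0..x} (\<lambda>t. f (pi - t)) = integral {0..pi} f - integral {0..pi - x} f"
    if "x \<in> {0..pi}" "f integrable_on {0..pi}" for x and f :: "real \<Rightarrow> complex"
  proof -
    have "(f has_integral integral {pi - x..pi} f) {pi - x..pi}"
      using that integrable_subinterval_real[OF that(2), of "pi - x" pi] by (auto intro: integrable_integral)
    then have "((\<lambda>t. f (pi - t)) has_integral integral {pi - x..pi} f) {0..x}"
      using has_integral_reflect_pi[of f "integral {pi - x..pi} f" pi "pi - x"] by simp
    then have "integral {0..x} (\<lambda>t. f (pi - t)) = integral {pi - x..pi} f" by (rule integral_unique)
    then show ?thesis
      using Henstock_Kurzweil_Integration.integral_combine[of 0 "pi - x" pi f] that by (auto simp: algebra_simps)
  qed
  have eq: "y (pi - x) = y (pi - 0) + integral {0..x} (\<lambda>x. - yd (pi - x)) \<and>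
     - yd (pi - x) = - yd (pi - 0) + integral {0..x} (\<lambda>t. (q (pi - t) - z) * y (pi - t))" if x: "x \<in> {0..pi}" for x
  proof -
    have x': "pi - x \<in> {0..pi}" and p: "pi \<in> {0..pi}" using x by auto
    have "y (pi - x) = y 0 + integral {0..pi - x} yd" "yd (pi - x) = yd 0 + integral {0..pi - x} (\<lambda>t. (q t - z) * y t)"
      using s x' unfolding sol_def by blast+
    moreover have "y pi = y 0 + integral {0..pi} yd" "yd pi = yd 0 + integral {0..pi} (\<lambda>t. (q t - z) * y t)"
      using s p unfolding sol_def by blast+
    moreover have "integral {0..x} (\<lambda>x. - yd (pi - x)) = - (integral {0..pi} yd - integral {0..pi - x} yd)"
      using refl[OF x yd] by simp
    ultimately show ?thesis using refl[OF x w] by simp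
  qed
  have "(\<lambda>x. pi - x) ` {0..pi} \<subseteq> {0..pi}" by auto
  then have "continuous_on {0..pi} (\<lambda>x. y (pi - x))" "continuous_on {0..pi} (\<lambda>x. - yd (pi - x))"
    by (intro continuous_intros continuous_on_compose2[OF c(1)] continuous_on_compose2[OF c(2)]; assumption)+
  then show ?thesis unfolding sol_def using eq by blast
qed

section \<open>The characteristic function\<close>

text \<open>Four times the squared modulus is
  \<open>exp (2 * I) + exp (- 2 * I) - 2 * cos (2 * pi * Re r)\<close>. Near the real axis the
  circle stays close to a half-integer, where the cosine is not positive; farther away
  \<open>exp (2 * I) >= 4\<close> outweighs the cosine.\<close>

lemma norm_sin_ge_on_circle:
  fixes r :: complex
  assumes r: "cmod r = real N + 1/2"
  shows "cmod (sin (r * of_real pi)) \<ge> exp (\<bar>Im r\<bar> * pi) / 4"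
proof -
  define I where "I = \<bar>Im r\<bar> * pi"
  have sq: "cmod (sin (r * of_real pi)) ^ 2 = (exp (2 * I) + exp (- 2 * I) - 2 * cos (2 * (Re r * pi))) / 4"
  proof (cases "Im r \<ge> 0")
    case True
    then show ?thesis using norm_sin_squared[of "r * of_real pi"]
      by (simp add: I_def exp_minus mult.assoc)
  next
    case False
    then show ?thesis using norm_sin_squared[of "r * of_real pi"]
      by (simp add: I_def exp_minus mult.assoc)
  qed
  have sum_sq: "(Re r)\<^sup>2 + (Im r)\<^sup>2 = (real N + 1/2)\<^sup>2" using r cmod_power2[of r] by simp
  have "exp (2 * I) + exp (- 2 * I) - 2 * cos (2 * (Re r * pi)) \<ge> exp (2 * I) / 4"
  proof (cases "\<bar>Im r\<bar> \<le> 1/3")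
    case True
    \<comment> \<open>\<open>d\<close> is how far \<open>|Re r|\<close> falls short of the
      half-integer. The circle equation gives \<open>d * (N + 1/2 + |Re r|) = (Im r)^2\<close>,
      which with \<open>|Im r| <= 1/3\<close> makes \<open>d\<close> less than 1/4.\<close>
    define d where "d = real N + 1/2 - \<bar>Re r\<bar>"
    have "\<bar>Re r\<bar> \<le> real N + 1/2" using abs_Re_le_cmod[of r] r by simp
    then have d0: "d \<ge> 0" by (simp add: d_def)
    have "d * (real N + 1/2) \<le> d * (real N + 1/2 + \<bar>Re r\<bar>)" using d0 by (intro mult_left_mono) auto
    also have "\<dots> = (Im r)\<^sup>2" using sum_sq by (simp add: d_def algebra_simps power2_eq_square)
    also have "\<dots> \<le> (1/3)\<^sup>2" using True by (metis abs_ge_zero power2_abs power_mono)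
    finally have "d * (1/2) \<le> 1/9" using d0 mult_left_mono[of "1/2" "real N + 1/2" d] by (simp add: power2_eq_square)
    then have d1: "d \<le> 1/4" by simp
    have "cos (2 * (Re r * pi)) = cos (2 * (\<bar>Re r\<bar> * pi))"
      by (cases "Re r \<ge> 0") auto
    also have "2 * (\<bar>Re r\<bar> * pi) = (pi - 2 * d * pi) + 2 * real N * pi" by (simp add: d_def algebra_simps)
    also have "cos \<dots> = - cos (2 * d * pi)"
      by (simp only: cos_add sin_2npi cos_2npi) simp
    also have "\<dots> \<le> 0" using d0 d1 by (auto intro!: cos_ge_zero simp: field_simps) (metis d0 pi_ge_zero mult_nonneg_nonneg neg_le_0_iff_le order_trans zero_le_numeral)
    finally have "cos (2 * (Re r * pi)) \<le> 0" .
    then show ?thesis using exp_gt_zero[of "2 * I"] exp_gt_zero[of "- 2 * I"] by linarith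
  next
    case False
    then have "I > 1/3 * pi" unfolding I_def by (intro mult_strict_right_mono) auto
    then have "I > 1" using pi_gt3 by linarith
    then have "exp (2 * I) \<ge> exp 2" by simp
    moreover have "exp 2 \<ge> (4 :: real)"
    proof -
      have "(2::real) * 2 \<le> exp 1 * exp 1"
        using exp_ge_add_one_self[of "1::real"] by (intro mult_mono) auto
      then show ?thesis by (simp flip: exp_add)
    qed
    moreover have "cos (2 * (Re r * pi)) \<le> 1" by simp
    moreover have "exp (- 2 * I) > 0" by simp
    ultimately show ?thesis by linarith
  qed
  then have "(exp I / 4)\<^sup>2 \<le> cmod (sin (r * of_real pi)) ^ 2"
    unfolding sq by (simp add: power_divide exp_double)
  then show ?thesis unfolding I_def[symmetric] by (rule power2_le_imp_le) simp
qed

text \<open>On \<open>cmod r <= 2 * Q + 1\<close> local boundedness suffices; beyond it the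
  asymptotics apply. The factor \<open>1 + cmod r\<close> is the cost of the leading term
  \<open>a * r * sin (r * x)\<close> of the derivative.\<close>

lemma ivp_growth:
  assumes q: "q absolutely_integrable_on {0..pi}"
  obtains C where "C \<ge> 0"
    "\<And>r x. x \<in> {0..pi} \<Longrightarrow> cmod (ivp q a b x (r ^ 2)) \<le> C * exp (\<bar>Im r\<bar> * x)"
    "\<And>r x. x \<in> {0..pi} \<Longrightarrow> cmod (ivp_deriv q a b x (r ^ 2)) \<le> C * (1 + cmod r) * exp (\<bar>Im r\<bar> * x)"
proof -
  define Q where "Q = integral {0..pi} (\<lambda>t. cmod (q t))"
  have Q0: "Q \<ge> 0" unfolding Q_def by (intro integral_nonneg norm_integrable q) auto
  define K where "K = cmod b + 2 * Q * (cmod a + cmod b)"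
  have K0: "K \<ge> 0" using Q0 by (simp add: K_def)
  obtain B where B: "\<And>x z. x \<in> {0..pi} \<Longrightarrow> cmod z \<le> (2 * Q + 1) ^ 2 \<Longrightarrow> cmod (ivp q a b x z) \<le> B \<and> cmod (ivp_deriv q a b x z) \<le> B"
    using ivp_entire_bounded(3)[OF q] by metis
  have B0: "B \<ge> 0" using B[of 0 0] by (auto intro: order_trans[OF norm_ge_zero])
  define C where "C = B + K + cmod a"
  have C: "C \<ge> 0" using B0 K0 by (simp add: C_def)
  have "cmod (ivp q a b x (r ^ 2)) \<le> C * exp (\<bar>Im r\<bar> * x) \<and> cmod (ivp_deriv q a b x (r ^ 2)) \<le> C * (1 + cmod r) * exp (\<bar>Im r\<bar> * x)"
    if x: "x \<in> {0..pi}" for x r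
  proof -
    define E where "E = exp (\<bar>Im r\<bar> * x)"
    have E: "E \<ge> 1" using x by (simp add: E_def)
    show ?thesis
    proof (cases "cmod r \<le> 2 * Q + 1")
      case True
      then have "cmod (r ^ 2) \<le> (2 * Q + 1) ^ 2" by (simp add: norm_power power_mono)
      note B = B[OF x this]
      have "B * 1 * 1 \<le> C * (1 + cmod r) * E" "B * 1 \<le> C * E"
        using B0 K0 C E by (intro mult_mono; simp add: C_def)+
      then show ?thesis using B by (simp add: E_def)
    next
      case False
      then have r: "cmod r \<ge> 2 * Q + 1" and r1: "cmod r \<ge> 1" using Q0 by auto
      note sY = sol_ivp[OF q, where z = "r ^ 2" and a = a and b = b]
      have 1: "cmod (ivp q a b x (r ^ 2) - a * cos (r * x)) \<le> K / cmod r * E"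
        and 2: "cmod (ivp_deriv q a b x (r ^ 2) + a * r * sin (r * x)) \<le> K * E"
        using sol_asymptotics[OF q sY(1) x Q_def r refl] by (simp_all add: sY K_def E_def)
      have sc: "cmod (sin (r * of_real x)) \<le> E" "cmod (cos (r * of_real x)) \<le> E"
        using norm_sin_cos_le[of x r] x by (auto simp: E_def)
      have "cmod (ivp q a b x (r ^ 2)) \<le> cmod (ivp q a b x (r ^ 2) - a * cos (r * x)) + cmod (a * cos (r * x))"
        using norm_triangle_ineq[of "ivp q a b x (r ^ 2) - a * cos (r * x)" "a * cos (r * x)"] by simp
      also have "\<dots> \<le> K / cmod r * E + cmod a * E"
        using 1 sc by (intro add_mono) (auto simp: norm_mult intro: mult_left_mono)
      also have "\<dots> \<le> K * E + cmod a * E"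
        using r1 K0 E by (intro add_right_mono mult_right_mono) (auto simp: divide_le_eq mult_left_le mult_le_cancel_left1)
      also have "\<dots> \<le> C * E" using E B0 by (simp add: C_def algebra_simps)
      finally have A: "cmod (ivp q a b x (r ^ 2)) \<le> C * E" .
      have "cmod (ivp_deriv q a b x (r ^ 2)) \<le> cmod (ivp_deriv q a b x (r ^ 2) + a * r * sin (r * x)) + cmod (a * r * sin (r * x))"
        using norm_triangle_ineq4[of "ivp_deriv q a b x (r ^ 2) + a * r * sin (r * x)" "a * r * sin (r * x)"] by simp
      also have "\<dots> \<le> K * E + cmod a * cmod r * E"
        using 2 sc by (intro add_mono) (auto simp: norm_mult intro: mult_left_mono)
      also have "\<dots> \<le> K * (1 + cmod r) * E + cmod a * (1 + cmod r) * E"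
        using K0 E by (intro add_mono mult_right_mono) (auto simp: mult_le_cancel_left1 intro: mult_left_mono)
      also have "\<dots> \<le> C * (1 + cmod r) * E"
        using E B0 by (simp add: C_def algebra_simps)
      finally show ?thesis using A by (simp add: E_def)
    qed
  qed
  then show ?thesis using that[OF C] by blast
qed

locale sturm_liouville =
  fixes q :: "real \<Rightarrow> complex" and h H :: complex
  assumes q: "q absolutely_integrable_on {0..pi}"
begin

text \<open>\<open>f\<close> is \<open>\<phi>\<close> and \<open>c\<close> is \<open>\<chi>\<close>, as functions of \<open>\<lambda> = \<rho>\<^sup>2\<close>; \<open>fd\<close> and \<open>cd\<close> are their derivatives in \<open>x\<close>. Solving the
  reflected problem from the left gives the growth bounds for \<open>c\<close> in terms of \<open>\<pi> - x\<close>.\<close>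

definition f :: "real \<Rightarrow> complex \<Rightarrow> complex" where "f x z = ivp q 1 h x z"
definition fd :: "real \<Rightarrow> complex \<Rightarrow> complex" where "fd x z = ivp_deriv q 1 h x z"
definition c :: "real \<Rightarrow> complex \<Rightarrow> complex" where "c x z = ivp (\<lambda>t. q (pi - t)) 1 H (pi - x) z"
definition cd :: "real \<Rightarrow> complex \<Rightarrow> complex" where "cd x z = - ivp_deriv (\<lambda>t. q (pi - t)) 1 H (pi - x) z"
definition Del :: "complex \<Rightarrow> complex" where "Del z = fd pi z + H * f pi z"

lemma qr: "(\<lambda>t. q (pi - t)) absolutely_integrable_on {0..pi}"
  by (rule absolutely_integrable_reflect_pi[OF q])

lemma sol_f: "sol q z (\<lambda>x. f x z) (\<lambda>x. fd x z)" and f0: "f 0 z = 1" and fd0: "fd 0 z = h"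
  using sol_ivp[OF q] by (auto simp: f_def fd_def)

lemma sol_c: "sol q z (\<lambda>x. c x z) (\<lambda>x. cd x z)" and c_pi: "c pi z = 1" and cd_pi: "cd pi z = - H"
  using sol_reflect[OF qr sol_ivp(1)[OF qr]] sol_ivp(2,3)[OF qr] by (auto simp: c_def cd_def)

lemma continuous_fc:
  "continuous_on {0..pi} (\<lambda>x. f x z)" "continuous_on {0..pi} (\<lambda>x. fd x z)"
  "continuous_on {0..pi} (\<lambda>x. c x z)" "continuous_on {0..pi} (\<lambda>x. cd x z)"
  using sol_f sol_c by (auto simp: sol_def)

lemma holomorphic_fc:
  assumes "x \<in> {0..pi}"
  shows "f x holomorphic_on S" "fd x holomorphic_on S" "c x holomorphic_on S" "cd x holomorphic_on S"
proof -
  have "pi - x \<in> {0..pi}" using assms by auto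
  then have "f x holomorphic_on UNIV" "fd x holomorphic_on UNIV" "c x holomorphic_on UNIV" "cd x holomorphic_on UNIV"
    using ivp_entire_bounded(1,2)[OF q assms] ivp_entire_bounded(1,2)[OF qr, of "pi - x"]
    unfolding f_def[abs_def] fd_def[abs_def] c_def[abs_def] cd_def[abs_def]
    by (auto intro!: holomorphic_intros)
  then show "f x holomorphic_on S" "fd x holomorphic_on S" "c x holomorphic_on S" "cd x holomorphic_on S"
    using holomorphic_on_subset by blast+
qed

lemma holomorphic_Del: "Del holomorphic_on S"
  unfolding Del_def[abs_def] by (intro holomorphic_intros holomorphic_fc) auto

text \<open>For equal spectral parameters the left side of the Lagrange identity vanishes, so the
  Wronskian does not depend on \<open>x\<close>, and at \<open>pi\<close> the normalisation of
  \<open>c\<close> gives \<open>Del\<close>.\<close>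

lemma wronskian: "x \<in> {0..pi} \<Longrightarrow> c x z * fd x z - cd x z * f x z = Del z"
  using lagrange_identity[OF q sol_c[of z] sol_f[of z], of x] lagrange_identity[OF q sol_c[of z] sol_f[of z], of pi]
  by (simp add: Del_def c_pi cd_pi)

lemma growth:
  obtains C where "C \<ge> 0"
    "\<And>r x. x \<in> {0..pi} \<Longrightarrow> cmod (f x (r ^ 2)) \<le> C * exp (\<bar>Im r\<bar> * x)"
    "\<And>r x. x \<in> {0..pi} \<Longrightarrow> cmod (fd x (r ^ 2)) \<le> C * (1 + cmod r) * exp (\<bar>Im r\<bar> * x)"
    "\<And>r x. x \<in> {0..pi} \<Longrightarrow> cmod (c x (r ^ 2)) \<le> C * exp (\<bar>Im r\<bar> * (pi - x))"
    "\<And>r x. x \<in> {0..pi} \<Longrightarrow> cmod (cd x (r ^ 2)) \<le> C * (1 + cmod r) * exp (\<bar>Im r\<bar> * (pi - x))"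
proof -
  obtain C where C: "C \<ge> 0"
    "\<And>r x. x \<in> {0..pi} \<Longrightarrow> cmod (ivp q 1 h x (r ^ 2)) \<le> C * exp (\<bar>Im r\<bar> * x)"
    "\<And>r x. x \<in> {0..pi} \<Longrightarrow> cmod (ivp_deriv q 1 h x (r ^ 2)) \<le> C * (1 + cmod r) * exp (\<bar>Im r\<bar> * x)"
    using ivp_growth[OF q, of 1 h] by blast
  obtain D where D: "D \<ge> 0"
    "\<And>r x. x \<in> {0..pi} \<Longrightarrow> cmod (ivp (\<lambda>t. q (pi - t)) 1 H x (r ^ 2)) \<le> D * exp (\<bar>Im r\<bar> * x)"
    "\<And>r x. x \<in> {0..pi} \<Longrightarrow> cmod (ivp_deriv (\<lambda>t. q (pi - t)) 1 H x (r ^ 2)) \<le> D * (1 + cmod r) * exp (\<bar>Im r\<bar> * x)"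
    using ivp_growth[OF qr, of 1 H] by blast
  define B where "B = C + D"
  have le: "C * exp t \<le> B * exp t" "D * exp t \<le> B * exp t" 
     "C * (1 + cmod r) * exp t \<le> B * (1 + cmod r) * exp t" "D * (1 + cmod r) * exp t \<le> B * (1 + cmod r) * exp t" for t r
    using C(1) D(1) by (auto simp: B_def intro!: mult_right_mono)
  have x': "pi - x \<in> {0..pi}" if "x \<in> {0..pi}" for x using that by auto
  show ?thesis
  proof (rule that[of B])
    fix r x assume x: "x \<in> {0..pi}"
    show "cmod (f x (r ^ 2)) \<le> B * exp (\<bar>Im r\<bar> * x)"
      unfolding f_def by (rule order_trans[OF C(2)[OF x] le(1)])
    show "cmod (fd x (r ^ 2)) \<le> B * (1 + cmod r) * exp (\<bar>Im r\<bar> * x)"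
      unfolding fd_def by (rule order_trans[OF C(3)[OF x] le(3)])
    show "cmod (c x (r ^ 2)) \<le> B * exp (\<bar>Im r\<bar> * (pi - x))"
      unfolding c_def by (rule order_trans[OF D(2)[OF x'[OF x]] le(2)])
    show "cmod (cd x (r ^ 2)) \<le> B * (1 + cmod r) * exp (\<bar>Im r\<bar> * (pi - x))"
      unfolding cd_def norm_minus_cancel by (rule order_trans[OF D(3)[OF x'[OF x]] le(4)])
  qed (use C(1) D(1) in \<open>simp add: B_def\<close>)
qed

lemma asymptotics:
  obtains K R where "K \<ge> 0" "R \<ge> 1"
    "\<And>r x. cmod r \<ge> R \<Longrightarrow> x \<in> {0..pi} \<Longrightarrow> cmod (f x (r ^ 2) - cos (r * x)) \<le> K / cmod r * exp (\<bar>Im r\<bar> * x)"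
    "\<And>r x. cmod r \<ge> R \<Longrightarrow> x \<in> {0..pi} \<Longrightarrow> cmod (c x (r ^ 2) - cos (r * (pi - x))) \<le> K / cmod r * exp (\<bar>Im r\<bar> * (pi - x))"
    "\<And>r. cmod r \<ge> R \<Longrightarrow> cmod (Del (r ^ 2) + r * sin (r * pi)) \<le> K * exp (\<bar>Im r\<bar> * pi)"
    "\<And>r N. cmod r \<ge> R \<Longrightarrow> cmod r = real N + 1/2 \<Longrightarrow> cmod (Del (r ^ 2)) \<ge> cmod r * exp (\<bar>Im r\<bar> * pi) / 8"
proof -
  define Q where "Q = integral {0..pi} (\<lambda>t. cmod (q t))"
  define Q' where "Q' = integral {0..pi} (\<lambda>t. cmod (q (pi - t)))"
  have Q0: "Q \<ge> 0" unfolding Q_def by (intro integral_nonneg norm_integrable q) auto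
  have Q'0: "Q' \<ge> 0" unfolding Q'_def by (intro integral_nonneg norm_integrable qr) auto
  define K1 where "K1 = cmod h + 2 * Q * (1 + cmod h)"
  define K2 where "K2 = cmod H + 2 * Q' * (1 + cmod H)"
  have K0: "K1 \<ge> 0" "K2 \<ge> 0" using Q0 Q'0 by (auto simp: K1_def K2_def)
  obtain C where C: "C \<ge> 0" "\<And>r x. x \<in> {0..pi} \<Longrightarrow> cmod (f x (r ^ 2)) \<le> C * exp (\<bar>Im r\<bar> * x)"
    by (rule growth) (erule that)
  define K where "K = K1 + K2 + cmod H * C"
  have K: "K1 \<le> K" "K2 \<le> K" "K1 + cmod H * C \<le> K" "K \<ge> 0" using K0 C(1) by (auto simp: K_def)
  \<comment> \<open>The summands with \<open>Q\<close> and \<open>Q'\<close> reach the threshold of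
    the asymptotics for the potential and for its reflection. The summand \<open>8 * K\<close> makes
    the error in \<open>Del\<close> at most half of the lower bound for
    \<open>r * sin (r * pi)\<close> on the circles.\<close>
  define R where "R = 2 * Q + 2 * Q' + 1 + 8 * K"
  have R: "R \<ge> 1" "R \<ge> 2 * Q + 1" "R \<ge> 2 * Q' + 1" "R \<ge> 8 * K" using Q0 Q'0 K(4) by (auto simp: R_def)
  have f: "cmod (f x (r ^ 2) - cos (r * x)) \<le> K1 / cmod r * exp (\<bar>Im r\<bar> * x)" 
    "cmod (fd x (r ^ 2) + r * sin (r * x)) \<le> K1 * exp (\<bar>Im r\<bar> * x)"
    if r: "cmod r \<ge> R" and x: "x \<in> {0..pi}" for r x
    using sol_asymptotics[OF q sol_f[of "r ^ 2"] x Q_def _ refl] r R by (simp_all add: f0 fd0 K1_def)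
  have c: "cmod (c x (r ^ 2) - cos (r * (pi - x))) \<le> K2 / cmod r * exp (\<bar>Im r\<bar> * (pi - x))"
    if r: "cmod r \<ge> R" and x: "x \<in> {0..pi}" for r x
  proof -
    have x': "pi - x \<in> {0..pi}" using x by auto
    note s = sol_asymptotics[OF qr sol_ivp(1)[OF qr, of "r ^ 2" 1 H] x' Q'_def _ refl]
    show "cmod (c x (r ^ 2) - cos (r * (pi - x))) \<le> K2 / cmod r * exp (\<bar>Im r\<bar> * (pi - x))"
      using s(1) r R by (simp add: sol_ivp[OF qr] K2_def c_def)
  qed
  have mono: "K1 / cmod r * exp t \<le> K / cmod r * exp t" "K2 / cmod r * exp t \<le> K / cmod r * exp t" for r t
    using K by (auto intro!: mult_right_mono divide_right_mono)
  have D: "cmod (Del (r ^ 2) + r * sin (r * pi)) \<le> K * exp (\<bar>Im r\<bar> * pi)" if r: "cmod r \<ge> R" for r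
  proof -
    have "Del (r ^ 2) + r * sin (r * pi) = (fd pi (r ^ 2) + r * sin (r * pi)) + H * f pi (r ^ 2)"
      by (simp add: Del_def)
    also have "cmod \<dots> \<le> K1 * exp (\<bar>Im r\<bar> * pi) + cmod H * (C * exp (\<bar>Im r\<bar> * pi))"
      using f(2)[OF r, of pi] C(2)[of pi r]
      by (rule_tac order_trans[OF norm_triangle_ineq], rule_tac add_mono) (auto simp: norm_mult intro: mult_left_mono)
    also have "\<dots> \<le> K * exp (\<bar>Im r\<bar> * pi)" using mult_right_mono[OF K(3), of "exp (\<bar>Im r\<bar> * pi)"]
      by (simp add: algebra_simps)
    finally show ?thesis .
  qed
  show ?thesis
  proof (rule that[OF K(4) R(1)])
    fix r assume r: "cmod r \<ge> R"
    show "cmod (Del (r ^ 2) + r * sin (r * pi)) \<le> K * exp (\<bar>Im r\<bar> * pi)" by (rule D[OF r])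
    show "cmod (Del (r ^ 2)) \<ge> cmod r * exp (\<bar>Im r\<bar> * pi) / 8" if N: "cmod r = real N + 1/2" for N
    proof -
      have "cmod r * (exp (\<bar>Im r\<bar> * pi) / 4) \<le> cmod (r * sin (r * pi))"
        unfolding norm_mult by (intro mult_left_mono norm_sin_ge_on_circle[OF N]) auto
      also have "\<dots> \<le> cmod (Del (r ^ 2) + r * sin (r * pi)) + cmod (Del (r ^ 2))"
        using norm_triangle_ineq4[of "Del (r ^ 2) + r * sin (r * pi)" "Del (r ^ 2)"] by simp
      also have "\<dots> \<le> K * exp (\<bar>Im r\<bar> * pi) + cmod (Del (r ^ 2))" using D[OF r] by simp
      also have "\<dots> \<le> cmod r / 8 * exp (\<bar>Im r\<bar> * pi) + cmod (Del (r ^ 2))"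
        using r R(4) by (intro add_right_mono mult_right_mono) auto
      finally show ?thesis by simp
    qed
    fix x assume x: "x \<in> {0..pi}"
    show "cmod (f x (r ^ 2) - cos (r * x)) \<le> K / cmod r * exp (\<bar>Im r\<bar> * x)"
      by (rule order_trans[OF f(1)[OF r x] mono(1)])
    show "cmod (c x (r ^ 2) - cos (r * (pi - x))) \<le> K / cmod r * exp (\<bar>Im r\<bar> * (pi - x))"
      by (rule order_trans[OF c(1)[OF r x] mono(2)])
  qed
qed

end

section \<open>Residues and the eigenfunction expansion\<close>

lemma contour_integral_simple_zeros:
  fixes g d :: "complex \<Rightarrow> complex"
  assumes g: "g holomorphic_on UNIV" and d: "d holomorphic_on UNIV" and R: "R > 0"
    and fin: "finite {z. cmod z < R \<and> d z = 0}"
    and simple: "\<And>z. cmod z < R \<Longrightarrow> d z = 0 \<Longrightarrow> deriv d z \<noteq> 0"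
    and circ: "\<And>z. cmod z = R \<Longrightarrow> d z \<noteq> 0"
  shows "((\<lambda>z. g z / d z) has_contour_integral
    2 * of_real pi * \<i> * (\<Sum>z | cmod z < R \<and> d z = 0. g z / deriv d z)) (circlepath 0 R)"
proof -
  define P where "P = {z. cmod z < R \<and> d z = 0}"
  have dc: "continuous_on UNIV d" using d holomorphic_on_imp_continuous_on by blast
  have "closed {z. d z = 0}"
    using continuous_closed_vimage[of "{0}" d] dc by (simp add: continuous_on_eq_continuous_at vimage_def)
  moreover have "sphere 0 R \<inter> {z. d z = 0} = {}" using circ by auto
  \<comment> \<open>The compact circle has positive distance \<open>e\<close> from the closed zero
    set, so the disc of radius \<open>R + e\<close> contains no zeros beyond those in
    \<open>P\<close>, and the residue theorem can be applied on it.\<close>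
  ultimately obtain e where e: "e > 0" "\<And>x y. x \<in> sphere 0 R \<Longrightarrow> d y = 0 \<Longrightarrow> e \<le> dist x y"
    using separate_compact_closed[of "sphere 0 R" "{z. d z = 0}"] by auto
  have zeros: "z \<in> P" if z: "z \<in> ball 0 (R + e)" "d z = 0" for z
  proof (rule ccontr)
    assume "z \<notin> P"
    then have zR: "cmod z \<ge> R" using z by (auto simp: P_def)
    then have "z \<noteq> 0" using R by auto
    \<comment> \<open>Radial projection onto the circle: a zero in the outer annulus would lie
      closer than \<open>e\<close> to this point.\<close>
    define y where "y = of_real (R / cmod z) * z"
    have "cmod y = R" using \<open>z \<noteq> 0\<close> R by (simp add: y_def norm_mult norm_divide)
    moreover have "dist y z = cmod z - R"
    proof -
      have "z - y = of_real (1 - R / cmod z) * z" by (simp add: y_def algebra_simps)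
      then have "cmod (z - y) = \<bar>1 - R / cmod z\<bar> * cmod z" by (metis norm_mult norm_of_real)
      also have "\<dots> = cmod z - R" using zR \<open>z \<noteq> 0\<close> by (simp add: field_simps)
      finally show ?thesis by (simp add: dist_norm norm_minus_commute)
    qed
    ultimately have "e \<le> cmod z - R" using e(2)[of y z] z by auto
    then show False using z by simp
  qed
  have hol: "(\<lambda>z. g z / d z) holomorphic_on (ball 0 (R + e) - P)"
    using zeros by (intro holomorphic_intros holomorphic_on_subset[OF g] holomorphic_on_subset[OF d]) auto
  have img: "path_image (circlepath 0 R) \<subseteq> ball 0 (R + e) - P"
    using R e by (auto simp: P_def)
  have res: "residue (\<lambda>z. g z / d z) p = g p / deriv d p" if p: "p \<in> P" for p
  proof (rule residue_simple'[of "ball 0 (R + e) - (P - {p})"])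
    show "open (ball 0 (R + e) - (P - {p}))"
      using fin by (intro open_Diff finite_imp_closed) (auto simp: P_def)
    show "p \<in> ball 0 (R + e) - (P - {p})" using p e by (auto simp: P_def)
    show "(\<lambda>z. g z / d z) holomorphic_on ball 0 (R + e) - (P - {p}) - {p}"
      by (rule holomorphic_on_subset[OF hol]) auto
    have dp: "d p = 0" "deriv d p \<noteq> 0" using p simple by (auto simp: P_def)
    have "((\<lambda>w. (d w - d p) / (w - p)) \<longlongrightarrow> deriv d p) (at p)"
      using holomorphic_derivI[OF d, of p] by (simp add: has_field_derivative_iff)
    then have "((\<lambda>w. g w / ((d w - d p) / (w - p))) \<longlongrightarrow> g p / deriv d p) (at p)"
      using dp holomorphic_on_imp_continuous_on[OF g]
      by (intro tendsto_divide) (auto simp: continuous_on_eq_continuous_at isCont_def)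
    then show "((\<lambda>w. g w / d w * (w - p)) \<longlongrightarrow> g p / deriv d p) (at p)"
      using dp by simp
  qed
  have "contour_integral (circlepath 0 R) (\<lambda>z. g z / d z)
      = 2 * pi * \<i> * (\<Sum>p\<in>P. winding_number (circlepath 0 R) p * residue (\<lambda>z. g z / d z) p)"
  proof (rule Residue_theorem[of "ball 0 (R + e)"])
    show "finite P" using fin by (simp add: P_def)
    show "\<forall>z. z \<notin> ball 0 (R + e) \<longrightarrow> winding_number (circlepath 0 R) z = 0"
      using R e by (auto intro!: winding_number_zero_outside[of _ "cball 0 R"])
  qed (use hol img in auto)
  also have "\<dots> = 2 * pi * \<i> * (\<Sum>p\<in>P. g p / deriv d p)"
  proof -
    have "winding_number (circlepath 0 R) p = 1" if "p \<in> P" for p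
      using that by (intro winding_number_circlepath) (auto simp: P_def)
    then show ?thesis using res by simp
  qed
  finally have "contour_integral (circlepath 0 R) (\<lambda>z. g z / d z) = 2 * pi * \<i> * (\<Sum>p\<in>P. g p / deriv d p)" .
  moreover have "(\<lambda>z. g z / d z) contour_integrable_on (circlepath 0 R)"
    by (rule contour_integrable_continuous_circlepath)
       (rule continuous_on_subset[OF holomorphic_on_imp_continuous_on[OF hol] img])
  ultimately show ?thesis using has_contour_integral_integral unfolding P_def by fastforce
qed

text \<open>Cauchy's formula turns the comparison function \<open>G z / (z - w)\<close> into exactly
  \<open>G w\<close>, however fast \<open>G\<close> grows. The error is \<open>O(1 / s^3)\<close> on
  a circle of length \<open>2 * pi * s^2\<close>, where \<open>s = N + 1/2\<close>. Points of the
  circle are written as squares because all estimates are in terms of the square root.\<close>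

lemma contour_limit:
  fixes F :: "nat \<Rightarrow> complex \<Rightarrow> complex" and G :: "complex \<Rightarrow> complex"
  assumes G: "G holomorphic_on UNIV"
    and I: "\<forall>\<^sub>F N in sequentially. (F N has_contour_integral 2 * of_real pi * \<i> * I N) (circlepath 0 ((real N + 1/2)\<^sup>2))"
    and B: "\<forall>\<^sub>F N in sequentially. \<forall>r. cmod r = real N + 1/2 \<longrightarrow>
      cmod (F N (r ^ 2) - G (r ^ 2) / (r ^ 2 - w)) \<le> K / (real N + 1/2) ^ 3"
  shows "I \<longlonglongrightarrow> G w"
proof -
  have big: "\<forall>\<^sub>F N in sequentially. cmod w < (real N + 1/2)\<^sup>2"
  proof -
    obtain n :: nat where n: "cmod w < real n" using reals_Archimedean2 by blast
    have "cmod w < (real N + 1/2)\<^sup>2" if "N \<ge> n + 1" for N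
    proof -
      have "real N + 1/2 \<ge> 1" using that by simp
      then have "(real N + 1/2) * 1 \<le> (real N + 1/2)\<^sup>2" unfolding power2_eq_square by (intro mult_left_mono) auto
      then show ?thesis using n that by simp
    qed
    then show ?thesis unfolding eventually_sequentially by blast
  qed
  have "\<forall>\<^sub>F N in sequentially. dist (I N) (G w) \<le> \<bar>K\<bar> / (real N + 1/2)"
    using I B big
  proof eventually_elim
    case (elim N)
    define s where "s = real N + 1/2"
    have s: "s > 0" by (simp add: s_def)
    have "((\<lambda>u. G u / (u - w)) has_contour_integral (2 * of_real pi * \<i> * G w)) (circlepath 0 (s\<^sup>2))"
      using elim(3) by (intro Cauchy_integral_circlepath_simple holomorphic_on_subset[OF G]) (auto simp: s_def)
    then have "((\<lambda>z. F N z - G z / (z - w)) has_contour_integral 2 * of_real pi * \<i> * I N - 2 * of_real pi * \<i> * G w) (circlepath 0 (s\<^sup>2))"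
      using elim(1) by (intro has_contour_integral_diff) (auto simp: s_def)
    then have "cmod (2 * of_real pi * \<i> * I N - 2 * of_real pi * \<i> * G w) \<le> (\<bar>K\<bar> / s ^ 3) * (2 * pi * s\<^sup>2)"
    proof (rule has_contour_integral_bound_circlepath)
      show "cmod (F N z - G z / (z - w)) \<le> \<bar>K\<bar> / s ^ 3" if z: "cmod (z - 0) = s\<^sup>2" for z
      proof -
        have "(cmod (csqrt z))\<^sup>2 = s\<^sup>2" using z by (metis diff_zero norm_power power2_csqrt)
        then have "cmod (csqrt z) = real N + 1/2" using s by (simp add: s_def power2_eq_iff_nonneg)
        then have "cmod (F N z - G z / (z - w)) \<le> K / s ^ 3" using elim(2) by (metis power2_csqrt s_def)
        also have "\<dots> \<le> \<bar>K\<bar> / s ^ 3" using s by (intro divide_right_mono) auto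
        finally show ?thesis .
      qed
    qed (use s in auto)
    also have "2 * of_real pi * \<i> * I N - 2 * of_real pi * \<i> * G w = 2 * of_real pi * \<i> * (I N - G w)"
      by (simp add: algebra_simps)
    also have "cmod (2 * of_real pi * \<i> * (I N - G w)) = 2 * pi * cmod (I N - G w)"
      by (simp only: norm_mult) simp
    also have "(\<bar>K\<bar> / s ^ 3) * (2 * pi * s\<^sup>2) = 2 * pi * (\<bar>K\<bar> / s)"
      using s by (simp add: power3_eq_cube power2_eq_square)
    finally have "cmod (I N - G w) \<le> \<bar>K\<bar> / s"
      using pi_gt_zero by (simp only: mult_le_cancel_left_pos mult_pos_pos zero_less_numeral)
    then show ?case by (simp add: dist_norm s_def)
  qed
  moreover have "(\<lambda>N. \<bar>K\<bar> / (real N + 1/2)) \<longlonglongrightarrow> 0" by real_asymp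
  ultimately show ?thesis
    by (intro tendstoI) (smt (verit) eventually_elim2 order_tendstoD(2) eventually_mono)
qed

lemma circle_denominator_ge:
  fixes r w :: complex
  assumes s: "s \<ge> 1" "s \<ge> 2 * cmod w" and r: "cmod r = s"
  shows "s\<^sup>2 / 2 \<le> cmod (r\<^sup>2 - w)"
proof -
  have "s * 1 \<le> s * s" using s by (intro mult_left_mono) auto
  then have "2 * cmod w \<le> s * s" using s by linarith
  then have "s\<^sup>2 / 2 \<le> s\<^sup>2 - cmod w" by (simp add: power2_eq_square)
  also have "\<dots> \<le> cmod (r\<^sup>2 - w)" using norm_triangle_ineq2[of "r\<^sup>2" w] r by (simp add: norm_power)
  finally show ?thesis .
qed

text \<open>\<open>e1\<close> and \<open>e2\<close> stand for \<open>exp (|Im r| * x)\<close> and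
  \<open>exp (|Im r| * (pi - x))\<close>. Their product is the growth of \<open>Del\<close> on the
  circles, so the exponentials of the numerator cancel.\<close>

lemma quotient_bound:
  fixes u v d :: complex
  assumes u: "cmod u \<le> A * e1" and v: "cmod v \<le> B * e2" and d: "cmod d \<ge> s * (e1 * e2) / 8"
    and pos: "s > 0" "e1 > 0" "e2 > 0"
  shows "cmod (u * v / d) \<le> 8 * A * B / s"
proof -
  have A: "A \<ge> 0" "B \<ge> 0" using u v pos norm_ge_zero order_trans by (metis mult_less_0_iff not_le)+
  have "cmod (u * v / d) = cmod u * cmod v / cmod d" by (simp add: norm_mult norm_divide)
  also have "\<dots> \<le> (A * e1) * (B * e2) / (s * (e1 * e2) / 8)"
    using pos A by (intro frac_le mult_mono u v d) auto
  also have "\<dots> = 8 * A * B / s" using pos by (simp add: field_simps)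
  finally show ?thesis .
qed

text \<open>\<open>count\<close> is what identifies residue sums over large circles with ordered
  partial sums, and it does so with the same \<open>N\<close> for any two problems. Indices start at
  0 here, so \<open>lam k\<close> will be the square of \<open>rho (Suc k)\<close>. The norming
  integrals have no modulus and could vanish for complex \<open>f\<close>.\<close>

locale sturm_spectral = sturm_liouville +
  fixes lam :: "nat \<Rightarrow> complex"
  assumes zeros: "{z. Del z = 0} = range lam"
    and inj: "inj lam"
    and norming: "\<And>k. integral {0..pi} (\<lambda>t. (f t (lam k))\<^sup>2) \<noteq> 0"
    and count: "\<forall>\<^sub>F N in sequentially. \<forall>k. cmod (lam k) < (real N + 1/2)\<^sup>2 \<longleftrightarrow> k \<le> N"
begin

definition al :: "nat \<Rightarrow> complex" where "al k = inverse (integral {0..pi} (\<lambda>t. (f t (lam k))\<^sup>2))"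

end

section \<open>Kernels, norming integrals and growth\<close>

context sturm_liouville
begin

definition D :: "real \<Rightarrow> complex \<Rightarrow> complex \<Rightarrow> complex" where "D x z w = integral {0..x} (\<lambda>t. f t z * f t w)"
definition X :: "real \<Rightarrow> complex \<Rightarrow> complex \<Rightarrow> complex" where "X x w z = integral {0..x} (\<lambda>t. c t z * f t w)"

lemma D_commute: "D x z w = D x w z"
  by (simp add: D_def mult.commute)

lemma D_identity: "x \<in> {0..pi} \<Longrightarrow> (z - w) * D x z w = f x z * fd x w - fd x z * f x w"
  using lagrange_identity[OF q sol_f[of z] sol_f[of w], of x] by (simp add: D_def f0 fd0)

text \<open>The boundary term at 0 is the Wronskian. After division by
  \<open>(z - w) * Del z\<close> its contribution is the Cauchy kernel \<open>- 1 / (z - w)\<close>,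
  the source of the reproducing property of the expansion.\<close>

lemma X_identity: "x \<in> {0..pi} \<Longrightarrow> (z - w) * X x w z = c x z * fd x w - cd x z * f x w - Del z"
  using lagrange_identity[OF q sol_c[of z] sol_f[of w], of x] wronskian[of 0 z] by (simp add: X_def f0 fd0)

lemma locally_bounded_fc: "\<exists>C. \<forall>t\<in>{0..pi}. \<forall>z. cmod z \<le> R \<longrightarrow> cmod (f t z) \<le> C"
  "\<exists>C. \<forall>t\<in>{0..pi}. \<forall>z. cmod z \<le> R \<longrightarrow> cmod (c t z) \<le> C"
proof -
  show "\<exists>C. \<forall>t\<in>{0..pi}. \<forall>z. cmod z \<le> R \<longrightarrow> cmod (f t z) \<le> C"
    using ivp_entire_bounded(3)[OF q, of R 1 h] unfolding f_def by blast
  obtain C where "\<And>t z. t \<in> {0..pi} \<Longrightarrow> cmod z \<le> R \<Longrightarrow> cmod (ivp (\<lambda>t. q (pi - t)) 1 H t z) \<le> C"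
    using ivp_entire_bounded(3)[OF qr, of R 1 H] by blast
  then have "cmod (c t z) \<le> C" if "t \<in> {0..pi}" "cmod z \<le> R" for t z
    using that unfolding c_def by auto
  then show "\<exists>C. \<forall>t\<in>{0..pi}. \<forall>z. cmod z \<le> R \<longrightarrow> cmod (c t z) \<le> C" by blast
qed

lemma holomorphic_D:
  assumes x: "x \<in> {0..pi}"
  shows "(\<lambda>z. D x z w) holomorphic_on S"
proof -
  have sub: "{0..x} \<subseteq> {0..pi}" using x by auto
  have "(\<lambda>z. integral {0..x} (\<lambda>t. f t w * f t z)) holomorphic_on UNIV"
  proof (rule holomorphic_integral_weighted)
    show "(\<lambda>t. f t w) absolutely_integrable_on {0..x}"
      by (intro absolutely_integrable_continuous_real continuous_on_subset[OF continuous_fc(1) sub])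
    show "f t holomorphic_on UNIV" if "t \<in> {0..x}" for t using that sub holomorphic_fc by blast
    show "continuous_on {0..x} (\<lambda>t. f t z)" for z by (rule continuous_on_subset[OF continuous_fc(1) sub])
    show "\<exists>C. \<forall>t\<in>{0..x}. \<forall>z. cmod z \<le> R \<longrightarrow> cmod (f t z) \<le> C" for R
      using locally_bounded_fc(1)[of R] sub by blast
  qed
  then have "(\<lambda>z. integral {0..x} (\<lambda>t. f t z * f t w)) holomorphic_on UNIV" by (simp only: mult.commute)
  then show ?thesis unfolding D_def using holomorphic_on_subset by blast
qed

lemma holomorphic_X:
  assumes x: "x \<in> {0..pi}"
  shows "X x w holomorphic_on S"
proof -
  have sub: "{0..x} \<subseteq> {0..pi}" using x by auto
  have "(\<lambda>z. integral {0..x} (\<lambda>t. f t w * c t z)) holomorphic_on UNIV"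
  proof (rule holomorphic_integral_weighted)
    show "(\<lambda>t. f t w) absolutely_integrable_on {0..x}"
      by (intro absolutely_integrable_continuous_real continuous_on_subset[OF continuous_fc(1) sub])
    show "c t holomorphic_on UNIV" if "t \<in> {0..x}" for t using that sub holomorphic_fc by blast
    show "continuous_on {0..x} (\<lambda>t. c t z)" for z by (rule continuous_on_subset[OF continuous_fc(3) sub])
    show "\<exists>C. \<forall>t\<in>{0..x}. \<forall>z. cmod z \<le> R \<longrightarrow> cmod (c t z) \<le> C" for R
      using locally_bounded_fc(2)[of R] sub by blast
  qed
  then have "(\<lambda>z. integral {0..x} (\<lambda>t. c t z * f t w)) holomorphic_on UNIV" by (simp only: mult.commute)
  then show ?thesis unfolding X_def[abs_def] using holomorphic_on_subset by blast
qed

text \<open>A vanishing Wronskian makes the initial data of \<open>c\<close> proportional to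
  \<open>(1, h)\<close>, those of \<open>f\<close>. The factor cannot vanish because
  \<open>c\<close> equals 1 at \<open>pi\<close>.\<close>

lemma eigenfunction_at_zero:
  assumes z: "Del z = 0"
  shows "x \<in> {0..pi} \<Longrightarrow> c x z = c 0 z * f x z" and "c 0 z \<noteq> 0"
proof -
  have "cd 0 z = c 0 z * h" using wronskian[of 0 z] by (simp add: f0 fd0 z)
  then show *: "c x z = c 0 z * f x z" if "x \<in> {0..pi}" for x
    using sol_unique[OF q sol_c[of z] sol_f[of z], of "c 0 z" x] that by (simp add: f0 fd0)
  show "c 0 z \<noteq> 0" using *[of pi] c_pi[of z] by auto
qed

text \<open>Pairing the fixed function \<open>c t z0\<close> with \<open>f t z\<close> in the
  Lagrange identity factors \<open>Del z\<close> as \<open>- (z - z0) * J z\<close> with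
  \<open>J\<close> entire, so the derivative is \<open>- J z0\<close>. It ties simplicity of an
  eigenvalue to the nonvanishing of the norming integral.\<close>

lemma deriv_Del_at_zero:
  assumes z0: "Del z0 = 0"
  shows "deriv Del z0 = - c 0 z0 * integral {0..pi} (\<lambda>t. (f t z0)\<^sup>2)"
proof -
  define J where "J z = integral {0..pi} (\<lambda>t. c t z0 * f t z)" for z
  have J: "Del z = - (z - z0) * J z" for z
  proof -
    have "(z0 - z) * J z = (1 * fd pi z - (- H) * f pi z) - (c 0 z0 * h - cd 0 z0 * 1)"
      using lagrange_identity[OF q sol_c[of z0] sol_f[of z], of pi] by (simp only: J_def c_pi cd_pi f0 fd0) simp
    moreover have "c 0 z0 * h - cd 0 z0 * 1 = 0"
      using wronskian[of 0 z0] by (simp only: f0 fd0 z0) simp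
    ultimately show ?thesis by (simp add: Del_def algebra_simps)
  qed
  have "J holomorphic_on UNIV"
    unfolding J_def[abs_def]
  proof (rule holomorphic_integral_weighted)
    show "(\<lambda>t. c t z0) absolutely_integrable_on {0..pi}"
      by (intro absolutely_integrable_continuous_real continuous_fc)
  qed (use continuous_fc holomorphic_fc locally_bounded_fc in auto)
  then have d: "(J has_field_derivative deriv J z0) (at z0)"
    by (rule holomorphic_derivI) auto
  have "((\<lambda>z. - (z - z0) * J z) has_field_derivative - J z0) (at z0)"
    by (rule derivative_eq_intros d refl)+ simp
  moreover have "Del = (\<lambda>z. - (z - z0) * J z)" using J by (rule ext)
  ultimately have "(Del has_field_derivative - J z0) (at z0)" by simp
  then have "deriv Del z0 = - J z0" by (rule DERIV_imp_deriv)
  also have "J z0 = integral {0..pi} (\<lambda>t. c t z0 * f t z0)" by (rule J_def)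
  also have "\<dots> = integral {0..pi} (\<lambda>t. c 0 z0 * (f t z0)\<^sup>2)"
  proof (rule integral_cong)
    fix t assume "t \<in> {0..pi}"
    from eigenfunction_at_zero(1)[OF z0 this] show "c t z0 * f t z0 = c 0 z0 * (f t z0)\<^sup>2"
      unfolding power2_eq_square by (metis mult.assoc)
  qed
  finally show ?thesis by simp
qed

text \<open>The numerator in \<open>D_identity\<close> grows like
  \<open>cmod r * exp (|Im r| * x)\<close> and the denominator \<open>r^2 - w\<close> is of order
  \<open>cmod r ^ 2\<close>. The gained factor \<open>1 / cmod r\<close> is the growth condition
  under which \<open>D\<close> itself can be expanded in eigenfunctions.\<close>

lemma D_growth:
  assumes x: "x \<in> {0..pi}"
  obtains C R where "C \<ge> 0" "R \<ge> 1" "\<And>r. cmod r \<ge> R \<Longrightarrow> cmod (D x (r ^ 2) w) \<le> C / cmod r * exp (\<bar>Im r\<bar> * x)"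
proof -
  obtain C where C: "C \<ge> 0"
    "\<And>r x. x \<in> {0..pi} \<Longrightarrow> cmod (f x (r ^ 2)) \<le> C * exp (\<bar>Im r\<bar> * x)"
    "\<And>r x. x \<in> {0..pi} \<Longrightarrow> cmod (fd x (r ^ 2)) \<le> C * (1 + cmod r) * exp (\<bar>Im r\<bar> * x)"
    by (rule growth) (erule that)
  define A where "A = cmod (f x w) + cmod (fd x w)"
  define R where "R = 1 + 2 * cmod w"
  have "cmod (D x (r ^ 2) w) \<le> 6 * C * A / cmod r * exp (\<bar>Im r\<bar> * x)" if r: "cmod r \<ge> R" for r
  proof -
    define s E where "s = cmod r" and "E = exp (\<bar>Im r\<bar> * x)"
    have s: "s \<ge> 1" "s \<ge> 2 * cmod w" using r norm_ge_zero[of w] by (auto simp: s_def R_def intro: order_trans[rotated])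
    have E: "E > 0" by (simp add: E_def)
    have lower: "s\<^sup>2 / 2 \<le> cmod (r\<^sup>2 - w)" by (rule circle_denominator_ge[OF s]) (simp add: s_def)
    have "s\<^sup>2 / 2 * cmod (D x (r ^ 2) w) \<le> cmod ((r\<^sup>2 - w) * D x (r ^ 2) w)"
      unfolding norm_mult by (intro mult_right_mono lower) auto
    also have "\<dots> = cmod (f x (r ^ 2) * fd x w - fd x (r ^ 2) * f x w)" by (simp add: D_identity[OF x])
    also have "\<dots> \<le> cmod (f x (r ^ 2)) * cmod (fd x w) + cmod (fd x (r ^ 2)) * cmod (f x w)"
      by (rule norm_triangle_ineq4[THEN order_trans]) (simp add: norm_mult)
    also have "\<dots> \<le> (C * E) * cmod (fd x w) + (C * (1 + s) * E) * cmod (f x w)"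
      using C(2,3)[OF x, of r] by (intro add_mono mult_right_mono) (auto simp: E_def s_def)
    also have "\<dots> \<le> (C * (1 + s) * E) * cmod (fd x w) + (C * (1 + s) * E) * cmod (f x w)"
      using C(1) s E by (intro add_right_mono mult_right_mono mult_left_mono) (auto simp: mult_le_cancel_left1)
    also have "\<dots> = C * A * E * (1 + s)" by (simp add: A_def algebra_simps)
    also have "\<dots> \<le> C * A * E * (2 * s)" using C(1) E s by (intro mult_left_mono) (auto simp: A_def)
    finally have "s * (s * cmod (D x (r ^ 2) w)) \<le> s * (4 * C * A * E)" by (simp add: power2_eq_square algebra_simps)
    then have "s * cmod (D x (r ^ 2) w) \<le> 4 * C * A * E" using s by simp
    also have "\<dots> \<le> 6 * C * A * E" using C(1) E by (intro mult_right_mono) (auto simp: A_def)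
    finally have "cmod (D x (r ^ 2) w) \<le> 6 * C * A * E / s" using s by (simp add: pos_le_divide_eq mult.commute)
    then show ?thesis by (simp add: s_def E_def)
  qed
  moreover have "6 * C * A \<ge> 0" "R \<ge> 1" using C(1) by (auto simp: A_def R_def)
  ultimately show ?thesis using that by blast
qed

end

lemma eventually_circle_ge: "\<forall>\<^sub>F N in sequentially. R \<le> real N + 1/2"
proof -
  obtain n :: nat where "R < real n" using reals_Archimedean2 by blast
  then show ?thesis unfolding eventually_sequentially by (intro exI[of _ n]) (auto simp: le_less_trans)
qed

section \<open>Residue sums and the expansion for one problem\<close>

context sturm_spectral
begin

lemma Del_lam: "Del (lam k) = 0"
  using zeros by blast

text \<open>The lower bound for \<open>Del\<close> keeps its zeros off the circle, and
  \<open>count\<close> matches the enclosed ones with the indices up to \<open>N\<close>.\<close>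

lemma circle_sum:
  assumes g: "g holomorphic_on UNIV" and simple: "\<And>k. deriv Del (lam k) \<noteq> 0"
  shows "\<forall>\<^sub>F N in sequentially. ((\<lambda>z. g z / Del z) has_contour_integral
    2 * of_real pi * \<i> * (\<Sum>k\<le>N. g (lam k) / deriv Del (lam k))) (circlepath 0 ((real N + 1/2)\<^sup>2))"
proof -
  obtain R where R: "R \<ge> 1" "\<And>r N. cmod r \<ge> R \<Longrightarrow> cmod r = real N + 1/2 \<Longrightarrow> cmod (Del (r ^ 2)) \<ge> cmod r * exp (\<bar>Im r\<bar> * pi) / 8"
    by (rule asymptotics) (erule that)
  show ?thesis using count eventually_circle_ge[of R]
  proof eventually_elim
    case (elim N)
    have eq: "{z. cmod z < (real N + 1/2)\<^sup>2 \<and> Del z = 0} = lam ` {..N}"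
      using elim(1) zeros by (auto simp: set_eq_iff)
    have "((\<lambda>z. g z / Del z) has_contour_integral
      2 * of_real pi * \<i> * (\<Sum>z | cmod z < (real N + 1/2)\<^sup>2 \<and> Del z = 0. g z / deriv Del z)) (circlepath 0 ((real N + 1/2)\<^sup>2))"
    proof (rule contour_integral_simple_zeros[OF g holomorphic_Del])
      show "deriv Del z \<noteq> 0" if "Del z = 0" for z
      proof -
        have "z \<in> range lam" unfolding zeros[symmetric] using that by simp
        then show ?thesis using simple by blast
      qed
      show "Del z \<noteq> 0" if z: "cmod z = (real N + 1/2)\<^sup>2" for z
      proof -
        have "(cmod (csqrt z))\<^sup>2 = (real N + 1/2)\<^sup>2" using z by (metis norm_power power2_csqrt)
        then have *: "cmod (csqrt z) = real N + 1/2" by (simp add: power2_eq_iff_nonneg)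
        then have "cmod (Del (csqrt z ^ 2)) \<ge> (real N + 1/2) * exp (\<bar>Im (csqrt z)\<bar> * pi) / 8"
          using R(2)[of "csqrt z" N] elim(2) by simp
        moreover have "(real N + 1/2) * exp (\<bar>Im (csqrt z)\<bar> * pi) / 8 > 0"
          by (intro divide_pos_pos mult_pos_pos) auto
        ultimately have "cmod (Del (csqrt z ^ 2)) > 0" by linarith
        then show ?thesis by simp
      qed
    qed (auto simp: eq)
    then show ?case unfolding eq using inj by (simp add: sum.reindex inj_on_subset[OF inj])
  qed
qed

lemmas eigenfunction = eigenfunction_at_zero[OF Del_lam]

lemma deriv_Del: "deriv Del (lam k) = - c 0 (lam k) / al k"
  by (simp add: deriv_Del_at_zero[OF Del_lam] al_def divide_inverse)

lemma al_nonzero: "al k \<noteq> 0"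
  using norming by (simp add: al_def)

lemma deriv_Del_nonzero: "deriv Del (lam k) \<noteq> 0"
  using deriv_Del eigenfunction(2) al_nonzero by simp

lemma X_lam: "x \<in> {0..pi} \<Longrightarrow> X x w (lam k) = c 0 (lam k) * D x (lam k) w"
proof -
  assume x: "x \<in> {0..pi}"
  have "X x w (lam k) = integral {0..x} (\<lambda>t. c 0 (lam k) * (f t (lam k) * f t w))"
    unfolding X_def
  proof (rule integral_cong)
    fix t assume "t \<in> {0..x}"
    then have "t \<in> {0..pi}" using x by auto
    from eigenfunction(1)[OF this, of k] show "c t (lam k) * f t w = c 0 (lam k) * (f t (lam k) * f t w)"
      by (metis mult.assoc)
  qed
  then show ?thesis by (simp add: D_def)
qed

text \<open>On large circles the Green function \<open>X / Del\<close> differs from \<open>- 1 / (z - w)\<close> by a term that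
  beats the growth of \<open>E\<close>; comparing residues gives the expansion.\<close>

lemma eigenfunction_expansion:
  assumes x: "x \<in> {0..pi}" and E: "E holomorphic_on UNIV" and CE: "CE \<ge> 0"
    and growth_E: "\<And>r. cmod r \<ge> RE \<Longrightarrow> cmod (E (r ^ 2)) \<le> CE / cmod r * exp (\<bar>Im r\<bar> * x)"
  shows "(\<lambda>k. al k * E (lam k) * D x (lam k) w) sums E w"
proof -
  obtain R where R: "R \<ge> 1" "\<And>r N. cmod r \<ge> R \<Longrightarrow> cmod r = real N + 1/2 \<Longrightarrow> cmod (Del (r ^ 2)) \<ge> cmod r * exp (\<bar>Im r\<bar> * pi) / 8"
    by (rule asymptotics) (erule that)
  obtain C where C: "C \<ge> 0"
    "\<And>r x. x \<in> {0..pi} \<Longrightarrow> cmod (c x (r ^ 2)) \<le> C * exp (\<bar>Im r\<bar> * (pi - x))"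
    "\<And>r x. x \<in> {0..pi} \<Longrightarrow> cmod (cd x (r ^ 2)) \<le> C * (1 + cmod r) * exp (\<bar>Im r\<bar> * (pi - x))"
    by (rule growth) (erule that)
  define A where "A = cmod (f x w) + cmod (fd x w)"
  have A: "A \<ge> 0" by (simp add: A_def)
  define g where "g z = - E z * X x w z" for z
  have g: "g holomorphic_on UNIV" unfolding g_def[abs_def] by (intro holomorphic_intros E holomorphic_X x)
  define I where "I N = (\<Sum>k\<le>N. g (lam k) / deriv Del (lam k))" for N
  have "I \<longlonglongrightarrow> E w"
  proof (rule contour_limit[OF E])
    show "\<forall>\<^sub>F N in sequentially. ((\<lambda>z. g z / Del z) has_contour_integral 2 * of_real pi * \<i> * I N) (circlepath 0 ((real N + 1/2)\<^sup>2))"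
      unfolding I_def by (rule circle_sum[OF g deriv_Del_nonzero])
    show "\<forall>\<^sub>F N in sequentially. \<forall>r. cmod r = real N + 1/2 \<longrightarrow>
      cmod (g (r ^ 2) / Del (r ^ 2) - E (r ^ 2) / (r ^ 2 - w)) \<le> (8 * CE * (2 * C * A) * 2) / (real N + 1/2) ^ 3"
      using eventually_circle_ge[of "R + \<bar>RE\<bar> + 2 * cmod w"]
    proof eventually_elim
      case (elim N)
      show ?case
      proof (intro allI impI)
        fix r :: complex assume r: "cmod r = real N + 1/2"
        define s e1 e2 where "s = real N + 1/2" and "e1 = exp (\<bar>Im r\<bar> * x)" and "e2 = exp (\<bar>Im r\<bar> * (pi - x))"
        have s: "s \<ge> 1" "s \<ge> 2 * cmod w" "s \<ge> R" "s \<ge> RE"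
          using elim R(1) norm_ge_zero[of w] unfolding s_def by linarith+
        have e: "e1 > 0" "e2 > 0" "exp (\<bar>Im r\<bar> * pi) = e1 * e2"
          by (auto simp: e1_def e2_def algebra_simps simp flip: exp_add)
        have Del: "cmod (Del (r ^ 2)) \<ge> s * (e1 * e2) / 8"
          using R(2)[of r N] r s by (simp add: e(3) s_def)
        moreover have "s * (e1 * e2) / 8 > 0" using s e by simp
        ultimately have Del0: "Del (r ^ 2) \<noteq> 0" by force
        have lower: "s\<^sup>2 / 2 \<le> cmod (r\<^sup>2 - w)" by (rule circle_denominator_ge[OF s(1,2)]) (simp add: s_def r)
        moreover have "s\<^sup>2 / 2 > 0" using s by simp
        ultimately have ne: "r\<^sup>2 - w \<noteq> 0" by force
        \<comment> \<open>\<open>W\<close> remains of \<open>(z - w) * X\<close> once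
          \<open>- Del\<close> is split off. The split-off part reproduces
          \<open>E / (z - w)\<close>; the growth \<open>e2\<close> of \<open>W\<close> and the
          growth \<open>e1\<close> of \<open>E\<close> are together compensated by
          \<open>Del\<close>.\<close>
        define W where "W = c x (r ^ 2) * fd x w - cd x (r ^ 2) * f x w"
        have W: "cmod W \<le> (2 * C * A * s) * e2"
        proof -
          have "cmod W \<le> cmod (c x (r ^ 2)) * cmod (fd x w) + cmod (cd x (r ^ 2)) * cmod (f x w)"
            unfolding W_def by (rule norm_triangle_ineq4[THEN order_trans]) (simp add: norm_mult)
          also have "\<dots> \<le> (C * e2) * cmod (fd x w) + (C * (1 + s) * e2) * cmod (f x w)"
            using C(2,3)[OF x, of r] r by (intro add_mono mult_right_mono) (auto simp: e2_def s_def)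
          also have "\<dots> \<le> (C * (2 * s) * e2) * cmod (fd x w) + (C * (2 * s) * e2) * cmod (f x w)"
            using C(1) s e by (intro add_mono mult_right_mono mult_left_mono) (auto simp: mult_le_cancel_left1)
          finally show ?thesis by (simp add: A_def algebra_simps)
        qed
        have "g (r ^ 2) / Del (r ^ 2) - E (r ^ 2) / (r ^ 2 - w) = - (E (r ^ 2) * W / Del (r ^ 2)) / (r\<^sup>2 - w)"
        proof -
          define v d where "v = r\<^sup>2 - w" and "d = Del (r ^ 2)"
          have "v * X x w (r ^ 2) = W - d" unfolding W_def v_def d_def by (rule X_identity[OF x])
          then have XX: "X x w (r ^ 2) = (W - d) / v" using ne by (simp add: v_def field_simps)
          have "v \<noteq> 0" "d \<noteq> 0" using ne Del0 by (auto simp: v_def d_def)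
          then have "- E (r ^ 2) * ((W - d) / v) / d - E (r ^ 2) / v = - (E (r ^ 2) * W / d) / v"
            by (simp add: field_simps)
          then show ?thesis by (simp only: g_def XX v_def[symmetric] d_def[symmetric])
        qed
        also have "cmod \<dots> = cmod (E (r ^ 2) * W / Del (r ^ 2)) / cmod (r\<^sup>2 - w)"
          by (simp only: norm_divide norm_minus_cancel)
        also have "\<dots> \<le> (8 * (CE / s) * (2 * C * A * s) / s) / (s\<^sup>2 / 2)"
        proof (rule frac_le)
          have "cmod (E (r ^ 2)) \<le> CE / s * e1" using growth_E[of r] r s by (simp add: e1_def s_def)
          then show "cmod (E (r ^ 2) * W / Del (r ^ 2)) \<le> 8 * (CE / s) * (2 * C * A * s) / s"
            using W Del s e by (intro quotient_bound[where ?e1.0 = e1 and ?e2.0 = e2]) auto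
        qed (use lower s CE C(1) A in auto)
        also have "\<dots> = (8 * CE * (2 * C * A) * 2) / s ^ 3"
          using s by (simp add: power2_eq_square power3_eq_cube field_simps)
        finally show "cmod (g (r ^ 2) / Del (r ^ 2) - E (r ^ 2) / (r ^ 2 - w)) \<le> (8 * CE * (2 * C * A) * 2) / (real N + 1/2) ^ 3"
          by (simp add: s_def)
      qed
    qed
  qed
  \<comment> \<open>The factor \<open>c 0 (lam k)\<close> occurs both in \<open>X\<close> and in the
    derivative of \<open>Del\<close>, and cancels.\<close>
  moreover have "g (lam k) / deriv Del (lam k) = al k * E (lam k) * D x (lam k) w" for k
    unfolding g_def deriv_Del X_lam[OF x] using eigenfunction(2)[of k] al_nonzero[of k]
    by (simp add: field_simps)
  then have "I = (\<lambda>N. \<Sum>k\<le>N. al k * E (lam k) * D x (lam k) w)" unfolding I_def by simp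
  ultimately have "(\<lambda>N. \<Sum>k\<le>N. al k * E (lam k) * D x (lam k) w) \<longlonglongrightarrow> E w" by simp
  then show ?thesis unfolding sums_def_le .
qed

end

locale sturm_pair = L: sturm_spectral q h H lam + M: sturm_spectral q' h' H' lam'
  for q h H lam q' h' H' lam'
begin

text \<open>Each problem's kernel is expanded with the eigenvalues of the other: \<open>M.D\<close>
  with the spectrum of \<open>L\<close>, and \<open>L.D\<close> with that of \<open>M\<close>. The
  summands of both expansions are products of one \<open>M.D\<close> and one \<open>L.D\<close>, so
  their difference is the series in question. Both series converge separately, thanks to the decay
  of the kernels.\<close>

lemma product_identity:
  assumes x: "x \<in> {0..pi}"
  shows "(\<lambda>k. L.al k * M.D x r (lam k) * L.D x (lam k) w - M.al k * M.D x r (lam' k) * L.D x (lam' k) w)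
    sums (M.D x r w - L.D x r w)"
proof (rule sums_diff)
  obtain C R where C: "C \<ge> 0" "R \<ge> 1" "\<And>s. cmod s \<ge> R \<Longrightarrow> cmod (M.D x (s ^ 2) r) \<le> C / cmod s * exp (\<bar>Im s\<bar> * x)"
    by (rule M.D_growth[OF x, where w = r]) (erule that)
  have "(\<lambda>k. L.al k * M.D x (lam k) r * L.D x (lam k) w) sums M.D x w r"
    by (rule L.eigenfunction_expansion[OF x M.holomorphic_D[OF x] C(1) C(3)])
  then show "(\<lambda>k. L.al k * M.D x r (lam k) * L.D x (lam k) w) sums M.D x r w"
    by (simp only: M.D_commute[of x r])
  obtain C R where C: "C \<ge> 0" "R \<ge> 1" "\<And>s. cmod s \<ge> R \<Longrightarrow> cmod (L.D x (s ^ 2) w) \<le> C / cmod s * exp (\<bar>Im s\<bar> * x)"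
    by (rule L.D_growth[OF x, where w = w]) (erule that)
  have "(\<lambda>k. M.al k * L.D x (lam' k) w * M.D x (lam' k) r) sums L.D x r w"
    by (rule M.eigenfunction_expansion[OF x L.holomorphic_D[OF x] C(1) C(3)])
  then show "(\<lambda>k. M.al k * M.D x r (lam' k) * L.D x (lam' k) w) sums L.D x r w"
    by (simp only: M.D_commute[of x r] mult.assoc mult.commute[of "M.D x _ r"])
qed

text \<open>The two expansions of \<open>\<phi>(x, \<cdot>)\<close> do not converge separately to the values needed (the expanded
  function jumps at \<open>x\<close>), but the leading terms cancel in the difference of the contour integrals.\<close>

lemma solution_identity:
  assumes x: "x \<in> {0..pi}"
  shows "(\<lambda>k. L.al k * M.D x (lam k) w * L.f x (lam k) - M.al k * M.D x (lam' k) w * L.f x (lam' k))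
    sums (M.f x w - L.f x w)"
proof -
  obtain KL RL where RL: "KL \<ge> 0" "RL \<ge> 1"
    "\<And>r x. cmod r \<ge> RL \<Longrightarrow> x \<in> {0..pi} \<Longrightarrow> cmod (L.f x (r ^ 2) - cos (r * x)) \<le> KL / cmod r * exp (\<bar>Im r\<bar> * x)"
    "\<And>r x. cmod r \<ge> RL \<Longrightarrow> x \<in> {0..pi} \<Longrightarrow> cmod (L.c x (r ^ 2) - cos (r * (pi - x))) \<le> KL / cmod r * exp (\<bar>Im r\<bar> * (pi - x))"
    "\<And>r. cmod r \<ge> RL \<Longrightarrow> cmod (L.Del (r ^ 2) + r * sin (r * pi)) \<le> KL * exp (\<bar>Im r\<bar> * pi)"
    "\<And>r N. cmod r \<ge> RL \<Longrightarrow> cmod r = real N + 1/2 \<Longrightarrow> cmod (L.Del (r ^ 2)) \<ge> cmod r * exp (\<bar>Im r\<bar> * pi) / 8"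
    by (rule L.asymptotics) (erule that)
  obtain KM RM where RM: "KM \<ge> 0" "RM \<ge> 1"
    "\<And>r x. cmod r \<ge> RM \<Longrightarrow> x \<in> {0..pi} \<Longrightarrow> cmod (M.f x (r ^ 2) - cos (r * x)) \<le> KM / cmod r * exp (\<bar>Im r\<bar> * x)"
    "\<And>r x. cmod r \<ge> RM \<Longrightarrow> x \<in> {0..pi} \<Longrightarrow> cmod (M.c x (r ^ 2) - cos (r * (pi - x))) \<le> KM / cmod r * exp (\<bar>Im r\<bar> * (pi - x))"
    "\<And>r. cmod r \<ge> RM \<Longrightarrow> cmod (M.Del (r ^ 2) + r * sin (r * pi)) \<le> KM * exp (\<bar>Im r\<bar> * pi)"
    "\<And>r N. cmod r \<ge> RM \<Longrightarrow> cmod r = real N + 1/2 \<Longrightarrow> cmod (M.Del (r ^ 2)) \<ge> cmod r * exp (\<bar>Im r\<bar> * pi) / 8"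
    by (rule M.asymptotics) (erule that)
  obtain CL where CL: "CL \<ge> 0"
    "\<And>r x. x \<in> {0..pi} \<Longrightarrow> cmod (L.f x (r ^ 2)) \<le> CL * exp (\<bar>Im r\<bar> * x)"
    "\<And>r x. x \<in> {0..pi} \<Longrightarrow> cmod (L.c x (r ^ 2)) \<le> CL * exp (\<bar>Im r\<bar> * (pi - x))"
    by (rule L.growth) (erule that)
  obtain CM where CM: "CM \<ge> 0"
    "\<And>r x. x \<in> {0..pi} \<Longrightarrow> cmod (M.f x (r ^ 2)) \<le> CM * exp (\<bar>Im r\<bar> * x)"
    "\<And>r x. x \<in> {0..pi} \<Longrightarrow> cmod (M.fd x (r ^ 2)) \<le> CM * (1 + cmod r) * exp (\<bar>Im r\<bar> * x)"
    "\<And>r x. x \<in> {0..pi} \<Longrightarrow> cmod (M.c x (r ^ 2)) \<le> CM * exp (\<bar>Im r\<bar> * (pi - x))"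
    "\<And>r x. x \<in> {0..pi} \<Longrightarrow> cmod (M.cd x (r ^ 2)) \<le> CM * (1 + cmod r) * exp (\<bar>Im r\<bar> * (pi - x))"
    by (rule M.growth) (erule that)
  define K where "K = KL + KM"
  have K: "K \<ge> 0" using RL(1) RM(1) by (simp add: K_def)
  \<comment> \<open>\<open>B1\<close> and \<open>B2\<close> collect the bounds for \<open>s\<close>
    times the error terms \<open>T1\<close> and \<open>T2\<close> below; \<open>K\<close> bounds the
    deviation between the two problems.\<close>
  define B1 where "B1 = 8 * CM * CL + 8 * CL * CM"
  define B2 where "B2 = 8 * (2 * CM) * K + (8 * (2 * CM) * CM) * (8 * K) + 8 * K * (2 * CM)"
  have B: "B1 \<ge> 0" "B2 \<ge> 0" using CL(1) CM(1) K by (auto simp: B1_def B2_def)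
  \<comment> \<open>\<open>M\<close> enters through \<open>D\<close> in one integrand and through
    \<open>X\<close> in the other, \<open>L\<close> through \<open>c\<close> and \<open>f\<close>
    respectively. In both quotients a factor growing like \<open>e1\<close> then meets one growing
    like \<open>e2\<close>, and the leading parts combine to the Wronskian of
    \<open>M\<close>.\<close>
  define gL where "gL z = - M.D x z w * L.c x z" for z
  define gM where "gM z = - M.X x w z * L.f x z" for z
  define I where "I N = (\<Sum>k\<le>N. gL (lam k) / deriv L.Del (lam k)) - (\<Sum>k\<le>N. gM (lam' k) / deriv M.Del (lam' k))" for N
  have gL: "gL holomorphic_on UNIV" unfolding gL_def[abs_def] by (intro holomorphic_intros M.holomorphic_D L.holomorphic_fc x)
  have gM: "gM holomorphic_on UNIV" unfolding gM_def[abs_def] by (intro holomorphic_intros M.holomorphic_X L.holomorphic_fc x)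
  have "I \<longlonglongrightarrow> M.f x w - L.f x w"
  \<comment> \<open>The growing summand \<open>L.f x z\<close> is the contribution of
    \<open>- M.Del\<close> inside \<open>M.X\<close>. It is kept in \<open>G\<close>, where Cauchy's
    formula evaluates it exactly.\<close>
  proof (rule contour_limit[where G = "\<lambda>z. M.f x w - L.f x z"])
    show "(\<lambda>z. M.f x w - L.f x z) holomorphic_on UNIV" by (intro holomorphic_intros L.holomorphic_fc x)
    show "\<forall>\<^sub>F N in sequentially. ((\<lambda>z. gL z / L.Del z - gM z / M.Del z) has_contour_integral 2 * of_real pi * \<i> * I N) (circlepath 0 ((real N + 1/2)\<^sup>2))"
      using L.circle_sum[OF gL L.deriv_Del_nonzero] M.circle_sum[OF gM M.deriv_Del_nonzero]
    proof eventually_elim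
      case (elim N)
      from has_contour_integral_diff[OF this] show ?case by (simp add: I_def algebra_simps)
    qed
    show "\<forall>\<^sub>F N in sequentially. \<forall>r. cmod r = real N + 1/2 \<longrightarrow>
      cmod (gL (r ^ 2) / L.Del (r ^ 2) - gM (r ^ 2) / M.Del (r ^ 2) - (M.f x w - L.f x (r ^ 2)) / (r ^ 2 - w))
        \<le> (2 * (cmod (M.fd x w) * B1 + cmod (M.f x w) * B2)) / (real N + 1/2) ^ 3"
      using eventually_circle_ge[of "RL + RM + 2 * cmod w"]
    proof eventually_elim
      case (elim N)
      show ?case
      proof (intro allI impI)
        fix r :: complex assume r: "cmod r = real N + 1/2"
        define s e1 e2 where "s = real N + 1/2" and "e1 = exp (\<bar>Im r\<bar> * x)" and "e2 = exp (\<bar>Im r\<bar> * (pi - x))"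
        have s: "s \<ge> 1" "s \<ge> 2 * cmod w" "s \<ge> RL" "s \<ge> RM" "s > 0"
          using elim RL(2) RM(2) norm_ge_zero[of w] unfolding s_def by linarith+
        have rs: "cmod r = s" using r by (simp add: s_def)
        have e: "e1 > 0" "e2 > 0" "exp (\<bar>Im r\<bar> * pi) = e1 * e2"
          by (auto simp: e1_def e2_def algebra_simps simp flip: exp_add)
        define f f' fd' c c' cd' d d' where "f = L.f x (r\<^sup>2)" and "f' = M.f x (r\<^sup>2)" and "fd' = M.fd x (r\<^sup>2)"
          and "c = L.c x (r\<^sup>2)" and "c' = M.c x (r\<^sup>2)" and "cd' = M.cd x (r\<^sup>2)" and "d = L.Del (r\<^sup>2)" and "d' = M.Del (r\<^sup>2)"
        have d: "cmod d \<ge> s * (e1 * e2) / 8"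
          using RL(6)[of r N] r s rs by (simp add: e(3) d_def)
        have d': "cmod d' \<ge> s * (e1 * e2) / 8"
          using RM(6)[of r N] r s rs by (simp add: e(3) d'_def)
        have pos: "s * (e1 * e2) / 8 > 0" using s e by simp
        then have ne: "d \<noteq> 0" "d' \<noteq> 0" using d d' by force+
        have lower: "s\<^sup>2 / 2 \<le> cmod (r\<^sup>2 - w)" by (rule circle_denominator_ge[OF s(1,2)]) (simp add: s_def r)
        moreover have "s\<^sup>2 / 2 > 0" using s by simp
        ultimately have new: "r\<^sup>2 - w \<noteq> 0" by force
        have bf: "cmod f \<le> CL * e1" and bc: "cmod c \<le> CL * e2" and bf': "cmod f' \<le> CM * e1" and bc': "cmod c' \<le> CM * e2"
          using CL(2,3)[OF x] CM(2,4)[OF x] by (auto simp: f_def c_def f'_def c'_def e1_def e2_def)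
        have bfd': "cmod fd' \<le> (2 * CM * s) * e1"
        proof -
          have "cmod fd' \<le> CM * (1 + s) * e1" using CM(3)[OF x, of r] by (simp add: fd'_def e1_def rs)
          also have "\<dots> \<le> CM * (2 * s) * e1" using CM(1) s e by (intro mult_right_mono mult_left_mono) auto
          finally show ?thesis by (simp add: algebra_simps)
        qed
        have bcd': "cmod cd' \<le> (2 * CM * s) * e2"
        proof -
          have "cmod cd' \<le> CM * (1 + s) * e2" using CM(5)[OF x, of r] by (simp add: cd'_def e2_def rs)
          also have "\<dots> \<le> CM * (2 * s) * e2" using CM(1) s e by (intro mult_right_mono mult_left_mono) auto
          finally show ?thesis by (simp add: algebra_simps)
        qed
        have bff: "cmod (f - f') \<le> (K / s) * e1"
          using RL(3)[of r x] RM(3)[of r x] s x norm_triangle_ineq4[of "f - cos (r * x)" "f' - cos (r * x)"]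
          unfolding rs by (simp add: f_def f'_def e1_def K_def add_divide_distrib algebra_simps)
        have bcc: "cmod (c - c') \<le> (K / s) * e2"
          using RL(4)[of r x] RM(4)[of r x] s x norm_triangle_ineq4[of "c - cos (r * (pi - x))" "c' - cos (r * (pi - x))"]
          unfolding rs by (simp add: c_def c'_def e2_def K_def add_divide_distrib algebra_simps)
        have bdd: "cmod (d' - d) \<le> K * (e1 * e2)"
          using RL(5)[of r] RM(5)[of r] s norm_triangle_ineq4[of "d' + r * sin (r * pi)" "d + r * sin (r * pi)"]
          unfolding rs e(3) by (simp add: d_def d'_def K_def algebra_simps)
        define T1 where "T1 = c' * f / d' - f' * c / d"
        define T2 where "T2 = fd' * c / d - cd' * f / d' - 1"
        have T1: "cmod T1 \<le> B1 / s"
        proof -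
          have "cmod (f * c' / d') \<le> 8 * CL * CM / s" by (rule quotient_bound[OF bf bc' d' s(5) e(1,2)])
          moreover have "cmod (f' * c / d) \<le> 8 * CM * CL / s" by (rule quotient_bound[OF bf' bc d s(5) e(1,2)])
          moreover have "cmod T1 = cmod (f * c' / d' - f' * c / d)" by (simp add: T1_def mult.commute)
          moreover have "B1 / s = 8 * CM * CL / s + 8 * CL * CM / s" by (simp add: B1_def add_divide_distrib)
          ultimately show ?thesis
            using norm_triangle_ineq4[of "f * c' / d'" "f' * c / d"] by linarith
        qed
        have wr: "c' * fd' - cd' * f' = d'" unfolding c'_def fd'_def cd'_def f'_def d'_def by (rule M.wronskian[OF x])
        \<comment> \<open>With \<open>c\<close>, \<open>f\<close>, \<open>d\<close> replaced by
          \<open>c'\<close>, \<open>f'\<close>, \<open>d'\<close>, the Wronskian of \<open>M\<close>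
          would make \<open>T2\<close> zero. Hence \<open>T2\<close> can be written with the
          differences between the problems, each a factor \<open>1 / s\<close> below the leading
          order.\<close>
        have T2eq: "T2 = fd' * (c - c') / d + (fd' * c' / d) * ((d' - d) / d') - (f - f') * cd' / d'"
        proof -
          have "1 = (c' * fd' - cd' * f') / d'" using wr ne by simp
          then have "T2 = fd' * c / d - cd' * f / d' - (c' * fd' - cd' * f') / d'" by (simp add: T2_def)
          also have "\<dots> = fd' * (c - c') / d + (fd' * c' / d) * ((d' - d) / d') - (f - f') * cd' / d'"
            using ne by (simp add: field_simps)
          finally show ?thesis .
        qed
        have T2: "cmod T2 \<le> B2 / s"
        proof -
          have "cmod (fd' * (c - c') / d) \<le> 8 * (2 * CM * s) * (K / s) / s"
            by (rule quotient_bound[OF bfd' bcc d s(5) e(1,2)])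
          then have 1: "cmod (fd' * (c - c') / d) \<le> 8 * (2 * CM) * K / s" using s by simp
          have "cmod (fd' * c' / d) \<le> 8 * (2 * CM * s) * CM / s"
            by (rule quotient_bound[OF bfd' bc' d s(5) e(1,2)])
          then have 2: "cmod (fd' * c' / d) \<le> 8 * (2 * CM) * CM" using s by simp
          have "cmod ((d' - d) / d') \<le> (K * (e1 * e2)) / (s * (e1 * e2) / 8)"
            unfolding norm_divide using K e by (intro frac_le bdd d' pos) auto
          then have 3: "cmod ((d' - d) / d') \<le> 8 * K / s" using e s by (simp add: field_simps)
          have 23: "cmod ((fd' * c' / d) * ((d' - d) / d')) \<le> (8 * (2 * CM) * CM) * (8 * K / s)"
            unfolding norm_mult[of "fd' * c' / d"] using CM(1) by (intro mult_mono 2 3) auto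
          have "cmod ((f - f') * cd' / d') \<le> 8 * (K / s) * (2 * CM * s) / s"
            by (rule quotient_bound[OF bff bcd' d' s(5) e(1,2)])
          then have 4: "cmod ((f - f') * cd' / d') \<le> 8 * K * (2 * CM) / s" using s by simp
          have "cmod T2 \<le> cmod (fd' * (c - c') / d) + cmod ((fd' * c' / d) * ((d' - d) / d')) + cmod ((f - f') * cd' / d')"
            unfolding T2eq by (rule norm_triangle_ineq4[THEN order_trans]) (intro add_right_mono norm_triangle_ineq)
          also have "\<dots> \<le> 8 * (2 * CM) * K / s + (8 * (2 * CM) * CM) * (8 * K / s) + 8 * K * (2 * CM) / s"
            by (intro add_mono 1 23 4)
          also have "\<dots> = B2 / s" by (simp add: B2_def add_divide_distrib)
          finally show ?thesis .
        qed
        have main: "gL (r ^ 2) / L.Del (r ^ 2) - gM (r ^ 2) / M.Del (r ^ 2) - (M.f x w - L.f x (r ^ 2)) / (r ^ 2 - w)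
            = (M.fd x w * T1 + M.f x w * T2) / (r ^ 2 - w)"
        proof -
          define v where "v = r\<^sup>2 - w"
          have v: "v \<noteq> 0" using new by (simp add: v_def)
          have "v * M.D x (r ^ 2) w = f' * M.fd x w - fd' * M.f x w"
            unfolding v_def f'_def fd'_def by (rule M.D_identity[OF x])
          then have DD: "M.D x (r ^ 2) w = (f' * M.fd x w - fd' * M.f x w) / v" using v by (simp add: field_simps)
          have "v * M.X x w (r ^ 2) = c' * M.fd x w - cd' * M.f x w - d'"
            unfolding v_def c'_def cd'_def d'_def by (rule M.X_identity[OF x])
          then have XX: "M.X x w (r ^ 2) = (c' * M.fd x w - cd' * M.f x w - d') / v" using v by (simp add: field_simps)
          have "- ((f' * M.fd x w - fd' * M.f x w) / v) * c / d - - ((c' * M.fd x w - cd' * M.f x w - d') / v) * f / d'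
              - (M.f x w - f) / v = (M.fd x w * T1 + M.f x w * T2) / v"
            unfolding T1_def T2_def using v ne by (simp add: field_simps)
          then show ?thesis by (simp only: gL_def gM_def DD XX f_def[symmetric] c_def[symmetric] d_def[symmetric] d'_def[symmetric] v_def[symmetric])
        qed
        have "cmod ((M.fd x w * T1 + M.f x w * T2) / (r ^ 2 - w)) = cmod (M.fd x w * T1 + M.f x w * T2) / cmod (r\<^sup>2 - w)"
          by (rule norm_divide)
        also have "\<dots> \<le> (cmod (M.fd x w) * (B1 / s) + cmod (M.f x w) * (B2 / s)) / (s\<^sup>2 / 2)"
        proof (rule frac_le)
          show "cmod (M.fd x w * T1 + M.f x w * T2) \<le> cmod (M.fd x w) * (B1 / s) + cmod (M.f x w) * (B2 / s)"
            by (rule norm_triangle_ineq[THEN order_trans], unfold norm_mult) (intro add_mono mult_left_mono T1 T2 norm_ge_zero)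
        qed (use lower s B in auto)
        also have "\<dots> = (2 * (cmod (M.fd x w) * B1 + cmod (M.f x w) * B2)) / s ^ 3"
          using s by (simp add: power2_eq_square power3_eq_cube field_simps)
        finally show "cmod (gL (r ^ 2) / L.Del (r ^ 2) - gM (r ^ 2) / M.Del (r ^ 2) - (M.f x w - L.f x (r ^ 2)) / (r ^ 2 - w))
            \<le> (2 * (cmod (M.fd x w) * B1 + cmod (M.f x w) * B2)) / (real N + 1/2) ^ 3"
          by (simp only: main s_def)
      qed
    qed
  qed
  moreover have "I N = (\<Sum>k\<le>N. L.al k * M.D x (lam k) w * L.f x (lam k) - M.al k * M.D x (lam' k) w * L.f x (lam' k))" for N
  proof -
    have 1: "gL (lam k) / deriv L.Del (lam k) = L.al k * M.D x (lam k) w * L.f x (lam k)" for k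
    proof -
      have "L.c x (lam k) = L.c 0 (lam k) * L.f x (lam k)" by (rule L.eigenfunction(1)[OF x])
      then have "gL (lam k) = - M.D x (lam k) w * (L.c 0 (lam k) * L.f x (lam k))" by (simp only: gL_def)
      then show ?thesis using L.eigenfunction(2)[of k] L.al_nonzero[of k] by (simp only: L.deriv_Del) (simp add: field_simps)
    qed
    have 2: "gM (lam' k) / deriv M.Del (lam' k) = M.al k * M.D x (lam' k) w * L.f x (lam' k)" for k
    proof -
      have "gM (lam' k) = - (M.c 0 (lam' k) * M.D x (lam' k) w) * L.f x (lam' k)" by (simp only: gM_def M.X_lam[OF x])
      then show ?thesis using M.eigenfunction(2)[of k] M.al_nonzero[of k] by (simp only: M.deriv_Del) (simp add: field_simps)
    qed
    show ?thesis unfolding I_def 1 2 by (simp add: sum_subtractf)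
  qed
  then have "I = (\<lambda>N. \<Sum>k\<le>N. L.al k * M.D x (lam k) w * L.f x (lam k) - M.al k * M.D x (lam' k) w * L.f x (lam' k))"
    by (rule ext)
  ultimately show ?thesis unfolding sums_def_le by (simp only:)
qed

end

section \<open>Matrix operators on bounded sequences\<close>

text \<open>Domination yields absolute summability over pairs of indices, where the exchange is
  available for unordered sums; both iterated sums are converted back to ordered ones.\<close>

lemma suminf_swap_dominated:
  fixes f :: "nat \<Rightarrow> nat \<Rightarrow> complex" and g :: "nat \<Rightarrow> nat \<Rightarrow> real"
  assumes le: "\<And>l k. cmod (f l k) \<le> g l k" and g: "\<And>l. summable (g l)" and G: "summable (\<lambda>l. suminf (g l))"
  shows "(\<Sum>l. \<Sum>k. f l k) = (\<Sum>k. \<Sum>l. f l k)"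
proof -
  have g0: "g l k \<ge> 0" for l k using le[of l k] norm_ge_zero order_trans by blast
  have inf_eq: "infsum h UNIV = suminf h" if "summable (\<lambda>n. norm (h n))" for h :: "nat \<Rightarrow> 'z::banach"
    using norm_summable_imp_has_sum[OF that summable_sums[OF summable_norm_cancel[OF that]]] by (rule infsumI)
  have f1: "summable (\<lambda>k. cmod (f l k))" for l
    by (rule summable_comparison_test'[OF g[of l], of 0]) (simp add: le)
  have f1': "summable (\<lambda>k. norm (cmod (f l k)))" for l using f1 by simp
  have f2: "summable (\<lambda>l. cmod (f l k))" for k
  proof (rule summable_comparison_test'[OF G, of 0])
    show "norm (cmod (f l k)) \<le> suminf (g l)" for l
      using le[of l k] sum_le_suminf[OF g[of l], of "{k}"] g0 by simp
  qed
  have ab: "(\<lambda>p. norm (f (fst p) (snd p))) summable_on (UNIV \<times> UNIV)"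
    unfolding Infinite_Sum.abs_summable_on_Sigma_iff
  proof (intro conjI ballI)
    show "(\<lambda>y. norm (f (fst (l, y)) (snd (l, y)))) summable_on UNIV" for l
      using f1 by (simp add: summable_on_UNIV_nonneg_real_iff)
    have "summable (\<lambda>l. \<Sum>k. cmod (f l k))"
    proof (rule summable_comparison_test'[OF G, of 0])
      show "norm (\<Sum>k. cmod (f l k)) \<le> suminf (g l)" for l
        using suminf_le[OF le f1 g, of l] suminf_nonneg[OF f1, of l] by simp
    qed
    moreover have "(\<Sum>k. cmod (f l k)) \<ge> 0" for l using suminf_nonneg[OF f1] by simp
    ultimately show "(\<lambda>x. norm (infsum (\<lambda>y. norm (f (fst (x, y)) (snd (x, y)))) UNIV)) summable_on UNIV"
      by (simp add: inf_eq[OF f1'] summable_on_UNIV_nonneg_real_iff)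
  qed
  have s: "(\<lambda>(l, k). f l k) summable_on (UNIV \<times> UNIV)"
    using Infinite_Sum.abs_summable_summable[OF ab] by (simp add: case_prod_beta')
  have s': "(\<lambda>(k, l). f l k) summable_on (UNIV \<times> UNIV)"
    using s by (subst summable_on_swap) simp
  have out: "infsum h UNIV = suminf h" if "h summable_on UNIV" for h :: "nat \<Rightarrow> complex"
    using has_sum_imp_sums[OF has_sum_infsum[OF that]] by (simp add: sums_iff)
  have "(\<Sum>l. \<Sum>k. f l k) = infsum (\<lambda>l. infsum (\<lambda>k. f l k) UNIV) UNIV"
    using summable_on_Sigma_banach[OF s] by (simp add: inf_eq[OF f1] out)
  also have "\<dots> = infsum (\<lambda>k. infsum (\<lambda>l. f l k) UNIV) UNIV" by (rule infsum_swap_banach[OF s])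
  also have "\<dots> = (\<Sum>k. \<Sum>l. f l k)"
    using summable_on_Sigma_banach[OF s'] by (simp add: inf_eq[OF f2] out)
  finally show ?thesis .
qed

text \<open>The factor \<open>1 / k\<close> will come from the column transformation, the other
  factor from the decay of the kernel away from the diagonal.\<close>

definition wt :: "nat \<Rightarrow> nat \<Rightarrow> real" where
  "wt n k = 1 / (real k * (1 + \<bar>real n - real k\<bar>))"

lemma wt_nonneg: "wt n k \<ge> 0"
  by (simp add: wt_def)

lemma mult_le_sum_squares: "a * b \<le> a\<^sup>2 + (b::real)\<^sup>2"
  using sum_squares_bound[of a b] zero_le_power2[of a] zero_le_power2[of b] by linarith

lemma summable_inverse_Suc_squares: "summable (\<lambda>k. (1 / real (Suc k))\<^sup>2)"
  using inverse_squares_sums by (simp add: power_one_over sums_iff add.commute)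

text \<open>Every distance \<open>|n - k|\<close> occurs at most twice, once on each side of
  \<open>n\<close>, so two copies of the sum of inverse squares bound every row, whatever
  \<open>n\<close> is.\<close>

lemma inverse_distance_squares_sum:
  obtains Z where "Z \<ge> 0" "\<And>n. summable (\<lambda>k. (1 / (1 + \<bar>real n - real k\<bar>))\<^sup>2)"
    "\<And>n. (\<Sum>k. (1 / (1 + \<bar>real n - real k\<bar>))\<^sup>2) \<le> Z"
proof -
  define z where "z j = (1 / real (Suc j))\<^sup>2" for j
  have z: "summable z" unfolding z_def by (rule summable_inverse_Suc_squares)
  have fin: "(\<Sum>k<m. (1 / (1 + \<bar>real n - real k\<bar>))\<^sup>2) \<le> suminf z + suminf z" for n m
  proof -
    have "(\<Sum>k<m. (1 / (1 + \<bar>real n - real k\<bar>))\<^sup>2)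
        = (\<Sum>k\<in>{..<m} \<inter> {..n}. (1 / (1 + \<bar>real n - real k\<bar>))\<^sup>2) + (\<Sum>k\<in>{..<m} - {..n}. (1 / (1 + \<bar>real n - real k\<bar>))\<^sup>2)"
      by (rule sum.Int_Diff) simp
    also have "(\<Sum>k\<in>{..<m} \<inter> {..n}. (1 / (1 + \<bar>real n - real k\<bar>))\<^sup>2) = sum z ((\<lambda>k. n - k) ` ({..<m} \<inter> {..n}))"
      by (subst sum.reindex) (auto simp: inj_on_def z_def of_nat_diff intro!: sum.cong)
    also have "\<dots> \<le> suminf z" by (rule sum_le_suminf[OF z]) (auto simp: z_def)
    also have "(\<Sum>k\<in>{..<m} - {..n}. (1 / (1 + \<bar>real n - real k\<bar>))\<^sup>2) = sum z ((\<lambda>k. k - n) ` ({..<m} - {..n}))"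
      by (subst sum.reindex) (auto simp: inj_on_def z_def of_nat_diff intro!: sum.cong)
    also have "\<dots> \<le> suminf z" by (rule sum_le_suminf[OF z]) (auto simp: z_def)
    finally show ?thesis by simp
  qed
  have s: "summable (\<lambda>k. (1 / (1 + \<bar>real n - real k\<bar>))\<^sup>2)" for n
    by (rule summableI_nonneg_bounded[OF _ fin]) simp
  show ?thesis
    by (rule that[OF _ s suminf_le_const[OF s fin]]) (simp add: suminf_nonneg z z_def)
qed

text \<open>The inequality \<open>a * b <= a^2 + b^2\<close> separates the two factors of
  \<open>wt\<close>, each of which is square summable with a bound uniform in
  \<open>n\<close>.\<close>

lemma wt_sum:
  obtains S where "S \<ge> 0" "\<And>n. summable (\<lambda>k. wt n (Suc k))" "\<And>n. (\<Sum>k. wt n (Suc k)) \<le> S"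
proof -
  obtain Z where Z: "Z \<ge> 0" "\<And>n. summable (\<lambda>k. (1 / (1 + \<bar>real n - real k\<bar>))\<^sup>2)"
    "\<And>n. (\<Sum>k. (1 / (1 + \<bar>real n - real k\<bar>))\<^sup>2) \<le> Z"
    by (rule inverse_distance_squares_sum) (erule that)
  have Z': "summable (\<lambda>k. (1 / (1 + \<bar>real n - real (Suc k)\<bar>))\<^sup>2)" "(\<Sum>k. (1 / (1 + \<bar>real n - real (Suc k)\<bar>))\<^sup>2) \<le> Z" for n
  proof -
    show s: "summable (\<lambda>k. (1 / (1 + \<bar>real n - real (Suc k)\<bar>))\<^sup>2)"
      using Z(2)[of n] by (subst summable_Suc_iff)
    show "(\<Sum>k. (1 / (1 + \<bar>real n - real (Suc k)\<bar>))\<^sup>2) \<le> Z"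
      using Z(3)[of n] suminf_split_head[OF Z(2)[of n]] zero_le_power2[of "1 / (1 + \<bar>real n - real 0\<bar>)"] by linarith
  qed
  have le: "wt n (Suc k) \<le> (1 / real (Suc k))\<^sup>2 + (1 / (1 + \<bar>real n - real (Suc k)\<bar>))\<^sup>2" for n k
    using mult_le_sum_squares[of "1 / real (Suc k)" "1 / (1 + \<bar>real n - real (Suc k)\<bar>)"] by (simp add: wt_def)
  have sm: "summable (\<lambda>k. (1 / real (Suc k))\<^sup>2 + (1 / (1 + \<bar>real n - real (Suc k)\<bar>))\<^sup>2)" for n
    by (intro summable_add summable_inverse_Suc_squares Z')
  have s: "summable (\<lambda>k. wt n (Suc k))" for n
    by (rule summable_comparison_test'[OF sm[of n], of 0]) (use le[of n] wt_nonneg in auto)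
  have "(\<Sum>k. wt n (Suc k)) \<le> (\<Sum>k. (1 / real (Suc k))\<^sup>2) + Z" for n
    using suminf_le[OF le s sm, of n] suminf_add[OF summable_inverse_Suc_squares Z'(1)[of n]] Z'(2)[of n] by linarith
  moreover have "0 \<le> (\<Sum>k. (1 / real (Suc k))\<^sup>2) + Z"
    using Z(1) suminf_nonneg[OF summable_inverse_Suc_squares] by simp
  ultimately show ?thesis using that s by blast
qed

text \<open>An entrywise condition strong enough for absolutely convergent rows, boundedness on
  \<open>m\<close>, and the exchange of summations in products.\<close>

definition wt_bounded :: "(nat \<Rightarrow> nat \<Rightarrow> nat \<Rightarrow> nat \<Rightarrow> complex) \<Rightarrow> bool" where
  "wt_bounded P \<longleftrightarrow> (\<exists>C\<ge>0. \<forall>n\<ge>1. \<forall>k\<ge>1. \<forall>i<2. \<forall>j<2. cmod (P n i k j) \<le> C * wt n k)"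

section \<open>Operators with weighted entries and their products\<close>

lemma m_norm_ge:
  assumes a: "in_m a" and "n \<ge> 1" "i < 2"
  shows "cmod (a n i) \<le> m_norm a"
proof -
  obtain C where C: "\<And>n i. n \<ge> 1 \<Longrightarrow> i < 2 \<Longrightarrow> cmod (a n i) \<le> C" using a unfolding in_m_def by blast
  have "bdd_above ((\<lambda>p. cmod (a (fst p) (snd p))) ` {(n, i). n \<ge> 1 \<and> i < 2})"
    using C by (intro bdd_aboveI2[where M = C]) auto
  then have "cmod (a (fst (n, i)) (snd (n, i))) \<le> m_norm a"
    unfolding m_norm_def using assms by (intro cSUP_upper) auto
  then show ?thesis by simp
qed

lemma m_norm_nonneg: "in_m a \<Longrightarrow> m_norm a \<ge> 0"
  using m_norm_ge[of a 1 0] order_trans[OF norm_ge_zero[of "a 1 0"]] by simp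

lemma wt_bounded_row:
  fixes a :: "nat \<Rightarrow> nat \<Rightarrow> complex" and P :: "nat \<Rightarrow> nat \<Rightarrow> nat \<Rightarrow> nat \<Rightarrow> complex"
  assumes P: "\<And>n k i j. n \<ge> 1 \<Longrightarrow> k \<ge> 1 \<Longrightarrow> i < 2 \<Longrightarrow> j < 2 \<Longrightarrow> cmod (P n i k j) \<le> C * wt n k" and C: "C \<ge> 0"
    and a: "\<And>n i. n \<ge> 1 \<Longrightarrow> i < 2 \<Longrightarrow> cmod (a n i) \<le> m" and n: "n \<ge> (1::nat)" "i < 2"
  shows "cmod (\<Sum>j<2. P n i (Suc k) j * a (Suc k) j) \<le> 2 * C * m * wt n (Suc k)"
proof -
  have "cmod (P n i (Suc k) j * a (Suc k) j) \<le> (C * wt n (Suc k)) * m" if "j < 2" for j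
    unfolding norm_mult using that n C wt_nonneg by (intro mult_mono P a) auto
  then have "cmod (\<Sum>j<2. P n i (Suc k) j * a (Suc k) j) \<le> of_nat (card {..<2::nat}) * ((C * wt n (Suc k)) * m)"
    by (intro sum_norm_bound) auto
  then show ?thesis by (simp add: algebra_simps)
qed

lemma wt_bounded_summable:
  assumes P: "wt_bounded P" and a: "in_m a" and n: "n \<ge> 1" "i < 2"
  shows "summable (\<lambda>k. \<Sum>j<2. P n i (Suc k) j * a (Suc k) j)"
proof -
  obtain C where C: "C \<ge> 0" "\<And>n k i j. n \<ge> 1 \<Longrightarrow> k \<ge> 1 \<Longrightarrow> i < 2 \<Longrightarrow> j < 2 \<Longrightarrow> cmod (P n i k j) \<le> C * wt n k"
    using P unfolding wt_bounded_def by blast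
  obtain S where S: "\<And>n. summable (\<lambda>k. wt n (Suc k))" by (rule wt_sum) (erule that)
  show ?thesis
  proof (rule summable_comparison_test'[of _ 0])
    show "summable (\<lambda>k. 2 * C * m_norm a * wt n (Suc k))" by (intro summable_mult S)
    show "norm (\<Sum>j<2. P n i (Suc k) j * a (Suc k) j) \<le> 2 * C * m_norm a * wt n (Suc k)" for k
      by (rule wt_bounded_row[OF C(2,1) m_norm_ge[OF a] n])
  qed
qed

lemma wt_bounded_imp_bounded_op:
  assumes P: "wt_bounded P"
  shows "bounded_op_m P"
proof -
  obtain C where C: "C \<ge> 0" "\<And>n k i j. n \<ge> 1 \<Longrightarrow> k \<ge> 1 \<Longrightarrow> i < 2 \<Longrightarrow> j < 2 \<Longrightarrow> cmod (P n i k j) \<le> C * wt n k"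
    using P unfolding wt_bounded_def by blast
  obtain S where S: "S \<ge> 0" "\<And>n. summable (\<lambda>k. wt n (Suc k))" "\<And>n. (\<Sum>k. wt n (Suc k)) \<le> S"
    by (rule wt_sum) (erule that)
  have bd: "cmod (op_apply P a n i) \<le> 2 * C * S * m_norm a" if a: "in_m a" and n: "n \<ge> 1" "i < 2" for a n i
  proof -
    have "cmod (\<Sum>k. \<Sum>j<2. P n i (Suc k) j * a (Suc k) j) \<le> (\<Sum>k. 2 * C * m_norm a * wt n (Suc k))"
      by (rule norm_suminf_le[OF wt_bounded_row[OF C(2,1) m_norm_ge[OF a] n]]) (auto intro: summable_mult S)
    also have "\<dots> = 2 * C * m_norm a * (\<Sum>k. wt n (Suc k))" by (rule suminf_mult[OF S(2)])
    also have "\<dots> \<le> 2 * C * m_norm a * S" using C(1) m_norm_nonneg[OF a] S(3)[of n] by (intro mult_left_mono) auto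
    finally show ?thesis using n by (simp add: op_apply_def algebra_simps)
  qed
  have inm: "in_m (op_apply P a)" if "in_m a" for a
    unfolding in_m_def using bd[OF that] by (auto simp: op_apply_def)
  have "m_norm (op_apply P a) \<le> 2 * C * S * m_norm a" if "in_m a" for a
  proof -
    have "(1, 0) \<in> {(n, i). n \<ge> (1::nat) \<and> i < (2::nat)}" by simp
    then have ne: "{(n, i). n \<ge> (1::nat) \<and> i < (2::nat)} \<noteq> {}" by blast
    show ?thesis
      unfolding m_norm_def[of "op_apply P a"] by (rule cSUP_least[OF ne]) (use bd[OF that] in auto)
  qed
  then show ?thesis unfolding bounded_op_m_def using wt_bounded_summable[OF P] inm by blast
qed

lemma in_m_op_apply: "wt_bounded P \<Longrightarrow> in_m a \<Longrightarrow> in_m (op_apply P a)"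
  using wt_bounded_imp_bounded_op unfolding bounded_op_m_def by blast

lemma op_apply_add:
  assumes "wt_bounded P" "in_m a" "in_m b"
  shows "op_apply P (\<lambda>n i. a n i + b n i) = (\<lambda>n i. op_apply P a n i + op_apply P b n i)"
  using wt_bounded_summable[OF assms(1,2)] wt_bounded_summable[OF assms(1,3)]
  by (intro ext) (auto simp: op_apply_def ring_distribs sum.distrib suminf_add)

lemma op_apply_diff:
  assumes "wt_bounded P" "in_m a" "in_m b"
  shows "op_apply P (\<lambda>n i. a n i - b n i) = (\<lambda>n i. op_apply P a n i - op_apply P b n i)"
  using wt_bounded_summable[OF assms(1,2)] wt_bounded_summable[OF assms(1,3)]
  by (intro ext) (auto simp: op_apply_def ring_distribs sum_subtractf suminf_diff)

text \<open>The inner sums of weights are at most \<open>S\<close> whatever the row, and the outer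
  weights are summable again. This dominates the double series and allows summing over the middle
  index before the last one, so that entrywise products determine the composition.\<close>

lemma op_apply_compose:
  assumes P: "wt_bounded P" and Q: "wt_bounded Q" and a: "in_m a"
    and PQ: "\<And>n k i j. n \<ge> 1 \<Longrightarrow> k \<ge> 1 \<Longrightarrow> i < 2 \<Longrightarrow> j < 2 \<Longrightarrow>
      (\<lambda>l. \<Sum>p<2. P n i (Suc l) p * Q (Suc l) p k j) sums T n i k j"
  shows "op_apply P (op_apply Q a) = op_apply T a"
proof (intro ext)
  fix n i
  show "op_apply P (op_apply Q a) n i = op_apply T a n i"
  proof (cases "n \<ge> 1 \<and> i < 2")
    case False
    then show ?thesis by (auto simp: op_apply_def)
  next
    case n: True
    obtain C where C: "C \<ge> 0" "\<And>n k i j. n \<ge> 1 \<Longrightarrow> k \<ge> 1 \<Longrightarrow> i < 2 \<Longrightarrow> j < 2 \<Longrightarrow> cmod (P n i k j) \<le> C * wt n k"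
      using P unfolding wt_bounded_def by blast
    obtain C' where C': "C' \<ge> 0" "\<And>n k i j. n \<ge> 1 \<Longrightarrow> k \<ge> 1 \<Longrightarrow> i < 2 \<Longrightarrow> j < 2 \<Longrightarrow> cmod (Q n i k j) \<le> C' * wt n k"
      using Q unfolding wt_bounded_def by blast
    obtain S where S: "S \<ge> 0" "\<And>n. summable (\<lambda>k. wt n (Suc k))" "\<And>n. (\<Sum>k. wt n (Suc k)) \<le> S"
      by (rule wt_sum) (erule that)
    define m where "m = m_norm a"
    have m: "m \<ge> 0" using m_norm_nonneg[OF a] by (simp add: m_def)
    define r where "r l p k = (\<Sum>j<2. Q (Suc l) p (Suc k) j * a (Suc k) j)" for l p k
    have r: "cmod (r l p k) \<le> 2 * C' * m * wt (Suc l) (Suc k)" if "p < 2" for l p k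
      unfolding r_def m_def using that by (intro wt_bounded_row[OF C'(2,1) m_norm_ge[OF a]]) auto
    have rs: "summable (r l p)" if "p < 2" for l p
      unfolding r_def using that by (intro wt_bounded_summable[OF Q a]) auto
    define t where "t l k = (\<Sum>p<2. P n i (Suc l) p * r l p k)" for l k
    have t: "cmod (t l k) \<le> 2 * C * wt n (Suc l) * (2 * C' * m) * wt (Suc l) (Suc k)" for l k
    proof -
      have "cmod (P n i (Suc l) p * r l p k) \<le> (C * wt n (Suc l)) * (2 * C' * m * wt (Suc l) (Suc k))" if "p < 2" for p
        unfolding norm_mult using that n C(1) wt_nonneg by (intro mult_mono r C(2)) auto
      then have "cmod (t l k) \<le> of_nat (card {..<2::nat}) * ((C * wt n (Suc l)) * (2 * C' * m * wt (Suc l) (Suc k)))"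
        unfolding t_def by (intro sum_norm_bound) auto
      then show ?thesis by (simp add: algebra_simps)
    qed
    have inner: "(\<Sum>l. t l k) = (\<Sum>j<2. T n i (Suc k) j * a (Suc k) j)" for k
    proof -
      have "(\<lambda>l. \<Sum>j<2. (\<Sum>p<2. P n i (Suc l) p * Q (Suc l) p (Suc k) j) * a (Suc k) j) sums (\<Sum>j<2. T n i (Suc k) j * a (Suc k) j)"
        using n by (intro sums_sum sums_mult2 PQ) auto
      moreover have "(\<Sum>j<2. (\<Sum>p<2. P n i (Suc l) p * Q (Suc l) p (Suc k) j) * a (Suc k) j) = t l k" for l
        by (simp add: t_def r_def sum_distrib_left sum_distrib_right sum.swap[of _ "{..<2}" "{..<2}"] mult.assoc numeral_2_eq_2 algebra_simps)
      ultimately show ?thesis by (simp add: sums_iff)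
    qed
    have lhs: "op_apply P (op_apply Q a) n i = (\<Sum>l. \<Sum>k. t l k)"
    proof -
      have "(\<Sum>p<2. P n i (Suc l) p * op_apply Q a (Suc l) p) = (\<Sum>k. t l k)" for l
      proof -
        have "(\<Sum>p<2. P n i (Suc l) p * op_apply Q a (Suc l) p) = (\<Sum>p<2. P n i (Suc l) p * (\<Sum>k. r l p k))"
          by (intro sum.cong) (auto simp: op_apply_def r_def)
        also have "\<dots> = (\<Sum>p<2. \<Sum>k. P n i (Suc l) p * r l p k)"
          by (intro sum.cong refl suminf_mult[symmetric] rs) auto
        also have "\<dots> = (\<Sum>k. t l k)"
          unfolding t_def by (intro suminf_sum[symmetric] summable_mult rs) auto
        finally show ?thesis .
      qed
      then show ?thesis using n by (simp add: op_apply_def[of P])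
    qed
    also have "\<dots> = (\<Sum>k. \<Sum>l. t l k)"
    proof (rule suminf_swap_dominated[OF t])
      show "summable (\<lambda>k. 2 * C * wt n (Suc l) * (2 * C' * m) * wt (Suc l) (Suc k))" for l
        by (intro summable_mult S)
      have "(\<Sum>k. 2 * C * wt n (Suc l) * (2 * C' * m) * wt (Suc l) (Suc k))
          = 2 * C * wt n (Suc l) * (2 * C' * m) * (\<Sum>k. wt (Suc l) (Suc k))" for l
        by (rule suminf_mult[OF S(2)])
      moreover have "summable (\<lambda>l. 2 * C * wt n (Suc l) * (2 * C' * m) * (\<Sum>k. wt (Suc l) (Suc k)))"
      proof (rule summable_comparison_test'[of _ 0])
        show "summable (\<lambda>l. (2 * C * (2 * C' * m) * S) * wt n (Suc l))" by (intro summable_mult S)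
        fix l
        have "0 \<le> (\<Sum>k. wt (Suc l) (Suc k))" by (intro suminf_nonneg S wt_nonneg)
        then have "norm (2 * C * wt n (Suc l) * (2 * C' * m) * (\<Sum>k. wt (Suc l) (Suc k)))
            = 2 * C * wt n (Suc l) * (2 * C' * m) * (\<Sum>k. wt (Suc l) (Suc k))"
          using C(1) C'(1) m wt_nonneg by (simp add: abs_mult)
        also have "\<dots> \<le> 2 * C * wt n (Suc l) * (2 * C' * m) * S"
          using C(1) C'(1) m wt_nonneg S(3) by (intro mult_left_mono) auto
        finally show "norm (2 * C * wt n (Suc l) * (2 * C' * m) * (\<Sum>k. wt (Suc l) (Suc k)))
            \<le> (2 * C * (2 * C' * m) * S) * wt n (Suc l)" by (simp add: algebra_simps)
      qed
      ultimately show "summable (\<lambda>l. \<Sum>k. 2 * C * wt n (Suc l) * (2 * C' * m) * wt (Suc l) (Suc k))" by simp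
    qed
    finally show ?thesis using n by (simp add: op_apply_def inner)
  qed
qed

text \<open>Both \<open>P Q\<close> and \<open>Q P\<close> are equal to \<open>P - Q\<close>, so
  \<open>(I + P) (I - Q)\<close> and \<open>(I - Q) (I + P)\<close> reduce to the identity. In
  infinite dimension neither product alone would give a two-sided inverse.\<close>

lemma mutually_inverse_operators:
  assumes P: "wt_bounded P" and Q: "wt_bounded Q"
    and PQ: "\<And>n k i j. n \<ge> 1 \<Longrightarrow> k \<ge> 1 \<Longrightarrow> i < 2 \<Longrightarrow> j < 2 \<Longrightarrow>
      (\<lambda>l. \<Sum>p<2. P n i (Suc l) p * Q (Suc l) p k j) sums (P n i k j - Q n i k j)"
    and QP: "\<And>n k i j. n \<ge> 1 \<Longrightarrow> k \<ge> 1 \<Longrightarrow> i < 2 \<Longrightarrow> j < 2 \<Longrightarrow>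
      (\<lambda>l. \<Sum>p<2. Q n i (Suc l) p * P (Suc l) p k j) sums (P n i k j - Q n i k j)"
    and a: "in_m a"
  shows "I_plus P (I_minus Q a) = a" and "I_minus Q (I_plus P a) = a"
proof -
  let ?T = "\<lambda>n i k j. P n i k j - Q n i k j"
  have T: "op_apply ?T a = (\<lambda>n i. op_apply P a n i - op_apply Q a n i)"
    using wt_bounded_summable[OF P a] wt_bounded_summable[OF Q a]
    by (intro ext) (auto simp: op_apply_def left_diff_distrib sum_subtractf suminf_diff)
  have 1: "op_apply P (op_apply Q a) = (\<lambda>n i. op_apply P a n i - op_apply Q a n i)"
    unfolding T[symmetric] by (rule op_apply_compose[OF P Q a PQ])
  have 2: "op_apply Q (op_apply P a) = (\<lambda>n i. op_apply P a n i - op_apply Q a n i)"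
    unfolding T[symmetric] by (rule op_apply_compose[OF Q P a QP])
  have Ia: "I_minus Q a = (\<lambda>n i. a n i - op_apply Q a n i)" "I_plus P a = (\<lambda>n i. a n i + op_apply P a n i)"
    by (auto simp: I_minus_def I_plus_def fun_eq_iff)
  show "I_plus P (I_minus Q a) = a"
    unfolding Ia I_plus_def[abs_def] op_apply_diff[OF P a in_m_op_apply[OF Q a]] 1 by simp
  show "I_minus Q (I_plus P a) = a"
    unfolding Ia I_minus_def[abs_def] op_apply_add[OF Q a in_m_op_apply[OF P a]] 2 by simp
qed

section \<open>Row and column transformations\<close>

text \<open>\<open>Lam rho n i\<close> is the row operation \<open>T\<^sub>n\<^sup>-\<^sup>1\<close> (a divided difference, or a derivative when the two nodes
  coincide), \<open>col rho al k j g\<close> is entry \<open>j\<close> of \<open>(\<alpha>\<^sub>k\<^sub>0 g(\<rho>\<^sub>k\<^sub>0), - \<alpha>\<^sub>k\<^sub>1 g(\<rho>\<^sub>k\<^sub>1)) T\<^sub>k\<close>; both act on entire functions of \<open>\<rho>\<close>.\<close>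

definition Lam :: "(nat \<Rightarrow> complex) \<Rightarrow> nat \<Rightarrow> nat \<Rightarrow> (complex \<Rightarrow> complex) \<Rightarrow> complex" where
  "Lam rho n i g = (if i = 0 then
      (if rr rho n 0 \<noteq> rr rho n 1 then (g (rr rho n 0) - g (rr rho n 1)) / rhat rho n else deriv g (rr rho n 1))
     else g (rr rho n 1))"

definition col :: "(nat \<Rightarrow> complex) \<Rightarrow> (nat \<Rightarrow> complex) \<Rightarrow> nat \<Rightarrow> nat \<Rightarrow> (complex \<Rightarrow> complex) \<Rightarrow> complex" where
  "col rho al k j g = (if j = 0 then aa al k 0 * rhat rho k * g (rr rho k 0)
     else aa al k 0 * g (rr rho k 0) - aa al k 1 * g (rr rho k 1))"

definition Mat :: "(nat \<Rightarrow> complex) \<Rightarrow> (nat \<Rightarrow> complex) \<Rightarrow> (complex \<Rightarrow> complex \<Rightarrow> complex) \<Rightarrow> nat \<Rightarrow> nat \<Rightarrow> nat \<Rightarrow> nat \<Rightarrow> complex" where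
  "Mat rho al E n i k j = Lam rho n i (\<lambda>r. col rho al k j (\<lambda>s. E r s))"

lemma rhat_eq_0_iff: "rhat rho n = 0 \<longleftrightarrow> rr rho n 0 = rr rho n 1"
  by (simp add: rhat_def)

lemma psiv_eq_Lam: "psiv Phi rho x n i = (if n \<ge> 1 \<and> i < 2 then Lam rho n i (\<lambda>r. Phi x r) else 0)"
  by (auto simp: psiv_def Lam_def)

lemma Lam_mult: "g holomorphic_on UNIV \<Longrightarrow> Lam rho n i (\<lambda>r. w * g r) = w * Lam rho n i g"
  by (auto simp: Lam_def right_diff_distrib[symmetric] deriv_cmult holomorphic_on_imp_differentiable_at)

lemma Lam_diff:
  "g holomorphic_on UNIV \<Longrightarrow> g' holomorphic_on UNIV \<Longrightarrow> Lam rho n i (\<lambda>r. g r - g' r) = Lam rho n i g - Lam rho n i g'"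
  by (auto simp: Lam_def diff_divide_distrib deriv_diff holomorphic_on_imp_differentiable_at)

text \<open>The upper row of \<open>T_n * T_n^{-1}\<close>. It survives coinciding nodes, since the
  derivative then carries the factor \<open>rhat rho n = 0\<close>.\<close>

lemma Lam_recover: "rhat rho n * Lam rho n 0 g + Lam rho n 1 g = g (rr rho n 0)"
  by (auto simp: Lam_def rhat_eq_0_iff)

lemma holomorphic_col:
  assumes "\<And>s. (\<lambda>r. E r s) holomorphic_on UNIV"
  shows "(\<lambda>r. col rho al k j (\<lambda>s. E r s)) holomorphic_on UNIV"
  using assms by (cases "j = 0") (auto simp: col_def intro!: holomorphic_intros)

text \<open>For coinciding nodes the definition differentiates before combining columns, whereas
  \<open>Mat\<close> differentiates the combination; differentiability in the first argument
  reconciles the two.\<close>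

lemma Rm_eq_Mat:
  assumes "\<And>s. (\<lambda>r. DD Phi x r s) holomorphic_on UNIV"
  shows "Rm Phi rho al x n i k j = Mat rho al (DD Phi x) n i k j"
proof -
  have d: "(\<lambda>r. DD Phi x r s) field_differentiable at z" for s z
    using assms holomorphic_on_imp_differentiable_at by blast
  show ?thesis
  proof (cases "rr rho n 0 = rr rho n 1")
    case True
    have 0: "deriv (\<lambda>r. aa al k 0 * rhat rho k * DD Phi x r (rr rho k 0)) z
        = aa al k 0 * rhat rho k * deriv (\<lambda>r. DD Phi x r (rr rho k 0)) z" for z
      by (intro deriv_cmult d)
    have 1: "deriv (\<lambda>r. aa al k 0 * DD Phi x r (rr rho k 0) - aa al k 1 * DD Phi x r (rr rho k 1)) z
        = aa al k 0 * deriv (\<lambda>r. DD Phi x r (rr rho k 0)) z - aa al k 1 * deriv (\<lambda>r. DD Phi x r (rr rho k 1)) z" for z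
      by (subst deriv_diff) (auto intro!: d derivative_intros field_differentiable_mult field_differentiable_const simp: deriv_cmult d)
    show ?thesis using True 0 1
      by (auto simp: Rm_def Mat_def Lam_def col_def mulT_def)
  next
    case False
    then show ?thesis
      by (auto simp: Rm_def Mat_def Lam_def col_def mulT_def Tinvmul_def algebra_simps)
  qed
qed

text \<open>A single constant serves for nodes and weights: in both cases the given and the free
  data differ by at most \<open>A / n\<close>. It also limits how far the two nodes of a pair are
  apart.\<close>

locale nodes =
  fixes rho al :: "nat \<Rightarrow> complex" and A :: real
  assumes A: "A \<ge> 0"
    and rhat_le: "\<And>n. n \<ge> 1 \<Longrightarrow> cmod (rhat rho n) \<le> A / real n"
    and aa_le: "\<And>n i. n \<ge> 1 \<Longrightarrow> cmod (aa al n i) \<le> A"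
    and aa_diff_le: "\<And>n. n \<ge> 1 \<Longrightarrow> cmod (aa al n 0 - aa al n 1) \<le> A / real n"
begin

text \<open>Radius \<open>A\<close> covers both nodes; the additional 1 is the margin for Cauchy
  estimates.\<close>

definition B :: "nat \<Rightarrow> complex set" where "B n = cball (rr rho n 1) (A + 1)"

lemma rhat_le': "n \<ge> 1 \<Longrightarrow> cmod (rhat rho n) \<le> A"
  using rhat_le[of n] A by (auto intro: order_trans simp: divide_le_eq mult_le_cancel_left1)

lemma rr_in_B: "n \<ge> 1 \<Longrightarrow> rr rho n i \<in> B n"
  using rhat_le'[of n] A by (auto simp: B_def rhat_def rr_def dist_norm norm_minus_commute)

text \<open>On the disc of radius \<open>A\<close> the derivative is at most \<open>K\<close> by
  Cauchy's estimate with radius 1, and the divided difference inherits this bound by convexity. The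
  constant does not deteriorate as the two nodes approach each other.\<close>

lemma Lam_bound:
  assumes n: "n \<ge> 1" and g: "g holomorphic_on UNIV" and K: "\<And>z. z \<in> B n \<Longrightarrow> cmod (g z) \<le> K"
  shows "cmod (Lam rho n i g) \<le> K"
proof -
  have der: "cmod (deriv g z) \<le> K" if z: "z \<in> cball (rr rho n 1) A" for z
  proof -
    have "cmod ((deriv ^^ 1) g z) \<le> fact 1 * K / 1 ^ 1"
    proof (rule Cauchy_inequality)
      show "g holomorphic_on ball z 1" using g holomorphic_on_subset by blast
      show "continuous_on (cball z 1) g" 
        using g holomorphic_on_imp_continuous_on continuous_on_subset by blast
      fix y assume "cmod (z - y) = 1"
      then have "y \<in> B n" using z dist_triangle[of "rr rho n 1" y z] by (auto simp: B_def dist_norm)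
      then show "cmod (g y) \<le> K" by (rule K)
    qed auto
    then show ?thesis by simp
  qed
  show ?thesis
  proof (cases "i = 0")
    case False
    then show ?thesis using K[OF rr_in_B[OF n]] by (simp add: Lam_def)
  next
    case True
    show ?thesis
    proof (cases "rr rho n 0 = rr rho n 1")
      case eq: True
      then show ?thesis using True der[of "rr rho n 1"] A by (simp add: Lam_def)
    next
      case False
      have "cmod (g (rr rho n 0) - g (rr rho n 1)) \<le> K * cmod (rr rho n 0 - rr rho n 1)"
      proof (rule field_differentiable_bound[where S = "cball (rr rho n 1) A" and f' = "deriv g"])
        show "(g has_field_derivative deriv g z) (at z within cball (rr rho n 1) A)" for z
          using holomorphic_derivI[OF g, of z] has_field_derivative_at_within by blast
        show "rr rho n 0 \<in> cball (rr rho n 1) A" using rhat_le'[OF n] by (simp add: rhat_def dist_norm norm_minus_commute)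
      qed (use A der in auto)
      then show ?thesis using True False by (simp add: Lam_def rhat_def norm_divide divide_le_eq)
    qed
  qed
qed

text \<open>The decay is required on whole discs instead of at the nodes, so that it passes to
  divided differences and derivatives in either variable.\<close>

definition kernel :: "(complex \<Rightarrow> complex \<Rightarrow> complex) \<Rightarrow> bool" where
  "kernel E \<longleftrightarrow> (\<forall>s. (\<lambda>r. E r s) holomorphic_on UNIV) \<and> (\<forall>r. (\<lambda>s. E r s) holomorphic_on UNIV) \<and>
    (\<exists>C\<ge>0. \<forall>n\<ge>1. \<forall>k\<ge>1. \<forall>r\<in>B n. \<forall>s\<in>B k. cmod (E r s) \<le> C / (1 + \<bar>real n - real k\<bar>))"

text \<open>The gain \<open>1 / k\<close> is explicit in column 0 through \<open>rhat\<close>.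
  Column 1 is a difference, split into one part with the difference of the weights and one with
  \<open>rhat\<close> times a divided difference of the kernel; both are
  \<open>O(1 / k)\<close>.\<close>

lemma col_bound:
  assumes E: "kernel E"
  obtains C where "C \<ge> 0" "\<And>n k r j. n \<ge> 1 \<Longrightarrow> k \<ge> 1 \<Longrightarrow> r \<in> B n \<Longrightarrow> cmod (col rho al k j (\<lambda>s. E r s)) \<le> C * wt n k"
proof -
  obtain C where C: "C \<ge> 0" "\<And>n k r s. n \<ge> 1 \<Longrightarrow> k \<ge> 1 \<Longrightarrow> r \<in> B n \<Longrightarrow> s \<in> B k \<Longrightarrow> cmod (E r s) \<le> C / (1 + \<bar>real n - real k\<bar>)"
    using E unfolding kernel_def by blast
  have "cmod (col rho al k j (\<lambda>s. E r s)) \<le> (A * A * C + A * C) * wt n k"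
    if n: "n \<ge> 1" and k: "k \<ge> 1" and r: "r \<in> B n" for n k r j
  proof -
    define b where "b = 1 / (1 + \<bar>real n - real k\<bar>)"
    have b: "b \<ge> 0" by (simp add: b_def)
    have wt: "wt n k = b / real k" by (simp add: wt_def b_def)
    have E0: "cmod (E r s) \<le> C * b" if "s \<in> B k" for s using C(2)[OF n k r that] by (simp add: b_def)
    show ?thesis
    proof (cases "j = 0")
      case True
      have "cmod (aa al k 0) * cmod (rhat rho k) * cmod (E r (rr rho k 0)) \<le> A * (A / real k) * (C * b)"
        using A k by (intro mult_mono aa_le rhat_le E0 rr_in_B) auto
      also have "\<dots> = A * A * C * wt n k" by (simp add: wt)
      also have "\<dots> \<le> (A * A * C + A * C) * wt n k" using A C(1) wt_nonneg by (intro mult_right_mono) auto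
      finally show ?thesis using True by (simp add: col_def norm_mult)
    next
      case False
      have hol: "(\<lambda>s. E r s) holomorphic_on UNIV" using E unfolding kernel_def by blast
      have L: "cmod (Lam rho k 0 (\<lambda>s. E r s)) \<le> C * b" by (rule Lam_bound[OF k hol E0])
      have dif: "E r (rr rho k 0) - E r (rr rho k 1) = rhat rho k * Lam rho k 0 (\<lambda>s. E r s)"
        using Lam_recover[of rho k "\<lambda>s. E r s"] by (simp add: Lam_def algebra_simps)
      have "col rho al k j (\<lambda>s. E r s) = (aa al k 0 - aa al k 1) * E r (rr rho k 0) + aa al k 1 * (rhat rho k * Lam rho k 0 (\<lambda>s. E r s))"
        unfolding dif[symmetric] using False by (simp add: col_def algebra_simps)
      also have "cmod \<dots> \<le> cmod (aa al k 0 - aa al k 1) * cmod (E r (rr rho k 0)) + cmod (aa al k 1) * (cmod (rhat rho k) * cmod (Lam rho k 0 (\<lambda>s. E r s)))"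
        by (rule norm_triangle_ineq[THEN order_trans]) (simp add: norm_mult)
      also have "\<dots> \<le> (A / real k) * (C * b) + A * ((A / real k) * (C * b))"
        using A k C(1) b by (intro add_mono mult_mono aa_diff_le aa_le rhat_le E0 rr_in_B L) auto
      also have "\<dots> = (A * A * C + A * C) * wt n k" by (simp add: wt add_divide_distrib ring_distribs)
      finally show ?thesis .
    qed
  qed
  moreover have "A * A * C + A * C \<ge> 0" using A C(1) by simp
  ultimately show ?thesis using that by blast
qed

lemma wt_bounded_Mat:
  assumes E: "kernel E"
  shows "wt_bounded (Mat rho al E)"
proof -
  obtain C where C: "C \<ge> 0" "\<And>n k r j. n \<ge> 1 \<Longrightarrow> k \<ge> 1 \<Longrightarrow> r \<in> B n \<Longrightarrow> cmod (col rho al k j (\<lambda>s. E r s)) \<le> C * wt n k"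
    by (rule col_bound[OF E]) (erule that)
  have hol: "\<And>s. (\<lambda>r. E r s) holomorphic_on UNIV" using E unfolding kernel_def by blast
  have "cmod (Mat rho al E n i k j) \<le> C * wt n k" if "n \<ge> 1" "k \<ge> 1" for n i k j
    unfolding Mat_def by (rule Lam_bound[OF that(1) holomorphic_col[OF hol] C(2)[OF that]])
  then show ?thesis unfolding wt_bounded_def using C(1) by blast
qed

text \<open>Apart from the derivative, \<open>Lam\<close> is a finite combination of point values.
  For coinciding nodes the series is differentiated termwise in the open disc inside
  \<open>B n\<close>, where \<open>M\<close> dominates it.\<close>

lemma Lam_sums:
  assumes n: "n \<ge> 1" and hol: "\<And>l. f l holomorphic_on UNIV"
    and le: "\<And>l r. r \<in> B n \<Longrightarrow> cmod (f l r) \<le> M l" and M: "summable M"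
    and sums: "\<And>r. (\<lambda>l. f l r) sums F r"
  shows "(\<lambda>l. Lam rho n i (f l)) sums Lam rho n i F"
proof (cases "i = 0 \<and> rr rho n 0 = rr rho n 1")
  case False
  then show ?thesis by (auto simp: Lam_def intro!: sums sums_divide sums_diff)
next
  case True
  define S where "S = ball (rr rho n 1) (A + 1)"
  have SB: "S \<subseteq> B n" by (auto simp: S_def B_def)
  have M0: "M l \<ge> 0" for l
    using le[OF rr_in_B[OF n], of l] norm_ge_zero order_trans by blast
  have "\<exists>g g'. \<forall>x \<in> S. ((\<lambda>l. f l x) sums g x) \<and> ((\<lambda>l. deriv (f l) x) sums g' x) \<and> (g has_field_derivative g' x) (at x)"
  proof (rule series_and_derivative_comparison_complex)
    show "open S" by (simp add: S_def)
    show "(f l has_field_derivative deriv (f l) x) (at x)" for l x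
      using holomorphic_derivI[OF hol] by auto
    fix x assume "x \<in> S"
    have "summable (\<lambda>l. of_real (M l) :: complex)" using M by (rule summable_of_real)
    moreover have "\<forall>\<^sub>F l in sequentially. \<forall>y\<in>ball x 1 \<inter> S. cmod (f l y) \<le> cmod (of_real (M l) :: complex)"
      using le SB M0 by (intro always_eventually) auto
    ultimately show "\<exists>d h. 0 < d \<and> summable h \<and> range h \<subseteq> \<real>\<^sub>\<ge>\<^sub>0 \<and> (\<forall>\<^sub>F n in sequentially. \<forall>y\<in>ball x d \<inter> S. cmod (f n y) \<le> cmod (h n))"
      using M0 by (intro exI[of _ 1] exI[of _ "\<lambda>l. of_real (M l)"]) auto
  qed
  then obtain g g' where g: "\<And>x. x \<in> S \<Longrightarrow> (\<lambda>l. f l x) sums g x" "\<And>x. x \<in> S \<Longrightarrow> (\<lambda>l. deriv (f l) x) sums g' x"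
    "\<And>x. x \<in> S \<Longrightarrow> (g has_field_derivative g' x) (at x)" by blast
  have c: "rr rho n 1 \<in> S" using A by (simp add: S_def)
  have gF: "g x = F x" if "x \<in> S" for x using sums_unique2[OF g(1)[OF that] sums] .
  have "(F has_field_derivative g' (rr rho n 1)) (at (rr rho n 1))"
    using has_field_derivative_transform_within_open[OF g(3)[OF c], of S F] c gF by (simp add: S_def)
  then have "deriv F (rr rho n 1) = g' (rr rho n 1)" by (rule DERIV_imp_deriv)
  then show ?thesis using g(2)[OF c] True by (simp add: Lam_def)
qed

text \<open>Undoing the transformation \<open>T\<^sub>l\<close> in the middle: only the values at the two nodes enter the sum over \<open>p\<close>.\<close>

lemma Mat_Lam_sums:
  assumes n: "n \<ge> 1" and E: "kernel E" and g: "g holomorphic_on UNIV"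
    and Kg: "\<And>l z. l \<ge> 1 \<Longrightarrow> z \<in> B l \<Longrightarrow> cmod (g z) \<le> Kg"
    and F: "\<And>r. (\<lambda>l. col rho al (Suc l) 1 (\<lambda>z. E r z * g z)) sums F r"
  shows "(\<lambda>l. \<Sum>p<2. Mat rho al E n i (Suc l) p * Lam rho (Suc l) p g) sums Lam rho n i F"
proof -
  define f where "f l r = (\<Sum>p<2. Lam rho (Suc l) p g * col rho al (Suc l) p (\<lambda>s. E r s))" for l r
  obtain C where C: "C \<ge> 0" "\<And>n k r j. n \<ge> 1 \<Longrightarrow> k \<ge> 1 \<Longrightarrow> r \<in> B n \<Longrightarrow> cmod (col rho al k j (\<lambda>s. E r s)) \<le> C * wt n k"
    by (rule col_bound[OF E]) (erule that)
  obtain S where S: "\<And>n. summable (\<lambda>k. wt n (Suc k))" by (rule wt_sum) (erule that)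
  have holE: "\<And>s. (\<lambda>r. E r s) holomorphic_on UNIV" using E unfolding kernel_def by blast
  have two: "(\<Sum>p<2. u p) = u 0 + u 1" for u :: "nat \<Rightarrow> complex" by (simp add: numeral_2_eq_2)
  have "(\<lambda>l. Lam rho n i (f l)) sums Lam rho n i F"
  proof (rule Lam_sums[OF n])
    show "f l holomorphic_on UNIV" for l
      unfolding f_def[abs_def] by (intro holomorphic_intros holomorphic_col holE)
    show "cmod (f l r) \<le> (2 * Kg * C) * wt n (Suc l)" if r: "r \<in> B n" for l r
    proof -
      have L: "cmod (Lam rho (Suc l) p g) \<le> Kg" for p by (rule Lam_bound[OF _ g Kg]) auto
      then have "Kg \<ge> 0" using norm_ge_zero order_trans by blast
      then have "cmod (Lam rho (Suc l) p g * col rho al (Suc l) p (\<lambda>s. E r s)) \<le> Kg * (C * wt n (Suc l))" for p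
        unfolding norm_mult using n r by (intro mult_mono L C(2)) auto
      then have "cmod (f l r) \<le> of_nat (card {..<2::nat}) * (Kg * (C * wt n (Suc l)))"
        unfolding f_def by (intro sum_norm_bound)
      then show ?thesis by (simp add: algebra_simps)
    qed
    show "summable (\<lambda>l. (2 * Kg * C) * wt n (Suc l))" by (intro summable_mult S)
    have "f l r = col rho al (Suc l) 1 (\<lambda>z. E r z * g z)" for l r
    proof -
      have "f l r = aa al (Suc l) 0 * E r (rr rho (Suc l) 0) * (rhat rho (Suc l) * Lam rho (Suc l) 0 g + Lam rho (Suc l) 1 g)
          - aa al (Suc l) 1 * E r (rr rho (Suc l) 1) * Lam rho (Suc l) 1 g"
        unfolding f_def two by (simp add: col_def algebra_simps)
      also have "Lam rho (Suc l) 1 g = g (rr rho (Suc l) 1)" by (simp add: Lam_def)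
      finally show ?thesis using Lam_recover[of rho "Suc l" g] by (simp add: Lam_def col_def mult.assoc)
    qed
    then show "(\<lambda>l. f l r) sums F r" for r using F by simp
  qed
  moreover have "Lam rho n i (f l) = (\<Sum>p<2. Mat rho al E n i (Suc l) p * Lam rho (Suc l) p g)" for l
  proof -
    define c where "c p r = col rho al (Suc l) p (\<lambda>s. E r s)" for p r
    have c: "c p holomorphic_on UNIV" for p unfolding c_def[abs_def] by (intro holomorphic_col holE)
    \<comment> \<open>The sum is written as a difference with a negated coefficient in order to use
      linearity in the form \<open>Lam_diff\<close>.\<close>
    have "Lam rho n i (f l) = Lam rho n i (\<lambda>r. Lam rho (Suc l) 0 g * c 0 r - (- Lam rho (Suc l) 1 g) * c 1 r)"
      by (simp add: f_def[abs_def] two c_def)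
    also have "\<dots> = Lam rho n i (\<lambda>r. Lam rho (Suc l) 0 g * c 0 r) - Lam rho n i (\<lambda>r. (- Lam rho (Suc l) 1 g) * c 1 r)"
      by (intro Lam_diff holomorphic_intros c)
    also have "\<dots> = Lam rho (Suc l) 0 g * Lam rho n i (c 0) - (- Lam rho (Suc l) 1 g) * Lam rho n i (c 1)"
      by (simp only: Lam_mult[OF c])
    finally show ?thesis by (simp add: two Mat_def c_def[abs_def])
  qed
  ultimately show ?thesis by simp
qed

text \<open>The column operation for \<open>k\<close>, applied to the second argument of
  \<open>G\<close>, leaves a bounded entire function \<open>g\<close> of the middle variable near
  the nodes; being a finite combination of values, it commutes with the series over
  \<open>l\<close>.\<close>

lemma Mat_product_sums:
  assumes n: "n \<ge> 1" and k: "k \<ge> 1" and E: "kernel E" and G: "kernel G"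
    and F: "\<And>r s. (\<lambda>l. col rho al (Suc l) 1 (\<lambda>z. E r z * G z s)) sums F r s"
  shows "(\<lambda>l. \<Sum>p<2. Mat rho al E n i (Suc l) p * Mat rho al G (Suc l) p k j) sums Mat rho al F n i k j"
proof -
  define g where "g r = col rho al k j (\<lambda>s. G r s)" for r
  obtain C where C: "C \<ge> 0" "\<And>n k r j. n \<ge> 1 \<Longrightarrow> k \<ge> 1 \<Longrightarrow> r \<in> B n \<Longrightarrow> cmod (col rho al k j (\<lambda>s. G r s)) \<le> C * wt n k"
    by (rule col_bound[OF G]) (erule that)
  have holG: "\<And>s. (\<lambda>r. G r s) holomorphic_on UNIV" using G unfolding kernel_def by blast
  have "(\<lambda>l. \<Sum>p<2. Mat rho al E n i (Suc l) p * Lam rho (Suc l) p g) sums Lam rho n i (\<lambda>r. col rho al k j (\<lambda>s. F r s))"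
  proof (rule Mat_Lam_sums[OF n E])
    show "g holomorphic_on UNIV" unfolding g_def[abs_def] by (intro holomorphic_col holG)
    show "cmod (g z) \<le> C * 1" if "l \<ge> 1" "z \<in> B l" for l z
    proof -
      have "1 * 1 \<le> real k * (1 + \<bar>real l - real k\<bar>)" using k by (intro mult_mono) auto
      then have "wt l k \<le> 1" by (simp add: wt_def)
      then show ?thesis using C(2)[OF that(1) k that(2), of j] C(1) mult_left_mono[of "wt l k" 1 C]
        unfolding g_def by linarith
    qed
    fix r
    let ?t = "\<lambda>s l. col rho al (Suc l) 1 (\<lambda>z. E r z * G z s)"
    have "(\<lambda>l. col rho al k j (\<lambda>s. ?t s l)) sums col rho al k j (\<lambda>s. F r s)"
      unfolding col_def[of _ _ k] by (cases "j = 0") (auto intro!: sums_mult sums_diff F[unfolded One_nat_def])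
    moreover have "col rho al k j (\<lambda>s. ?t s l) = col rho al (Suc l) 1 (\<lambda>z. E r z * g z)" for l
      by (simp add: col_def g_def algebra_simps)
    ultimately show "(\<lambda>l. col rho al (Suc l) 1 (\<lambda>z. E r z * g z)) sums col rho al k j (\<lambda>s. F r s)" by simp
  qed
  then show ?thesis by (simp add: Mat_def g_def[abs_def])
qed

lemma Mat_diff:
  assumes E: "kernel E" and G: "kernel G"
  shows "Mat rho al (\<lambda>r s. E r s - G r s) n i k j = Mat rho al E n i k j - Mat rho al G n i k j"
proof -
  have "(\<lambda>r. col rho al k j (\<lambda>s. E r s - G r s)) = (\<lambda>r. col rho al k j (\<lambda>s. E r s) - col rho al k j (\<lambda>s. G r s))"
    by (auto simp: col_def algebra_simps)
  then show ?thesis unfolding Mat_def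
    using E G by (simp add: Lam_diff holomorphic_col kernel_def)
qed

lemma in_m_Lam:
  assumes g: "g holomorphic_on UNIV" and Kg: "\<And>l z. l \<ge> 1 \<Longrightarrow> z \<in> B l \<Longrightarrow> cmod (g z) \<le> Kg"
  shows "in_m (\<lambda>n i. if n \<ge> 1 \<and> i < 2 then Lam rho n i g else 0)"
proof -
  have "cmod (Lam rho n i g) \<le> Kg" if "n \<ge> 1" for n i
    by (rule Lam_bound[OF that g Kg[OF that]])
  then show ?thesis unfolding in_m_def by auto
qed

text \<open>\<open>E\<close> and \<open>e\<close> stand for the free problem, \<open>G\<close> and
  \<open>g\<close> for the given one. The three series hypotheses are scalar identities at arbitrary
  complex arguments, and everything about matrices is derived from them by row and column
  operations.\<close>

lemma main_equation_abstract:
  fixes E G :: "complex \<Rightarrow> complex \<Rightarrow> complex" and e g :: "complex \<Rightarrow> complex"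
  assumes E: "kernel E" and G: "kernel G" and e: "e holomorphic_on UNIV" and g: "g holomorphic_on UNIV"
    and Kg: "\<And>l z. l \<ge> 1 \<Longrightarrow> z \<in> B l \<Longrightarrow> cmod (g z) \<le> Kg"
    and EG: "\<And>r s. (\<lambda>l. col rho al (Suc l) 1 (\<lambda>z. E r z * G z s)) sums (E r s - G r s)"
    and GE: "\<And>r s. (\<lambda>l. col rho al (Suc l) 1 (\<lambda>z. G r z * E z s)) sums (E r s - G r s)"
    and eg: "\<And>r. (\<lambda>l. col rho al (Suc l) 1 (\<lambda>z. E r z * g z)) sums (e r - g r)"
    and P: "P = Mat rho al E" and Q: "Q = Mat rho al G"
    and psi: "psi = (\<lambda>n i. if n \<ge> 1 \<and> i < 2 then Lam rho n i g else 0)"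
    and psit: "psit = (\<lambda>n i. if n \<ge> 1 \<and> i < 2 then Lam rho n i e else 0)"
  shows "bounded_op_m P" and "bounded_op_m Q" and "psit = I_plus P psi"
    and "in_m a \<Longrightarrow> I_plus P (I_minus Q a) = a" and "in_m a \<Longrightarrow> I_minus Q (I_plus P a) = a"
proof -
  have wP: "wt_bounded P" and wQ: "wt_bounded Q" unfolding P Q by (intro wt_bounded_Mat E G)+
  show "bounded_op_m P" "bounded_op_m Q" using wP wQ wt_bounded_imp_bounded_op by blast+
  have PQ: "(\<lambda>l. \<Sum>p<2. P n i (Suc l) p * Q (Suc l) p k j) sums (P n i k j - Q n i k j)" if "n \<ge> 1" "k \<ge> 1" for n k i j
    using Mat_product_sums[OF that E G EG, of i j] unfolding P Q Mat_diff[OF E G] .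
  have QP: "(\<lambda>l. \<Sum>p<2. Q n i (Suc l) p * P (Suc l) p k j) sums (P n i k j - Q n i k j)" if "n \<ge> 1" "k \<ge> 1" for n k i j
    using Mat_product_sums[OF that G E GE, of i j] unfolding P Q Mat_diff[OF E G] .
  show "I_plus P (I_minus Q a) = a" "I_minus Q (I_plus P a) = a" if "in_m a"
    using mutually_inverse_operators[OF wP wQ PQ QP that] by auto
  have "psit n i = I_plus P psi n i" for n i
  proof (cases "n \<ge> 1 \<and> i < 2")
    case False
    then show ?thesis by (auto simp: psit psi I_plus_def op_apply_def)
  next
    case True
    have "(\<lambda>l. \<Sum>p<2. Mat rho al E n i (Suc l) p * Lam rho (Suc l) p g) sums Lam rho n i (\<lambda>r. e r - g r)"
    proof (rule Mat_Lam_sums[OF _ E g])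
      show "n \<ge> 1" using True by simp
      show "cmod (g z) \<le> Kg" if "l \<ge> 1" "z \<in> B l" for l z by (rule Kg[OF that])
    qed (rule eg)
    then have "(\<lambda>l. \<Sum>p<2. P n i (Suc l) p * Lam rho (Suc l) p g) sums (Lam rho n i e - Lam rho n i g)"
      unfolding P Lam_diff[OF e g] .
    then have "(\<Sum>l. \<Sum>p<2. P n i (Suc l) p * psi (Suc l) p) = Lam rho n i e - Lam rho n i g"
      by (simp add: psi sums_iff)
    then show ?thesis using True by (simp add: psit psi I_plus_def op_apply_def)
  qed
  then show "psit = I_plus P psi" by (intro ext)
qed

end

section \<open>The kernels and the free problem\<close>

lemma holomorphic_on_compose_square:
  fixes g :: "complex \<Rightarrow> complex"
  assumes "g holomorphic_on UNIV"
  shows "(\<lambda>r. g (r\<^sup>2)) holomorphic_on UNIV"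
proof -
  have "(g \<circ> (\<lambda>r. r\<^sup>2)) holomorphic_on UNIV"
    using assms by (intro holomorphic_on_compose holomorphic_intros) (rule holomorphic_on_subset, auto)
  then show ?thesis by (simp add: o_def)
qed

context sturm_liouville
begin

text \<open>Near the diagonal a crude bound of the integrand suffices. Elsewhere
  \<open>(r - s) * (r + s)\<close> divides the Wronskian-type expression in
  \<open>D_identity\<close>: its numerator is \<open>O(n + k)\<close>, which \<open>r + s\<close>
  compensates, and \<open>r - s\<close> supplies the decay.\<close>

lemma D_estimate:
  assumes x: "x \<in> {0..pi}" and a: "a \<ge> 0"
  shows "\<exists>C\<ge>0. \<forall>n\<ge>1. \<forall>k\<ge>1. \<forall>r s. cmod (r - of_nat (n - 1)) \<le> a \<longrightarrow> cmod (s - of_nat (k - 1)) \<le> a \<longrightarrow>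
    cmod (D x (r\<^sup>2) (s\<^sup>2)) \<le> C / (1 + \<bar>real n - real k\<bar>)"
proof -
  obtain C where C: "C \<ge> 0"
    "\<And>r x. x \<in> {0..pi} \<Longrightarrow> cmod (f x (r ^ 2)) \<le> C * exp (\<bar>Im r\<bar> * x)"
    "\<And>r x. x \<in> {0..pi} \<Longrightarrow> cmod (fd x (r ^ 2)) \<le> C * (1 + cmod r) * exp (\<bar>Im r\<bar> * x)"
    by (rule growth) (erule that)
  define F where "F = C * exp (a * pi)"
  have F: "F \<ge> 0" using C(1) by (simp add: F_def)
  have strip: "cmod (f t (r\<^sup>2)) \<le> F" "cmod (fd t (r\<^sup>2)) \<le> F * (1 + real n + a)"
    if t: "t \<in> {0..pi}" and r: "cmod (r - of_nat (n - 1)) \<le> a" for t r n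
  proof -
    have "\<bar>Im r\<bar> \<le> a" using abs_Im_le_cmod[of "r - of_nat (n - 1)"] r by simp
    then have e: "exp (\<bar>Im r\<bar> * t) \<le> exp (a * pi)" using t a by (auto intro!: mult_mono)
    have "cmod r \<le> cmod (r - of_nat (n - 1)) + cmod (of_nat (n - 1) :: complex)" 
      using norm_triangle_ineq[of "r - of_nat (n - 1)" "of_nat (n - 1)"] by simp
    then have rn: "cmod r \<le> a + real n" using r by simp
    show "cmod (f t (r\<^sup>2)) \<le> F"
      unfolding F_def by (rule order_trans[OF C(2)[OF t]]) (intro mult_left_mono e C(1))
    have "cmod (fd t (r\<^sup>2)) \<le> C * (1 + cmod r) * exp (\<bar>Im r\<bar> * t)" by (rule C(3)[OF t])
    also have "\<dots> \<le> C * (1 + real n + a) * exp (a * pi)"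
      using rn a C(1) e by (intro mult_mono) auto
    finally show "cmod (fd t (r\<^sup>2)) \<le> F * (1 + real n + a)" by (simp add: F_def mult_ac)
  qed
  \<comment> \<open>The summand with \<open>pi * (5 + 4 * a)\<close> covers
    \<open>|n - k| < 4 + 4 * a\<close>; the summand 16 covers the rest, where this threshold gives
    \<open>cmod (r - s) >= |n - k| / 2\<close> and
    \<open>cmod (r + s) >= (n + k) / 2\<close>.\<close>
  define K where "K = F * F * (pi * (5 + 4 * a) + 16)"
  have K: "K \<ge> 0" using a by (simp add: K_def)
  have "cmod (D x (r\<^sup>2) (s\<^sup>2)) \<le> K / (1 + \<bar>real n - real k\<bar>)"
    if n: "n \<ge> 1" "k \<ge> 1" and r: "cmod (r - of_nat (n - 1)) \<le> a" and s: "cmod (s - of_nat (k - 1)) \<le> a" for n k r s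
  proof -
    define m where "m = \<bar>real n - real k\<bar>"
    show ?thesis
    proof (cases "m < 4 + 4 * a")
      case True
      have "cmod (D x (r\<^sup>2) (s\<^sup>2)) \<le> (F * F) * integral {0..x} (\<lambda>t. cmod (1 :: complex))"
      proof -
        have sub: "{0..x} \<subseteq> {0..pi}" using x by auto
        have "cmod (integral {0..x} (\<lambda>t. 1 * (f t (r\<^sup>2) * f t (s\<^sup>2)))) \<le> (F * F) * integral {0..x} (\<lambda>t. cmod (1 :: complex))"
        proof (rule norm_integral_mult_le)
          show "(\<lambda>t. 1::complex) absolutely_integrable_on {0..x}"
            by (intro absolutely_integrable_continuous_real continuous_intros)
          show "continuous_on {0..x} (\<lambda>t. f t (r\<^sup>2) * f t (s\<^sup>2))"
            by (intro continuous_intros continuous_on_subset[OF continuous_fc(1) sub])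
          show "cmod (f t (r\<^sup>2) * f t (s\<^sup>2)) \<le> F * F" if "t \<in> {0..x}" for t
            unfolding norm_mult using that sub F by (intro mult_mono strip(1)[OF _ r] strip(1)[OF _ s]) auto
        qed
        then show ?thesis by (simp add: D_def)
      qed
      also have "\<dots> \<le> F * F * pi" using x by (simp add: mult_left_mono)
      finally have D1: "cmod (D x (r\<^sup>2) (s\<^sup>2)) \<le> F * F * pi" .
      have "F * F * pi * (1 + m) \<le> F * F * pi * (5 + 4 * a)" using True by (intro mult_left_mono) auto
      also have "\<dots> \<le> K" unfolding K_def by (simp add: algebra_simps)
      finally have "F * F * pi * (1 + m) \<le> K" .
      moreover have "1 + m > 0" by (simp add: m_def)
      ultimately have "F * F * pi \<le> K / (1 + m)" by (simp add: pos_le_divide_eq)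
      then show ?thesis using D1 unfolding m_def by linarith
    next
      case False
      define N where "N = real n + real k"
      have mN: "m \<le> N" "m \<ge> 4 + 4 * a" using False by (auto simp: m_def N_def)
      have rs1: "m / 2 \<le> cmod (r - s)"
      proof -
        have "cmod (of_nat (n - 1) - of_nat (k - 1) :: complex) = m"
        proof -
          have "(of_nat (n - 1) - of_nat (k - 1) :: complex) = of_real (real (n - 1) - real (k - 1))" by simp
          then have "cmod (of_nat (n - 1) - of_nat (k - 1) :: complex) = \<bar>real (n - 1) - real (k - 1)\<bar>"
            by (simp only: norm_of_real)
          then show ?thesis using n by (simp add: of_nat_diff m_def)
        qed
        moreover have "cmod (of_nat (n - 1) - of_nat (k - 1) :: complex) \<le> cmod (r - s) + cmod (r - of_nat (n - 1)) + cmod (s - of_nat (k - 1))"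
          using norm_triangle_ineq4[of "(r - s) + (s - of_nat (k - 1))" "r - of_nat (n - 1)"]
            norm_triangle_ineq[of "r - s" "s - of_nat (k - 1)"] by simp
        ultimately show ?thesis using r s mN by linarith
      qed
      have rs2: "N / 2 \<le> cmod (r + s)"
      proof -
        have "cmod (of_nat (n - 1) + of_nat (k - 1) :: complex) = N - 2"
        proof -
          have "(of_nat (n - 1) + of_nat (k - 1) :: complex) = of_real (real (n - 1) + real (k - 1))" by simp
          then have "cmod (of_nat (n - 1) + of_nat (k - 1) :: complex) = \<bar>real (n - 1) + real (k - 1)\<bar>"
            by (simp only: norm_of_real)
          then show ?thesis using n by (simp add: of_nat_diff N_def)
        qed
        moreover have "cmod (of_nat (n - 1) + of_nat (k - 1) :: complex) \<le> cmod (r + s) + cmod (r - of_nat (n - 1)) + cmod (s - of_nat (k - 1))"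
          using norm_triangle_ineq4[of "(r + s) - (s - of_nat (k - 1))" "r - of_nat (n - 1)"]
            norm_triangle_ineq4[of "r + s" "s - of_nat (k - 1)"] by (simp add: add.commute)
        ultimately show ?thesis using r s mN by linarith
      qed
      have m0: "m > 0" "N > 0" using mN a by linarith+
      have "(m / 2) * (N / 2) * cmod (D x (r\<^sup>2) (s\<^sup>2)) \<le> cmod (r - s) * cmod (r + s) * cmod (D x (r\<^sup>2) (s\<^sup>2))"
        using m0 by (intro mult_right_mono mult_mono rs1 rs2) auto
      also have "\<dots> = cmod ((r\<^sup>2 - s\<^sup>2) * D x (r\<^sup>2) (s\<^sup>2))"
        by (simp add: norm_mult[symmetric] power2_eq_square algebra_simps)
      also have "\<dots> = cmod (f x (r\<^sup>2) * fd x (s\<^sup>2) - fd x (r\<^sup>2) * f x (s\<^sup>2))" by (simp only: D_identity[OF x])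
      also have "\<dots> \<le> cmod (f x (r\<^sup>2)) * cmod (fd x (s\<^sup>2)) + cmod (fd x (r\<^sup>2)) * cmod (f x (s\<^sup>2))"
        by (rule norm_triangle_ineq4[THEN order_trans]) (simp add: norm_mult)
      also have "\<dots> \<le> F * (F * (1 + real k + a)) + (F * (1 + real n + a)) * F"
        using F a by (intro add_mono mult_mono strip[OF x r] strip[OF x s]) auto
      also have "\<dots> = F * F * (2 + 2 * a + N)" by (simp add: N_def algebra_simps)
      also have "\<dots> \<le> F * F * (2 * N)"
      proof (rule mult_left_mono)
        show "2 + 2 * a + N \<le> 2 * N" using mN a by linarith
      qed simp
      finally have "N * (m * cmod (D x (r\<^sup>2) (s\<^sup>2))) \<le> N * (8 * (F * F))" by (simp add: algebra_simps)
      then have "m * cmod (D x (r\<^sup>2) (s\<^sup>2)) \<le> 8 * (F * F)" using m0 by simp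
      moreover have "1 + m \<le> 2 * m" using mN a by linarith
      then have "(1 + m) * cmod (D x (r\<^sup>2) (s\<^sup>2)) \<le> (2 * m) * cmod (D x (r\<^sup>2) (s\<^sup>2))" by (intro mult_right_mono) auto
      ultimately have "(1 + m) * cmod (D x (r\<^sup>2) (s\<^sup>2)) \<le> 16 * (F * F)" by linarith
      also have "\<dots> \<le> K" using a F by (simp add: K_def algebra_simps)
      finally have "cmod (D x (r\<^sup>2) (s\<^sup>2)) \<le> K / (1 + m)" using m0 by (simp add: pos_le_divide_eq mult.commute)
      then show ?thesis unfolding m_def .
    qed
  qed
  then show ?thesis using K by blast
qed

lemma f_bounded_near_integers:
  assumes x: "x \<in> {0..pi}" and a: "a \<ge> 0"
  shows "\<exists>K. \<forall>r n. cmod (r - of_nat n) \<le> a \<longrightarrow> cmod (f x (r\<^sup>2)) \<le> K"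
proof -
  obtain C where C: "C \<ge> 0" "\<And>r x. x \<in> {0..pi} \<Longrightarrow> cmod (f x (r ^ 2)) \<le> C * exp (\<bar>Im r\<bar> * x)"
    by (rule growth) (erule that)
  have "cmod (f x (r\<^sup>2)) \<le> C * exp (a * pi)" if r: "cmod (r - of_nat n) \<le> a" for r n
  proof -
    have "\<bar>Im r\<bar> \<le> a" using abs_Im_le_cmod[of "r - of_nat n"] r by simp
    then have e: "exp (\<bar>Im r\<bar> * x) \<le> exp (a * pi)" using x a by (auto intro!: mult_mono)
    show ?thesis by (rule order_trans[OF C(2)[OF x]]) (intro mult_left_mono e C(1))
  qed
  then show ?thesis by blast
qed

lemma kernel_D:
  assumes x: "x \<in> {0..pi}" and n: "nodes rho al A"
  shows "nodes.kernel rho A (\<lambda>r s. D x (r\<^sup>2) (s\<^sup>2))"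
proof -
  interpret nodes rho al A by (rule n)
  have 1: "(\<lambda>r. D x (r\<^sup>2) (s\<^sup>2)) holomorphic_on UNIV" for s
    by (rule holomorphic_on_compose_square) (rule holomorphic_D[OF x])
  then have 2: "(\<lambda>s. D x (r\<^sup>2) (s\<^sup>2)) holomorphic_on UNIV" for r
    by (subst D_commute)
  obtain C where C: "C \<ge> 0" "\<forall>n\<ge>1. \<forall>k\<ge>1. \<forall>r s. cmod (r - of_nat (n - 1)) \<le> A + 1 \<longrightarrow> cmod (s - of_nat (k - 1)) \<le> A + 1 \<longrightarrow>
    cmod (D x (r\<^sup>2) (s\<^sup>2)) \<le> C / (1 + \<bar>real n - real k\<bar>)"
    using D_estimate[OF x, of "A + 1"] A by auto
  have "cmod (r - of_nat (n - 1)) \<le> A + 1" if "r \<in> B n" for r n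
    using that by (simp add: B_def rr_def dist_norm norm_minus_commute)
  then have "\<forall>n\<ge>1. \<forall>k\<ge>1. \<forall>r\<in>B n. \<forall>s\<in>B k. cmod (D x (r\<^sup>2) (s\<^sup>2)) \<le> C / (1 + \<bar>real n - real k\<bar>)"
    using C(2) by blast
  then show ?thesis unfolding kernel_def using 1 2 C(1) by blast
qed

text \<open>The boundary condition at 0 makes every eigenfunction a multiple of \<open>f\<close>,
  with the nonzero factor \<open>y 0\<close>.\<close>

lemma Del_eq_0_iff: "Del z = 0 \<longleftrightarrow> is_eigenvalue q h H z"
proof
  assume z: "Del z = 0"
  have "is_sol q z (\<lambda>x. f x z) (\<lambda>x. fd x z)"
    using sol_pair_is_sol[OF q, of z 1 h] by (simp add: f_def fd_def ivp_def ivp_deriv_def)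
  moreover have "\<exists>x\<in>{0..pi}. f x z \<noteq> 0" using f0[of z] by (intro bexI[of _ 0]) auto
  ultimately show "is_eigenvalue q h H z"
    unfolding is_eigenvalue_def using z f0[of z] fd0[of z]
    by (intro exI[of _ "\<lambda>x. f x z"] exI[of _ "\<lambda>x. fd x z"]) (simp add: Del_def)
next
  assume "is_eigenvalue q h H z"
  then obtain y yd x where y: "is_sol q z y yd" "x \<in> {0..pi}" "y x \<noteq> 0" "yd 0 - h * y 0 = 0" "yd pi + H * y pi = 0"
    unfolding is_eigenvalue_def by blast
  have eq: "y t = y 0 * f t z \<and> yd t = y 0 * fd t z" if "t \<in> {0..pi}" for t
    by (rule sol_unique[OF q is_sol_imp_sol[OF y(1)] sol_f]) (use y(4) that in \<open>auto simp: f0 fd0\<close>)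
  have "y 0 * Del z = yd pi + H * y pi"
    using eq[of pi] by (simp add: Del_def algebra_simps)
  moreover have "y 0 \<noteq> 0" using eq[OF y(2)] y(3) by auto
  ultimately show "Del z = 0" using y(5) by simp
qed

lemma char_fun_eq_Del: "char_fun q h H = Del"
  by (rule ext) (simp add: char_fun_def Del_def phi_eq_ivp phid_eq_ivp_deriv f_def fd_def)

lemma norming_nonzero:
  assumes "Del z = 0" "deriv Del z \<noteq> 0"
  shows "integral {0..pi} (\<lambda>t. (f t z)\<^sup>2) \<noteq> 0"
  using assms deriv_Del_at_zero by auto

end

section \<open>Asymptotics of the norming integrals\<close>

lemma cmod_cos_diff_le:
  fixes u v :: complex
  assumes "\<bar>Im u\<bar> \<le> b" "\<bar>Im v\<bar> \<le> b"
  shows "cmod (cos u - cos v) \<le> exp b * cmod (u - v)"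
proof (rule field_differentiable_bound[where S = "{w. Im w \<le> b} \<inter> {w. Im w \<ge> - b}" and f' = "\<lambda>w. - sin w"])
  show "convex ({w. Im w \<le> b} \<inter> {w. - b \<le> Im w})"
    by (intro convex_Int convex_halfspace_Im_le convex_halfspace_Im_ge)
  show "(cos has_field_derivative - sin w) (at w within {w. Im w \<le> b} \<inter> {w. - b \<le> Im w})" for w
    by (auto intro!: derivative_eq_intros)
  show "cmod (- sin w) \<le> exp b" if "w \<in> {w. Im w \<le> b} \<inter> {w. - b \<le> Im w}" for w
    using that cmod_sin_le_exp[of 1 w] by (auto intro: order_trans)
qed (use assms in auto)

lemma integral_cos_square:
  "integral {0..pi} (\<lambda>t. (cos (of_nat k * of_real t :: complex))\<^sup>2) = (if k = 0 then of_real pi else of_real (pi / 2))"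
proof (cases "k = 0")
  case True
  have "integral {0..pi} (\<lambda>t. 1 :: complex) = of_real pi" by (simp add: scaleR_conv_of_real)
  then show ?thesis using True by simp
next
  case False
  define G where "G w = w / 2 + sin (2 * of_nat k * w) / (4 * of_nat k)" for w :: complex
  have "((\<lambda>t. (cos (of_nat k * of_real t :: complex))\<^sup>2) has_integral G (of_real pi) - G (of_real 0)) {0..pi}"
  proof (rule fundamental_theorem_of_calculus)
    show "((\<lambda>t. G (of_real t)) has_vector_derivative (cos (of_nat k * of_real t :: complex))\<^sup>2) (at t within {0..pi})" for t
    proof (rule has_vector_derivative_real_field)
      have "1 / 2 + cos (2 * of_nat k * of_real t :: complex) / 2 = (cos (of_nat k * of_real t))\<^sup>2"
        using cos_double_cos[of "of_nat k * of_real t :: complex"] by (simp add: mult.assoc diff_divide_distrib)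
      moreover have "(G has_field_derivative 1 / 2 + cos (2 * of_nat k * of_real t) / 2) (at (of_real t))"
        unfolding G_def[abs_def] using False by (auto intro!: derivative_eq_intros)
      ultimately show "(G has_field_derivative (cos (of_nat k * of_real t))\<^sup>2) (at (of_real t))" by simp
    qed
  qed simp
  moreover have "sin (2 * of_nat k * of_real pi :: complex) = 0"
  proof -
    have "sin (2 * of_nat k * of_real pi :: complex) = of_real (sin (2 * real k * pi))"
      by (simp only: sin_of_real[symmetric] of_real_mult of_real_of_nat_eq of_real_numeral)
    then show ?thesis by simp
  qed
  ultimately show ?thesis using False by (simp add: G_def integral_unique)
qed

context sturm_liouville
begin

text \<open>The solution at \<open>rho n\<close> is within \<open>O(1 / n)\<close> of
  \<open>cos ((n - 1) * t)\<close>, uniformly in \<open>t\<close>; factoring a difference of squares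
  carries this over to the integrals.\<close>

lemma norming_asymptotics:
  assumes A: "A \<ge> 0" and rho: "\<And>n. n \<ge> 1 \<Longrightarrow> cmod (rho n - of_nat (n - 1)) \<le> A / real n"
  shows "\<exists>C\<ge>0. \<forall>\<^sub>F n in sequentially. cmod (integral {0..pi} (\<lambda>t. (f t ((rho n)\<^sup>2))\<^sup>2) - of_real (pi / 2)) \<le> C / real n"
proof -
  obtain K R where K: "K \<ge> 0"
    "\<And>r x. cmod r \<ge> R \<Longrightarrow> x \<in> {0..pi} \<Longrightarrow> cmod (f x (r ^ 2) - cos (r * x)) \<le> K / cmod r * exp (\<bar>Im r\<bar> * x)"
    by (rule asymptotics) (erule that)
  obtain C where C: "C \<ge> 0" "\<And>r x. x \<in> {0..pi} \<Longrightarrow> cmod (f x (r ^ 2)) \<le> C * exp (\<bar>Im r\<bar> * x)"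
    by (rule growth) (erule that)
  define e where "e = exp (A * pi)"
  have e: "e > 0" by (simp add: e_def)
  \<comment> \<open>The summand \<open>2 * K\<close> stems from the asymptotics with
    \<open>cmod (rho n) >= n / 2\<close>, the summand \<open>A * pi\<close> from moving the node to
    \<open>n - 1\<close>, and \<open>e\<close> bounds the exponentials. In \<open>C'\<close> the
    factor \<open>C * e + 1\<close> bounds the sum of the two functions and \<open>pi\<close> is the
    length of the interval.\<close>
  define L where "L = (2 * K + A * pi) * e"
  define C' where "C' = pi * (L * (C * e + 1))"
  have L: "L \<ge> 0" "C' \<ge> 0" using K(1) A C(1) e by (auto simp: L_def C'_def)
  have "\<forall>\<^sub>F n in sequentially. real n \<ge> 2 * R \<and> real n \<ge> 2 + 2 * A"
  proof -
    obtain N :: nat where "2 * \<bar>R\<bar> + 2 + 2 * A \<le> real N" using real_arch_simple by blast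
    then have "real n \<ge> 2 * R \<and> real n \<ge> 2 + 2 * A" if "n \<ge> N" for n
      using of_nat_mono[OF that, where ?'a = real] A by linarith
    then show ?thesis unfolding eventually_sequentially by blast
  qed
  then have "\<forall>\<^sub>F n in sequentially. cmod (integral {0..pi} (\<lambda>t. (f t ((rho n)\<^sup>2))\<^sup>2) - of_real (pi / 2)) \<le> C' / real n"
  proof eventually_elim
    case (elim n)
    then have n1: "real n \<ge> 2" using A by linarith
    then have n: "n \<ge> 1" "n - 1 \<noteq> 0" by auto
    define r where "r = rho n"
    have rn: "cmod (r - of_nat (n - 1)) \<le> A / real n" using rho[OF n(1)] by (simp add: r_def)
    have "A / real n \<le> A / 1" using n1 A by (intro divide_left_mono) auto
    then have rA: "cmod (r - of_nat (n - 1)) \<le> A" using rn by simp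
    have Im: "\<bar>Im r\<bar> \<le> A" using abs_Im_le_cmod[of "r - of_nat (n - 1)"] rA by simp
    have expe: "exp (\<bar>Im r\<bar> * t) \<le> e" if "t \<in> {0..pi}" for t
      unfolding e_def using that Im A by (auto intro!: mult_mono)
    have "real n - 1 = cmod (of_nat (n - 1) :: complex)"
      unfolding norm_of_nat using n by (simp add: of_nat_diff)
    also have "\<dots> \<le> cmod r + cmod (r - of_nat (n - 1))"
      using norm_triangle_ineq4[of r "r - of_nat (n - 1)"] by simp
    finally have rbig: "cmod r \<ge> real n / 2" using rA elim by linarith
    have close: "cmod (f t (r\<^sup>2) - cos (of_nat (n - 1) * of_real t)) \<le> L / real n" if t: "t \<in> {0..pi}" for t
    proof -
      have "cmod (f t (r\<^sup>2) - cos (r * of_real t)) \<le> K / cmod r * exp (\<bar>Im r\<bar> * t)"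
        using rbig elim by (intro K(2) t) linarith
      also have "\<dots> \<le> K / (real n / 2) * e"
        using rbig n1 K(1) by (intro mult_mono frac_le expe t) auto
      finally have 1: "cmod (f t (r\<^sup>2) - cos (r * of_real t)) \<le> 2 * K * e / real n" by (simp add: mult.commute)
      have "\<bar>Im (r * of_real t)\<bar> \<le> A * pi" using Im t A by (auto simp: abs_mult intro!: mult_mono)
      then have "cmod (cos (r * of_real t) - cos (of_nat (n - 1) * of_real t)) \<le> e * cmod (r * of_real t - of_nat (n - 1) * of_real t)"
        unfolding e_def using A by (intro cmod_cos_diff_le) auto
      also have "cmod (r * of_real t - of_nat (n - 1) * of_real t) = cmod (r - of_nat (n - 1)) * t"
        using t by (simp only: left_diff_distrib[symmetric] norm_mult norm_of_real) simp
      also have "\<dots> \<le> (A / real n) * pi" using rn t A by (intro mult_mono) auto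
      finally have 2: "cmod (cos (r * of_real t) - cos (of_nat (n - 1) * of_real t)) \<le> e * ((A / real n) * pi)"
        using e by simp
      have "cmod (f t (r\<^sup>2) - cos (of_nat (n - 1) * of_real t)) \<le> 2 * K * e / real n + e * ((A / real n) * pi)"
        using norm_triangle_ineq[of "f t (r\<^sup>2) - cos (r * of_real t)" "cos (r * of_real t) - cos (of_nat (n - 1) * of_real t)"] 1 2
        by simp
      also have "\<dots> = L / real n" by (simp add: L_def add_divide_distrib ring_distribs mult_ac)
      finally show ?thesis .
    qed
    have cc: "continuous_on {0..pi} (\<lambda>t. cos (of_nat (n - 1) * of_real t :: complex))" by (intro continuous_intros)
    have "integral {0..pi} (\<lambda>t. (f t (r\<^sup>2))\<^sup>2) - integral {0..pi} (\<lambda>t. (cos (of_nat (n - 1) * of_real t :: complex))\<^sup>2)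
        = integral {0..pi} (\<lambda>t. (f t (r\<^sup>2))\<^sup>2 - (cos (of_nat (n - 1) * of_real t))\<^sup>2)"
      by (intro integral_diff[symmetric] integrable_continuous_interval continuous_intros continuous_fc)
    also have "cmod \<dots> \<le> integral {0..pi} (\<lambda>t. L / real n * (C * e + 1))"
    proof (rule integral_norm_bound_integral)
      show "(\<lambda>t. (f t (r\<^sup>2))\<^sup>2 - (cos (of_nat (n - 1) * of_real t))\<^sup>2) integrable_on {0..pi}"
        by (intro integrable_continuous_interval continuous_intros continuous_fc)
      fix t assume t: "t \<in> {0..pi}"
      have "cmod (cos (of_real (real (n - 1) * t) :: complex)) \<le> 1"
        by (simp only: cos_of_real norm_of_real) (simp add: abs_cos_le_one)
      then have c1: "cmod (cos (of_nat (n - 1) * of_real t :: complex)) \<le> 1" by simp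
      have f1: "cmod (f t (r\<^sup>2)) \<le> C * e" by (rule order_trans[OF C(2)[OF t]]) (intro mult_left_mono expe t C(1))
      have "(f t (r\<^sup>2))\<^sup>2 - (cos (of_nat (n - 1) * of_real t))\<^sup>2
          = (f t (r\<^sup>2) - cos (of_nat (n - 1) * of_real t)) * (f t (r\<^sup>2) + cos (of_nat (n - 1) * of_real t))"
        by (simp add: power2_eq_square algebra_simps)
      also have "cmod \<dots> \<le> L / real n * (C * e + 1)"
        unfolding norm_mult using L by (intro mult_mono close t order_trans[OF norm_triangle_ineq] add_mono f1 c1) auto
      finally show "cmod ((f t (r\<^sup>2))\<^sup>2 - (cos (of_nat (n - 1) * of_real t))\<^sup>2) \<le> L / real n * (C * e + 1)" .
    qed (intro integrable_continuous_interval continuous_intros)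
    also have "\<dots> = C' / real n" by (simp add: C'_def)
    finally show ?case using n(2) by (simp only: integral_cos_square r_def if_False)
  qed
  then show ?thesis using L(2) by blast
qed

end

section \<open>The free problem\<close>

lemma sol_free: "sol (\<lambda>_. 0) (r\<^sup>2) (\<lambda>x. cos (r * of_real x)) (\<lambda>x. - r * sin (r * of_real x))"
proof -
  have dc: "((\<lambda>t. cos (r * of_real t)) has_vector_derivative - r * sin (r * of_real t)) (at t within S)" for t S
  proof -
    have "((\<lambda>w. cos (r * w)) has_field_derivative - r * sin (r * of_real t)) (at (of_real t))"
      by (auto intro!: derivative_eq_intros)
    from has_vector_derivative_real_field[OF this] show ?thesis by simp
  qed
  have ds: "((\<lambda>t. - r * sin (r * of_real t)) has_vector_derivative (0 - r\<^sup>2) * cos (r * of_real t)) (at t within S)" for t S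
  proof -
    have "((\<lambda>w. - r * sin (r * w)) has_field_derivative (0 - r\<^sup>2) * cos (r * of_real t)) (at (of_real t))"
      by (auto intro!: derivative_eq_intros simp: power2_eq_square)
    from has_vector_derivative_real_field[OF this] show ?thesis by simp
  qed
  have "integral {0..x} (\<lambda>t. - r * sin (r * of_real t)) = cos (r * of_real x) - cos (r * of_real 0)" if "x \<in> {0..pi}" for x
    by (intro integral_unique fundamental_theorem_of_calculus dc) (use that in auto)
  moreover have "integral {0..x} (\<lambda>t. (0 - r\<^sup>2) * cos (r * of_real t)) = - r * sin (r * of_real x) - - r * sin (r * of_real 0)"
    if "x \<in> {0..pi}" for x
    by (intro integral_unique fundamental_theorem_of_calculus ds) (use that in auto)
  ultimately show ?thesis
    unfolding sol_def by (intro conjI ballI continuous_intros) simp_all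
qed

interpretation free: sturm_liouville "\<lambda>_. 0" 0 0
  by unfold_locales simp

lemma free_f: "x \<in> {0..pi} \<Longrightarrow> free.f x (r\<^sup>2) = cos (r * of_real x)"
  and free_fd: "x \<in> {0..pi} \<Longrightarrow> free.fd x (r\<^sup>2) = - r * sin (r * of_real x)"
  using sol_unique[OF free.q free.sol_f sol_free, of r 1 x] by (auto simp: free.f0 free.fd0)

lemma free_Del: "free.Del (r\<^sup>2) = - r * sin (r * of_real pi)"
  by (simp add: free.Del_def free_fd)

lemma free_norming: "integral {0..pi} (\<lambda>t. (free.f t ((of_nat k)\<^sup>2))\<^sup>2) = (if k = 0 then of_real pi else of_real (pi / 2))"
proof -
  have "integral {0..pi} (\<lambda>t. (free.f t ((of_nat k)\<^sup>2))\<^sup>2) = integral {0..pi} (\<lambda>t. (cos (of_nat k * of_real t :: complex))\<^sup>2)"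
    by (intro integral_cong) (simp add: free_f)
  then show ?thesis by (simp add: integral_cos_square)
qed

text \<open>The zeros of \<open>r * sin (r * pi)\<close> are the integers, and opposite integers
  give the same eigenvalue. The double zero at \<open>r = 0\<close> is simple as a function of
  \<open>r^2\<close>, in accordance with the nonzero norming integral \<open>pi\<close>
  there.\<close>

lemma sturm_spectral_free: "sturm_spectral (\<lambda>_. 0) 0 0 (\<lambda>k. (of_nat k)\<^sup>2)"
proof
  have "z \<in> range (\<lambda>k. (of_nat k)\<^sup>2)" if "free.Del z = 0" for z
  proof -
    have "csqrt z * sin (csqrt z * of_real pi) = 0" using that free_Del[of "csqrt z"] by simp
    then consider "csqrt z = 0" | n :: int where "csqrt z * of_real pi = of_real (of_int n * pi)"
      by (auto simp: sin_eq_0)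
    then obtain n :: int where "csqrt z = of_int n"
    proof cases
      case 1
      then show ?thesis using that[of 0] by simp
    next
      case 2
      then have "csqrt z * of_real pi = of_int n * of_real pi" by simp
      then show ?thesis using that[of n] by simp
    qed
    then have "z = (of_int n)\<^sup>2" by (metis power2_csqrt)
    also have "\<dots> = (of_nat (nat \<bar>n\<bar>))\<^sup>2" by (simp flip: of_int_power)
    finally show ?thesis by blast
  qed
  moreover have "free.Del ((of_nat k)\<^sup>2) = 0" for k
  proof -
    have "sin (of_nat k * of_real pi :: complex) = of_real (sin (real k * pi))"
      by (simp only: sin_of_real[symmetric] of_real_mult of_real_of_nat_eq)
    then show ?thesis by (simp add: free_Del)
  qed
  ultimately show "{z. free.Del z = 0} = range (\<lambda>k. (of_nat k)\<^sup>2)" by blast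
  show "inj (\<lambda>k. (of_nat k :: complex)\<^sup>2)"
    by (rule injI) (metis of_nat_eq_iff of_nat_power power2_eq_imp_eq zero_le)
  show "integral {0..pi} (\<lambda>t. (free.f t ((of_nat k)\<^sup>2))\<^sup>2) \<noteq> 0" for k
    by (simp add: free_norming)
  have "cmod ((of_nat k)\<^sup>2) < (real N + 1/2)\<^sup>2 \<longleftrightarrow> k \<le> N" for k N
  proof -
    have "cmod ((of_nat k)\<^sup>2) < (real N + 1/2)\<^sup>2 \<longleftrightarrow> (real k)\<^sup>2 < (real N + 1/2)\<^sup>2" by (simp add: norm_power)
    also have "\<dots> \<longleftrightarrow> real k < real N + 1/2"
      by (intro iffI power_strict_mono) (auto intro: power_less_imp_less_base)
    also have "\<dots> \<longleftrightarrow> k \<le> N" by linarith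
    finally show ?thesis .
  qed
  then show "\<forall>\<^sub>F N in sequentially. \<forall>k. cmod ((of_nat k)\<^sup>2) < (real N + 1/2)\<^sup>2 \<longleftrightarrow> k \<le> N" by simp
qed

interpretation free: sturm_spectral "\<lambda>_. 0" 0 0 "\<lambda>k. (of_nat k)\<^sup>2"
  by (rule sturm_spectral_free)

text \<open>Index 0 here is index 1 in the numbering of the statement, so the exceptional value
  \<open>1 / pi\<close> belongs to the constant eigenfunction.\<close>

lemma free_al: "free.al k = aa al (Suc k) 1"
  by (simp add: free.al_def free_norming aa_def inverse_eq_divide)

section \<open>The main equation\<close>

lemma square_integrable_imp_absolutely_integrable:
  fixes q :: "real \<Rightarrow> complex"
  assumes "q measurable_on {0..pi}" "(\<lambda>t. (cmod (q t))\<^sup>2) integrable_on {0..pi}"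
  shows "q absolutely_integrable_on {0..pi}"
proof (rule measurable_bounded_by_integrable_imp_absolutely_integrable)
  show "q \<in> borel_measurable (lebesgue_on {0..pi})"
    using assms(1) by (simp add: measurable_on_iff_borel_measurable)
  show "(\<lambda>t. 1 + (cmod (q t))\<^sup>2) integrable_on {0..pi}"
    by (intro integrable_add assms(2)) auto
  show "cmod (q t) \<le> 1 + (cmod (q t))\<^sup>2" for t
  proof (cases "cmod (q t) \<le> 1")
    case True
    then show ?thesis using zero_le_power2[of "cmod (q t)"] by linarith
  next
    case False
    then have "cmod (q t) * 1 \<le> cmod (q t) * cmod (q t)" by (intro mult_left_mono) auto
    then show ?thesis by (simp add: power2_eq_square)
  qed
qed simp

text \<open>A square summable remainder is bounded, and \<open>omega / pi\<close> is added to the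
  constant. Since \<open>U\<close> bounds the squares, \<open>U + 1\<close> bounds the
  moduli.\<close>

lemma spectral_numbering_bound:
  assumes "spectral_numbering q h H rho"
  obtains A where "A \<ge> 0" "\<And>n. n \<ge> 1 \<Longrightarrow> cmod (rho n - of_nat (n - 1)) \<le> A / real n"
proof -
  define v where "v n = of_nat (Suc n) * (rho (Suc n) - of_nat n) - omega q h H / of_real pi" for n
  have "summable (\<lambda>n. (cmod (v n))\<^sup>2)"
    using assms unfolding spectral_numbering_def v_def by simp
  then have "Bseq (\<lambda>n. (cmod (v n))\<^sup>2)" 
    using summable_LIMSEQ_zero convergentI convergent_imp_Bseq by blast
  then obtain U where U: "U > 0" "\<And>n. (cmod (v n))\<^sup>2 \<le> U" by (auto simp: Bseq_def)
  have v: "cmod (v n) \<le> U + 1" for n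
  proof -
    have "U \<le> (U + 1)\<^sup>2" using U(1) by (simp add: power2_sum)
    then have "(cmod (v n))\<^sup>2 \<le> (U + 1)\<^sup>2" using U(2)[of n] by linarith
    then show ?thesis by (rule power2_le_imp_le) (use U(1) in simp)
  qed
  define A where "A = U + 1 + cmod (omega q h H / of_real pi)"
  have "cmod (rho n - of_nat (n - 1)) \<le> A / real n" if n: "n \<ge> 1" for n
  proof -
    obtain k where k: "n = Suc k" using n by (cases n) auto
    have "of_nat n * (rho n - of_nat (n - 1)) = v k + omega q h H / of_real pi" by (simp add: v_def k)
    then have "cmod (of_nat n * (rho n - of_nat (n - 1))) \<le> A"
      using norm_triangle_ineq[of "v k" "omega q h H / of_real pi"] v[of k] unfolding A_def by simp
    then have "real n * cmod (rho n - of_nat (n - 1)) \<le> A" by (simp only: norm_mult norm_of_nat)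
    then show ?thesis using n by (simp add: pos_le_divide_eq mult.commute)
  qed
  moreover have "A \<ge> 0" using U(1) by (simp add: A_def add_nonneg_nonneg)
  ultimately show ?thesis using that by blast
qed

text \<open>From \<open>k0\<close> on, \<open>rho (Suc k)\<close> is within 1/4 of \<open>k\<close>,
  so the radius \<open>N + 1/2\<close> separates the indices \<open>N\<close> and
  \<open>N + 1\<close>. The finitely many earlier ones have modulus at most \<open>k0 + A\<close>,
  hence lie inside once \<open>N >= N0\<close>.\<close>

lemma eventually_count_nodes:
  fixes rho :: "nat \<Rightarrow> complex"
  assumes A: "A \<ge> 0" and rho: "\<And>n. n \<ge> 1 \<Longrightarrow> cmod (rho n - of_nat (n - 1)) \<le> A / real n"
  shows "\<forall>\<^sub>F N in sequentially. \<forall>k. cmod ((rho (Suc k))\<^sup>2) < (real N + 1/2)\<^sup>2 \<longleftrightarrow> k \<le> N"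
proof -
  obtain k0 :: nat where k0: "4 * A \<le> real k0" using real_arch_simple by blast
  obtain N0 :: nat where N0: "real k0 + A \<le> real N0" using real_arch_simple by blast
  have "cmod ((rho (Suc k))\<^sup>2) < (real N + 1/2)\<^sup>2 \<longleftrightarrow> k \<le> N" if N: "N \<ge> N0" for N k
  proof -
    have d: "cmod (rho (Suc k) - of_nat k) \<le> A / real (Suc k)" using rho[of "Suc k"] by simp
    have up: "cmod (rho (Suc k)) \<le> real k + cmod (rho (Suc k) - of_nat k)"
      using norm_triangle_ineq[of "of_nat k" "rho (Suc k) - of_nat k"] by simp
    have lo: "real k \<le> cmod (rho (Suc k)) + cmod (rho (Suc k) - of_nat k)"
      using norm_triangle_ineq4[of "rho (Suc k)" "rho (Suc k) - of_nat k"] by simp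
    have "cmod ((rho (Suc k))\<^sup>2) < (real N + 1/2)\<^sup>2 \<longleftrightarrow> cmod (rho (Suc k)) < real N + 1/2"
      unfolding norm_power by (intro iffI power_strict_mono) (auto intro: power_less_imp_less_base)
    also have "\<dots> \<longleftrightarrow> k \<le> N"
    proof (cases "k \<ge> k0")
      case True
      then have "A / real (Suc k) \<le> 1 / 4" using k0 by (simp add: divide_le_eq)
      then have "cmod (rho (Suc k) - of_nat k) \<le> 1 / 4" using d by linarith
      then show ?thesis using up lo by linarith
    next
      case False
      have "A / real (Suc k) \<le> A / 1" using A by (intro divide_left_mono) auto
      then have "cmod (rho (Suc k)) \<le> real k + A" using up d by linarith
      moreover have "real k + A \<le> real N" using False N0 N by linarith
      moreover have "k \<le> N" using \<open>real k + A \<le> real N\<close> A by linarith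
      ultimately show ?thesis by linarith
    qed
    finally show ?thesis .
  qed
  then show ?thesis unfolding eventually_sequentially by blast
qed

text \<open>For large \<open>n\<close> the norming integral is at least 1 in modulus, so its inverse
  inherits the rate. An eventually bounded sequence is bounded, which settles the small
  \<open>n\<close> together with the exceptional free weight at \<open>n = 1\<close>.\<close>

lemma (in sturm_liouville) alpha_asymptotics:
  assumes A: "A \<ge> 0" and rho: "\<And>n. n \<ge> 1 \<Longrightarrow> cmod (rho n - of_nat (n - 1)) \<le> A / real n"
  obtains A' where "A' \<ge> 0" "\<And>n al. n \<ge> 1 \<Longrightarrow> cmod (alpha q h rho n - aa al n 1) \<le> A' / real n"
proof -
  define J where "J n = integral {0..pi} (\<lambda>t. (f t ((rho n)\<^sup>2))\<^sup>2)" for n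
  have alJ: "alpha q h rho n = inverse (J n)" for n
    by (simp add: alpha_def J_def phi_eq_ivp f_def)
  obtain C where C: "C \<ge> 0" "\<forall>\<^sub>F n in sequentially. cmod (J n - of_real (pi / 2)) \<le> C / real n"
    using norming_asymptotics[OF A rho] unfolding J_def by blast
  have big: "\<forall>\<^sub>F n in sequentially. real n \<ge> 2 * C + 2"
  proof -
    obtain N :: nat where "2 * C + 2 \<le> real N" using real_arch_simple by blast
    then have "2 * C + 2 \<le> real n" if "n \<ge> N" for n using that by (meson of_nat_mono order_trans)
    then show ?thesis unfolding eventually_sequentially by blast
  qed
  \<comment> \<open>The zero function is a placeholder: with second index 1, \<open>aa\<close>
    returns the free weight whatever its first argument is.\<close>
  define X where "X n = of_nat n * (alpha q h rho n - aa (\<lambda>_. 0) n 1)" for n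
  have "\<forall>\<^sub>F n in sequentially. cmod (X n) \<le> norm C"
    using C(2) big
  proof eventually_elim
    case (elim n)
    then have n: "real n \<ge> 2" "real n > 0" using C(1) by linarith+
    have "C / real n \<le> 1 / 2" using elim n by (simp add: divide_le_eq)
    then have "cmod (J n - of_real (pi / 2)) \<le> 1 / 2" using elim(1) by linarith
    moreover have "pi / 2 \<le> cmod (J n) + cmod (J n - of_real (pi / 2))"
      using norm_triangle_ineq4[of "J n" "J n - of_real (pi / 2)"] by simp
    ultimately have J1: "cmod (J n) \<ge> 1" using pi_gt3 by linarith
    then have J0: "J n \<noteq> 0" by auto
    have "alpha q h rho n - aa (\<lambda>_. 0) n 1 = (of_real (pi / 2) - J n) / (J n * of_real (pi / 2))"
      using n J0 by (simp add: alJ aa_def field_simps)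
    also have "cmod \<dots> = cmod (J n - of_real (pi / 2)) / (cmod (J n) * (pi / 2))"
      unfolding norm_divide norm_mult by (subst norm_minus_commute) simp
    also have "\<dots> \<le> (C / real n) / (1 * 1)"
      using elim(1) J1 pi_gt3 C(1) by (intro frac_le mult_mono) auto
    finally have "real n * cmod (alpha q h rho n - aa (\<lambda>_. 0) n 1) \<le> real n * (C / real n)"
      using n by (intro mult_left_mono) auto
    then show ?case using n C(1) by (simp add: X_def norm_mult)
  qed
  then have "Bseq X" by (rule Bseq_eventually_mono[where g = "\<lambda>_. C"]) simp
  then obtain A' where A': "A' > 0" "\<And>n. cmod (X n) \<le> A'" by (auto simp: Bseq_def)
  show ?thesis
  proof (rule that[of A'])
    fix n :: nat and al assume n: "n \<ge> 1"
    have "real n * cmod (alpha q h rho n - aa al n 1) \<le> A'"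
      using A'(2)[of n] by (simp add: X_def norm_mult aa_def)
    then show "cmod (alpha q h rho n - aa al n 1) \<le> A' / real n"
      using n by (simp add: pos_le_divide_eq mult.commute)
  qed (use A' in simp)
qed

lemma cmod_aa_1_le: "cmod (aa al n 1) \<le> 1"
  using pi_gt3 by (simp add: aa_def norm_divide)

theorem theorem3p4:
  fixes q :: "real \<Rightarrow> complex" and h H :: complex and rho :: "nat \<Rightarrow> complex" and x :: real
  assumes q_L2: "q measurable_on {0..pi}" "(\<lambda>t. (cmod (q t))^2) integrable_on {0..pi}"
    and simple: "\<forall>lam. is_eigenvalue q h H lam \<longrightarrow> simple_eigenvalue q h H lam"
    and numbering: "spectral_numbering q h H rho"
    and x: "x \<in> {0..pi}"
  shows "in_m (psiv (phi q h) rho x) \<and> in_m (psiv phi0 rho x) \<and>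
         bounded_op_m (Rm (phi q h) rho (alpha q h rho) x) \<and>
         bounded_op_m (Rm phi0 rho (alpha q h rho) x) \<and>
         psiv phi0 rho x = I_plus (Rm phi0 rho (alpha q h rho) x) (psiv (phi q h) rho x) \<and>
         (\<forall>a. in_m a \<longrightarrow>
             I_plus (Rm phi0 rho (alpha q h rho) x) (I_minus (Rm (phi q h) rho (alpha q h rho) x) a) = a \<and>
             I_minus (Rm (phi q h) rho (alpha q h rho) x) (I_plus (Rm phi0 rho (alpha q h rho) x) a) = a) \<and>
         (\<exists>!a. in_m a \<and> psiv phi0 rho x = I_plus (Rm phi0 rho (alpha q h rho) x) a)"
proof -
  let ?al = "alpha q h rho"
  interpret L0: sturm_liouville q h H
    by unfold_locales (rule square_integrable_imp_absolutely_integrable[OF q_L2])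
  obtain A0 where A0: "A0 \<ge> 0" "\<And>n. n \<ge> 1 \<Longrightarrow> cmod (rho n - of_nat (n - 1)) \<le> A0 / real n"
    by (rule spectral_numbering_bound[OF numbering]) (erule that)
  obtain A1 where A1: "A1 \<ge> 0" "\<And>n al. n \<ge> 1 \<Longrightarrow> cmod (?al n - aa al n 1) \<le> A1 / real n"
    by (rule L0.alpha_asymptotics[OF A0]) (assumption, erule that)
  \<comment> \<open>The shift translates the numbering from 1 into the indexing from 0 used by the
    locales.\<close>
  define lam where "lam k = (rho (Suc k))\<^sup>2" for k
  have range: "{z. L0.Del z = 0} = range lam"
  proof -
    have "{z. is_eigenvalue q h H z} = {rho n ^ 2 | n. n \<ge> 1}"
      using numbering unfolding spectral_numbering_def by blast
    also have "\<dots> = range lam"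
    proof
      show "{rho n ^ 2 | n. n \<ge> 1} \<subseteq> range lam"
      proof
        fix z assume "z \<in> {rho n ^ 2 | n. n \<ge> 1}"
        then obtain n where "n \<ge> 1" "z = rho n ^ 2" by blast
        then show "z \<in> range lam" by (intro image_eqI[of _ _ "n - 1"]) (auto simp: lam_def)
      qed
    qed (auto simp: lam_def)
    finally show ?thesis by (simp add: L0.Del_eq_0_iff)
  qed
  interpret sturm_pair q h H lam "\<lambda>_. 0" 0 0 "\<lambda>k. (of_nat k)\<^sup>2"
  proof (intro sturm_pair.intro)
    show "sturm_spectral q h H lam"
    proof
      show "{z. L0.Del z = 0} = range lam" by (rule range)
      have "inj_on (\<lambda>n. rho n ^ 2) {1..}" using numbering unfolding spectral_numbering_def by blast
      then show "inj lam" by (auto simp: inj_on_def lam_def)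
      show "integral {0..pi} (\<lambda>t. (L0.f t (lam k))\<^sup>2) \<noteq> 0" for k
      \<comment> \<open>Here simplicity of the eigenvalues enters: the characteristic function is
        \<open>Del\<close>, whose derivative controls the norming integral.\<close>
      proof (rule L0.norming_nonzero)
        show 0: "L0.Del (lam k) = 0" using range by blast
        then show "deriv L0.Del (lam k) \<noteq> 0"
          using simple unfolding L0.Del_eq_0_iff simple_eigenvalue_def L0.char_fun_eq_Del by blast
      qed
      show "\<forall>\<^sub>F N in sequentially. \<forall>k. cmod (lam k) < (real N + 1/2)\<^sup>2 \<longleftrightarrow> k \<le> N"
        unfolding lam_def by (rule eventually_count_nodes[OF A0])
    qed
    show "sturm_spectral (\<lambda>_. 0) 0 0 (\<lambda>k. (of_nat k)\<^sup>2)" by (rule sturm_spectral_free)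
  qed
  have alL: "aa ?al (Suc k) 0 = L.al k" for k
    by (simp add: aa_def alpha_def L.al_def lam_def phi_eq_ivp L0.f_def)
  have alM: "aa ?al (Suc k) 1 = free.al k" for k by (rule free_al[symmetric])
  have node0: "(rr rho (Suc k) 0)\<^sup>2 = lam k" and node1: "(rr rho (Suc k) 1)\<^sup>2 = (of_nat k)\<^sup>2" for k
    by (simp_all add: rr_def lam_def)
  \<comment> \<open>\<open>A0\<close> bounds the deviation of the nodes and \<open>A1\<close> that
    of the weights; 1 bounds the free weights, which are at most \<open>2 / pi\<close>.\<close>
  define A where "A = A0 + A1 + 1"
  have nodes: "nodes rho ?al A"
  proof
    show "A \<ge> 0" using A0(1) A1(1) by (simp add: A_def)
    fix n :: nat assume n: "n \<ge> 1"
    have le: "A0 / real n \<le> A / real n" "A1 / real n \<le> A / real n" using A0(1) A1(1) by (auto simp: A_def intro: divide_right_mono)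
    show "cmod (rhat rho n) \<le> A / real n" using A0(2)[OF n] le by (simp add: rhat_def rr_def)
    show "cmod (aa ?al n 0 - aa ?al n 1) \<le> A / real n" using A1(2)[OF n, of ?al] le by (simp add: aa_def)
    show "cmod (aa ?al n i) \<le> A" for i
    proof (cases "i = 0")
      case True
      have "A1 / real n \<le> A1 / 1" using n A1(1) by (intro divide_left_mono) auto
      then have "cmod (?al n) \<le> A1 + 1"
        using A1(2)[OF n, of ?al] cmod_aa_1_le[of ?al n] norm_triangle_ineq[of "?al n - aa ?al n 1" "aa ?al n 1"] by simp
      then show ?thesis using True A0(1) by (simp add: aa_def A_def)
    next
      case False
      then have "aa ?al n i = aa ?al n 1" by (simp add: aa_def)
      then show ?thesis using cmod_aa_1_le[of ?al n] A0(1) A1(1) by (simp add: A_def)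
    qed
  qed
  interpret nodes rho ?al A by (rule nodes)
  define E where "E r s = free.D x (r\<^sup>2) (s\<^sup>2)" for r s
  define G where "G r s = L0.D x (r\<^sup>2) (s\<^sup>2)" for r s
  define e where "e r = free.f x (r\<^sup>2)" for r
  define g where "g r = L0.f x (r\<^sup>2)" for r
  have kE: "kernel E" unfolding E_def[abs_def] by (rule free.kernel_D[OF x nodes])
  have kG: "kernel G" unfolding G_def[abs_def] by (rule L0.kernel_D[OF x nodes])
  have he: "e holomorphic_on UNIV" unfolding e_def[abs_def] by (rule holomorphic_on_compose_square) (rule free.holomorphic_fc(1)[OF x])
  have hg: "g holomorphic_on UNIV" unfolding g_def[abs_def] by (rule holomorphic_on_compose_square) (rule L0.holomorphic_fc(1)[OF x])
  have inB: "cmod (z - of_nat (l - 1)) \<le> A + 1" if "z \<in> B l" for z l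
    using that by (simp add: B_def rr_def dist_norm norm_minus_commute)
  obtain Kg where Kg: "\<And>l z. z \<in> B l \<Longrightarrow> cmod (g z) \<le> Kg"
    using L0.f_bounded_near_integers[OF x, of "A + 1"] A inB unfolding g_def by (metis add_nonneg_nonneg zero_le_one)
  obtain Ke where Ke: "\<And>l z. z \<in> B l \<Longrightarrow> cmod (e z) \<le> Ke"
    using free.f_bounded_near_integers[OF x, of "A + 1"] A inB unfolding e_def by (metis add_nonneg_nonneg zero_le_one)
  have DG: "DD (phi q h) x = G"
    by (intro ext) (simp add: DD_def G_def L0.D_def phi_eq_ivp L0.f_def)
  have DE: "DD phi0 x = E"
  proof (intro ext)
    fix r s
    show "DD phi0 x r s = E r s"
      unfolding DD_def E_def free.D_def phi0_def using x by (intro integral_cong) (simp add: free_f)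
  qed
  have P: "Rm phi0 rho ?al x = Mat rho ?al E"
    using kE unfolding kernel_def by (intro ext) (simp add: Rm_eq_Mat DE)
  have Q: "Rm (phi q h) rho ?al x = Mat rho ?al G"
    using kG unfolding kernel_def by (intro ext) (simp add: Rm_eq_Mat DG)
  have psi: "psiv (phi q h) rho x = (\<lambda>n i. if n \<ge> 1 \<and> i < 2 then Lam rho n i g else 0)"
  proof -
    have "phi q h x = g" by (intro ext) (simp add: phi_eq_ivp g_def L0.f_def)
    then show ?thesis by (intro ext) (simp add: psiv_eq_Lam)
  qed
  have psit: "psiv phi0 rho x = (\<lambda>n i. if n \<ge> 1 \<and> i < 2 then Lam rho n i e else 0)"
  proof -
    have "phi0 x = e" by (intro ext) (simp add: phi0_def e_def free_f[OF x])
    then show ?thesis by (intro ext) (simp add: psiv_eq_Lam)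
  qed
  have col: "col rho ?al (Suc l) 1 u = L.al l * u (rr rho (Suc l) 0) - free.al l * u (rr rho (Suc l) 1)" for l u
    by (simp add: col_def alL alM[unfolded One_nat_def])
  have EG: "(\<lambda>l. col rho ?al (Suc l) 1 (\<lambda>z. E r z * G z s)) sums (E r s - G r s)" for r s
    using product_identity[OF x, of "r\<^sup>2" "s\<^sup>2"] unfolding E_def G_def col node0 node1 mult.assoc .
  \<comment> \<open>\<open>EG\<close> transposed: both kernels are symmetric, so one scalar identity
    serves both orders of multiplication.\<close>
  have GE: "(\<lambda>l. col rho ?al (Suc l) 1 (\<lambda>z. G r z * E z s)) sums (E r s - G r s)" for r s
  proof -
    have sym: "E u v = E v u" "G u v = G v u" for u v
      unfolding E_def G_def by (rule free.D_commute, rule L0.D_commute)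
    have "(\<lambda>z. G r z * E z s) = (\<lambda>z. E s z * G z r)"
      using sym(1)[of s] sym(2)[of r] by (intro ext) simp
    then show ?thesis using EG[of s r] unfolding sym(1)[of s r] sym(2)[of s r] by simp
  qed
  have eg: "(\<lambda>l. col rho ?al (Suc l) 1 (\<lambda>z. E r z * g z)) sums (e r - g r)" for r
    using solution_identity[OF x, of "r\<^sup>2"]
    unfolding E_def e_def g_def col node0 node1 mult.assoc free.D_commute[of x "r\<^sup>2"] .
  note main = main_equation_abstract[OF kE kG he hg _ EG GE eg P Q psi psit, of Kg]
  have in1: "in_m (psiv (phi q h) rho x)" unfolding psi by (rule in_m_Lam[OF hg Kg])
  have in2: "in_m (psiv phi0 rho x)" unfolding psit by (rule in_m_Lam[OF he Ke])
  have b: "bounded_op_m (Rm phi0 rho ?al x)" "bounded_op_m (Rm (phi q h) rho ?al x)"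
    by (rule main(1), rule Kg, assumption) (rule main(2), rule Kg)
  have eq: "psiv phi0 rho x = I_plus (Rm phi0 rho ?al x) (psiv (phi q h) rho x)"
    by (rule main(3)) (rule Kg)
  have inv: "I_plus (Rm phi0 rho ?al x) (I_minus (Rm (phi q h) rho ?al x) a) = a"
    "I_minus (Rm (phi q h) rho ?al x) (I_plus (Rm phi0 rho ?al x) a) = a" if a: "in_m a" for a
    by (rule main(4)[OF _ a], rule Kg, assumption) (rule main(5)[OF _ a], rule Kg)
  have "\<exists>!a. in_m a \<and> psiv phi0 rho x = I_plus (Rm phi0 rho ?al x) a"
  \<comment> \<open>Uniqueness follows by applying the inverse operator to both sides of the
    equation.\<close>
  proof (rule ex1I[of _ "psiv (phi q h) rho x"])
    show "a = psiv (phi q h) rho x" if "in_m a \<and> psiv phi0 rho x = I_plus (Rm phi0 rho ?al x) a" for a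
      using inv(2)[of a] inv(2)[OF in1] that eq by metis
  qed (use in1 eq in blast)
  then show ?thesis using in1 in2 b eq inv by blast
qed

end
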